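(* Let $L$ be a non-commutative algebra which is either a free associative algebra (unital or not) of finite rank over a field $K$, or a free Lie algebra of finite rank over a field $K$, or the group algebra over a field $K$ of a torsion-free hyperbolic group. Then the field $K$ together with its action on $L$ is $0$-interpretable in $L$.
   Context: $L$ is viewed as a ring in the language $\{+,\cdot,0\}$. A structure $\mathbb{A}$ is $0$-interpretable in a structure $\mathbb{B}$ if there are a subset $A^*\subseteq B^m$ and an equivalence relation $\sim$ on $A^*$, both definable in $\mathbb{B}$ by first-order formulas without parameters, and operations, predicates and constants on $A^*/\sim$ whose preimages in $A^*$ are definable without parameters in $\mathbb{B}$, such that the resulting structure is isomorphic to $\mathbb{A}$. "The field $K$ and its action on $L$" means the two-sorted structure consisting of the field $K$, the ring $L$, and the scalar multiplication $K\times L\to L$. *)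

theory Defs
  imports "HOL-Library.Poly_Mapping" "HOL-Algebra.Generated_Groups" Complex_Main
begin

section \<open>First-order logic of rings in the language of addition, multiplication and zero\<close>

record 'a rng_struct =
  dom :: "'a set"
  rzero :: 'a
  radd :: "'a \<Rightarrow> 'a \<Rightarrow> 'a"
  rmul :: "'a \<Rightarrow> 'a \<Rightarrow> 'a"

datatype rterm = Var nat | Zero | Plus rterm rterm | Times rterm rterm

datatype rform = Eq rterm rterm | Neg rform | Conj rform rform | Ex nat rform

primrec tvars :: "rterm \<Rightarrow> nat set" where
  "tvars (Var i) = {i}"
| "tvars Zero = {}"
| "tvars (Plus s t) = tvars s \<union> tvars t"
| "tvars (Times s t) = tvars s \<union> tvars t"

primrec fvars :: "rform \<Rightarrow> nat set" where
  "fvars (Eq s t) = tvars s \<union> tvars t"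
| "fvars (Neg p) = fvars p"
| "fvars (Conj p q) = fvars p \<union> fvars q"
| "fvars (Ex i p) = fvars p - {i}"

primrec tval :: "('a, 'z) rng_struct_scheme \<Rightarrow> (nat \<Rightarrow> 'a) \<Rightarrow> rterm \<Rightarrow> 'a" where
  "tval B e (Var i) = e i"
| "tval B e Zero = rzero B"
| "tval B e (Plus s t) = radd B (tval B e s) (tval B e t)"
| "tval B e (Times s t) = rmul B (tval B e s) (tval B e t)"

primrec sat :: "('a, 'z) rng_struct_scheme \<Rightarrow> (nat \<Rightarrow> 'a) \<Rightarrow> rform \<Rightarrow> bool" where
  "sat B e (Eq s t) \<longleftrightarrow> tval B e s = tval B e t"
| "sat B e (Neg p) \<longleftrightarrow> \<not> sat B e p"
| "sat B e (Conj p q) \<longleftrightarrow> sat B e p \<and> sat B e q"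
| "sat B e (Ex i p) \<longleftrightarrow> (\<exists>x\<in>dom B. sat B (e(i := x)) p)"

text \<open>Subsets of the power \<open>B\<^sup>m\<close> are sets of lists of length \<open>m\<close>; the coordinates of the list are the
  values of the variables with indices \<open>0, \<dots>, m - 1\<close>. No parameters from \<open>B\<close> are allowed.\<close>

definition definable :: "('a, 'z) rng_struct_scheme \<Rightarrow> nat \<Rightarrow> 'a list set \<Rightarrow> bool" where
  "definable B m D \<longleftrightarrow>
     D \<subseteq> {xs. length xs = m \<and> set xs \<subseteq> dom B} \<and>
     (\<exists>p. fvars p \<subseteq> {..<m} \<and>
        (\<forall>e. range e \<subseteq> dom B \<longrightarrow> (sat B e p \<longleftrightarrow> map e [0..<m] \<in> D)))"


section \<open>Interpretations of many-sorted structures\<close>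

text \<open>Sorts are the elements of \<open>'s\<close>, symbols those of \<open>'r\<close>. Operations are represented by their
  graphs and constants by singletons. Only the members of \<open>rel A r\<close> that are well-sorted with
  respect to \<open>arity A r\<close> matter.\<close>

record ('s, 'r, 'u) sorted_struct =
  univ :: "'s \<Rightarrow> 'u set"
  arity :: "'r \<Rightarrow> 's list"
  rel :: "'r \<Rightarrow> 'u list set"

definition sorted_iso ::
  "('s, 'r, 'u) sorted_struct \<Rightarrow> ('s, 'r, 'v) sorted_struct \<Rightarrow> bool" where
  "sorted_iso A Q \<longleftrightarrow>
     arity Q = arity A \<and>
     (\<exists>h. (\<forall>s. bij_betw (h s) (univ A s) (univ Q s)) \<and>
          (\<forall>r us. list_all2 (\<lambda>s u. u \<in> univ A s) (arity A r) us \<longrightarrow>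
             (us \<in> rel A r \<longleftrightarrow> map2 h (arity A r) us \<in> rel Q r)))"

text \<open>Each sort \<open>s\<close> is interpreted by a definable set \<open>D s\<close> of \<open>m s\<close>-tuples modulo a definable
  equivalence relation \<open>E s\<close>; \<open>Q\<close> is the resulting structure on the quotients \<open>D s // E s\<close>.\<close>

definition zero_interpretable ::
  "('s, 'r, 'u) sorted_struct \<Rightarrow> ('a, 'z) rng_struct_scheme \<Rightarrow> bool" where
  "zero_interpretable A B \<longleftrightarrow>
     (\<exists>(m :: 's \<Rightarrow> nat) (D :: 's \<Rightarrow> 'a list set) (E :: 's \<Rightarrow> ('a list \<times> 'a list) set)
        (Q :: ('s, 'r, 'a list set) sorted_struct).
        (\<forall>s. definable B (m s) (D s)) \<and>
        (\<forall>s. equiv (D s) (E s)) \<and>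
        (\<forall>s. definable B (m s + m s) {xs @ ys | xs ys. (xs, ys) \<in> E s}) \<and>
        (\<forall>s. univ Q s = D s // E s) \<and>
        (\<forall>r. definable B (\<Sum>s\<leftarrow>arity Q r. m s)
               {concat xss | xss.
                  list_all2 (\<lambda>s xs. xs \<in> D s) (arity Q r) xss \<and>
                  map2 (\<lambda>s xs. E s `` {xs}) (arity Q r) xss \<in> rel Q r}) \<and>
        sorted_iso A Q)"


section \<open>Algebras over a field\<close>

record ('k, 'a) kalg = "'a rng_struct" +
  scale :: "'k \<Rightarrow> 'a \<Rightarrow> 'a"

definition alg_iso :: "('k, 'a) kalg \<Rightarrow> ('k, 'b) kalg \<Rightarrow> bool" where
  "alg_iso A B \<longleftrightarrow>
     (\<exists>h. bij_betw h (dom A) (dom B) \<and>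
        h (rzero A) = rzero B \<and>
        (\<forall>x\<in>dom A. \<forall>y\<in>dom A. h (radd A x y) = radd B (h x) (h y)) \<and>
        (\<forall>x\<in>dom A. \<forall>y\<in>dom A. h (rmul A x y) = rmul B (h x) (h y)) \<and>
        (\<forall>c. \<forall>x\<in>dom A. h (scale A c x) = scale B c (h x)))"

definition noncommutative :: "('k, 'a) kalg \<Rightarrow> bool" where
  "noncommutative L \<longleftrightarrow> (\<exists>x\<in>dom L. \<exists>y\<in>dom L. rmul L x y \<noteq> rmul L y x)"

text \<open>For a Lie algebra, commutative means abelian. In characteristic different from 2, being
  non-abelian is the same as \<^const>\<open>noncommutative\<close>; in characteristic 2 every Lie bracket is
  symmetric.\<close>

definition nonabelian :: "('k, 'a) kalg \<Rightarrow> bool" where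
  "nonabelian L \<longleftrightarrow> (\<exists>x\<in>dom L. \<exists>y\<in>dom L. rmul L x y \<noteq> rzero L)"

text \<open>The two-sorted structure consisting of the field \<open>K\<close> (all of the type \<open>'k\<close>), the ring \<open>L\<close> and
  the scalar multiplication.\<close>

datatype action_sort = FieldSort | AlgSort

datatype action_symbol = KZero | KOne | KAdd | KMul | LZero | LAdd | LMul | Act

primrec action_univ :: "('k, 'a) kalg \<Rightarrow> action_sort \<Rightarrow> ('k + 'a) set" where
  "action_univ L FieldSort = range Inl"
| "action_univ L AlgSort = Inr ` dom L"

primrec action_arity :: "action_symbol \<Rightarrow> action_sort list" where
  "action_arity KZero = [FieldSort]"
| "action_arity KOne = [FieldSort]"
| "action_arity KAdd = [FieldSort, FieldSort, FieldSort]"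
| "action_arity KMul = [FieldSort, FieldSort, FieldSort]"
| "action_arity LZero = [AlgSort]"
| "action_arity LAdd = [AlgSort, AlgSort, AlgSort]"
| "action_arity LMul = [AlgSort, AlgSort, AlgSort]"
| "action_arity Act = [FieldSort, AlgSort, AlgSort]"

primrec action_rel :: "('k::field, 'a) kalg \<Rightarrow> action_symbol \<Rightarrow> ('k + 'a) list set" where
  "action_rel L KZero = {[Inl 0]}"
| "action_rel L KOne = {[Inl 1]}"
| "action_rel L KAdd = {[Inl a, Inl b, Inl (a + b)] | a b. True}"
| "action_rel L KMul = {[Inl a, Inl b, Inl (a * b)] | a b. True}"
| "action_rel L LZero = {[Inr (rzero L)]}"
| "action_rel L LAdd = {[Inr x, Inr y, Inr (radd L x y)] | x y. x \<in> dom L \<and> y \<in> dom L}"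
| "action_rel L LMul = {[Inr x, Inr y, Inr (rmul L x y)] | x y. x \<in> dom L \<and> y \<in> dom L}"
| "action_rel L Act = {[Inl a, Inr x, Inr (scale L a x)] | a x. x \<in> dom L}"

definition field_with_action ::
  "('k::field, 'a) kalg \<Rightarrow> (action_sort, action_symbol, 'k + 'a) sorted_struct" where
  "field_with_action L = \<lparr>univ = action_univ L, arity = action_arity, rel = action_rel L\<rparr>"


section \<open>The algebras with a multiplicative basis\<close>

text \<open>The product of finitely supported functions extending bilinearly an operation \<open>f\<close> on the
  index type, and the algebra with basis \<open>M\<close> (a set closed under \<open>f\<close>) that it defines.\<close>

definition convolve :: "('b \<Rightarrow> 'b \<Rightarrow> 'b) \<Rightarrow>
    ('b \<Rightarrow>\<^sub>0 'k::semiring_0) \<Rightarrow> ('b \<Rightarrow>\<^sub>0 'k) \<Rightarrow> ('b \<Rightarrow>\<^sub>0 'k)" where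
  "convolve f p q =
     (\<Sum>u\<in>Poly_Mapping.keys p. \<Sum>v\<in>Poly_Mapping.keys q.
        Poly_Mapping.single (f u v) (Poly_Mapping.lookup p u * Poly_Mapping.lookup q v))"

definition magma_algebra ::
  "'b set \<Rightarrow> ('b \<Rightarrow> 'b \<Rightarrow> 'b) \<Rightarrow> ('k::field, 'b \<Rightarrow>\<^sub>0 'k) kalg" where
  "magma_algebra M f =
     \<lparr>dom = {p. Poly_Mapping.keys p \<subseteq> M}, rzero = 0, radd = (+), rmul = convolve f,
      scale = (\<lambda>c. Poly_Mapping.map ((*) c))\<rparr>"

text \<open>Free associative algebras on the generators \<open>0, \<dots>, n - 1\<close>: the basis consists of all words,
  respectively of all nonempty words.\<close>

definition free_assoc_unital :: "nat \<Rightarrow> ('k::field, nat list \<Rightarrow>\<^sub>0 'k) kalg" where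
  "free_assoc_unital n = magma_algebra (lists {..<n}) (@)"

definition free_assoc_nonunital :: "nat \<Rightarrow> ('k::field, nat list \<Rightarrow>\<^sub>0 'k) kalg" where
  "free_assoc_nonunital n = magma_algebra (lists {..<n} - {[]}) (@)"

definition group_algebra :: "('g, 'z) monoid_scheme \<Rightarrow> ('k::field, 'g \<Rightarrow>\<^sub>0 'k) kalg" where
  "group_algebra G = magma_algebra (carrier G) (mult G)"


section \<open>Free Lie algebras\<close>

text \<open>The free Lie algebra of rank \<open>n\<close> is the quotient of the free non-associative algebra on \<open>n\<close>
  generators by the ideal generated by all squares and all Jacobi expressions.\<close>

datatype 'x magma = Gen 'x | Br "'x magma" "'x magma"

definition free_nonassoc :: "nat \<Rightarrow> ('k::field, nat magma \<Rightarrow>\<^sub>0 'k) kalg" where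
  "free_nonassoc n = magma_algebra {t. set_magma t \<subseteq> {..<n}} Br"

inductive_set lie_ideal :: "nat \<Rightarrow> (nat magma \<Rightarrow>\<^sub>0 'k::field) set" for n :: nat where
  square: "a \<in> dom (free_nonassoc n) \<Longrightarrow> convolve Br a a \<in> lie_ideal n"
| jacobi: "a \<in> dom (free_nonassoc n) \<Longrightarrow> b \<in> dom (free_nonassoc n) \<Longrightarrow>
    c \<in> dom (free_nonassoc n) \<Longrightarrow>
    convolve Br (convolve Br a b) c + convolve Br (convolve Br b c) a
      + convolve Br (convolve Br c a) b \<in> lie_ideal n"
| zero: "0 \<in> lie_ideal n"
| add: "p \<in> lie_ideal n \<Longrightarrow> q \<in> lie_ideal n \<Longrightarrow> p + q \<in> lie_ideal n"
| scale: "p \<in> lie_ideal n \<Longrightarrow> Poly_Mapping.map ((*) c) p \<in> lie_ideal n"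
| left: "a \<in> dom (free_nonassoc n) \<Longrightarrow> p \<in> lie_ideal n \<Longrightarrow> convolve Br a p \<in> lie_ideal n"
| right: "a \<in> dom (free_nonassoc n) \<Longrightarrow> p \<in> lie_ideal n \<Longrightarrow> convolve Br p a \<in> lie_ideal n"

text \<open>Quotient by an ideal \<open>I\<close>. The unions below are unions of equal cosets.\<close>

definition ideal_coset :: "('k, 'a::minus) kalg \<Rightarrow> 'a set \<Rightarrow> 'a \<Rightarrow> 'a set" where
  "ideal_coset A I p = {q \<in> dom A. q - p \<in> I}"

definition quotient_algebra :: "('k, 'a::minus) kalg \<Rightarrow> 'a set \<Rightarrow> ('k, 'a set) kalg" where
  "quotient_algebra A I =
     \<lparr>dom = ideal_coset A I ` dom A,
      rzero = ideal_coset A I (rzero A),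
      radd = (\<lambda>X Y. \<Union>p\<in>X. \<Union>q\<in>Y. ideal_coset A I (radd A p q)),
      rmul = (\<lambda>X Y. \<Union>p\<in>X. \<Union>q\<in>Y. ideal_coset A I (rmul A p q)),
      scale = (\<lambda>c X. \<Union>p\<in>X. ideal_coset A I (scale A c p))\<rparr>"

definition free_lie :: "nat \<Rightarrow> ('k::field, (nat magma \<Rightarrow>\<^sub>0 'k) set) kalg" where
  "free_lie n = quotient_algebra (free_nonassoc n) (lie_ideal n)"


section \<open>Torsion-free hyperbolic groups\<close>

definition torsion_free :: "('g, 'z) monoid_scheme \<Rightarrow> bool" where
  "torsion_free G \<longleftrightarrow>
     (\<forall>g\<in>carrier G. g \<noteq> \<one>\<^bsub>G\<^esub> \<longrightarrow> (\<forall>n::nat. n > 0 \<longrightarrow> g [^]\<^bsub>G\<^esub> n \<noteq> \<one>\<^bsub>G\<^esub>))"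

definition word_length :: "('g, 'z) monoid_scheme \<Rightarrow> 'g set \<Rightarrow> 'g \<Rightarrow> nat" where
  "word_length G S g =
     (LEAST n. \<exists>ws. length ws = n \<and> set ws \<subseteq> S \<union> m_inv G ` S \<and> foldr (mult G) ws \<one>\<^bsub>G\<^esub> = g)"

definition word_dist :: "('g, 'z) monoid_scheme \<Rightarrow> 'g set \<Rightarrow> 'g \<Rightarrow> 'g \<Rightarrow> nat" where
  "word_dist G S x y = word_length G S (inv\<^bsub>G\<^esub> x \<otimes>\<^bsub>G\<^esub> y)"

definition gromov_product :: "('g, 'z) monoid_scheme \<Rightarrow> 'g set \<Rightarrow> 'g \<Rightarrow> 'g \<Rightarrow> 'g \<Rightarrow> real" where
  "gromov_product G S w x y =
     (real (word_dist G S x w) + real (word_dist G S y w) - real (word_dist G S x y)) / 2"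

text \<open>Gromov's definition: the word metric of some finite generating set satisfies the four-point
  condition for some \<open>\<delta>\<close>.\<close>

definition hyperbolic_group :: "('g, 'z) monoid_scheme \<Rightarrow> bool" where
  "hyperbolic_group G \<longleftrightarrow>
     group G \<and>
     (\<exists>S \<delta>. finite S \<and> S \<subseteq> carrier G \<and> generate G S = carrier G \<and>
        (\<forall>w\<in>carrier G. \<forall>x\<in>carrier G. \<forall>y\<in>carrier G. \<forall>z\<in>carrier G.
           gromov_product G S w x z
             \<ge> min (gromov_product G S w x y) (gromov_product G S w y z) - \<delta>))"

end

theory Submission
  imports Defs "HOL-Library.List_Lexorder"
begin

text \<open>
  A scalar \<open>a\<close> is coded by the pairs \<open>(x, a x)\<close> with \<open>x\<close> in a definable set of nonzero elements. So it is
  enough to define, without parameters, the relation saying that \<open>y\<close> and \<open>w\<close> are the same multiples of \<open>x\<close>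
  and \<open>z\<close>; the field operations and the action are then first-order in this relation.

  In the unital free associative algebra and in the group algebra the center is \<open>K\<close>, so \<open>x = 1\<close>, \<open>y\<close> is
  central and \<open>w = y z\<close>. A central element of the group algebra is supported on elements with finitely many
  conjugates. A nontrivial such element of a torsion-free hyperbolic group has a power generating a
  subgroup of finite index, and a torsion-free group that is virtually cyclic is commutative by transfer.

  In the nonunital free associative algebra \<open>L\<close>, comparing degrees shows that nonzero \<open>x\<close> and \<open>y\<close> are
  proportional iff \<open>x L\<close> and \<open>y L\<close> are contained in each other, and \<open>w\<close> is given by \<open>y z = x w\<close>.

  The free Lie algebra is spanned by the standard bracketings of Lyndon words, whose values in the free
  associative algebra have distinct leading words. Hence it embeds there, with Lyndon leading words. As
  \<open>u v \<noteq> v u\<close> for distinct Lyndon words, the centralizer of a nonzero \<open>x\<close> is \<open>K x\<close>, which defines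
  proportionality.
\<close>

section \<open>Coding scalars by proportional pairs\<close>

text \<open>No nonzero element of \<open>L\<close> need be definable, so a scalar cannot be read off
  at one fixed base point. Pairs with varying base points are compared by the four-place relation
  instead: two codes are equal when they are related, a sum is formed after moving both scalars to a
  common base point, and a product by applying one scalar to the second component of the other code.

  For the free Lie algebra, the obstacle is that its relations are given only by generators of an
  ideal. That nothing else dies in the free associative algebra needs both spanning (by rewriting)
  and independence (by leading words) of the standard bracketings. Their leading coefficients are 1,
  so the characteristic never enters.

  For groups, the argument uses only the four-point inequality, not boundaries or quasi-geodesics.
  It turns on whether \<open>len (g \<otimes> g)\<close> exceeds \<open>len g\<close> by more than
  \<open>4 * \<delta>\<close>. This threshold is the sum of the errors \<open>2 * \<delta>\<close>
  of the two inequalities by which a point far from all powers of an element would be nearer to a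
  neighboring power than to its nearest one.\<close>

definition expressible :: "('a, 'z) rng_struct_scheme \<Rightarrow> nat set \<Rightarrow> ((nat \<Rightarrow> 'a) \<Rightarrow> bool) \<Rightarrow> bool" where
  "expressible B V P \<longleftrightarrow>
     (\<exists>p. fvars p \<subseteq> V \<and> (\<forall>e. range e \<subseteq> dom B \<longrightarrow> (sat B e p \<longleftrightarrow> P e)))"

lemma expressible_eq:
  "tvars s \<union> tvars t \<subseteq> V \<Longrightarrow> expressible B V (\<lambda>e. tval B e s = tval B e t)"
  unfolding expressible_def by (rule exI[of _ "Eq s t"]) auto

lemma expressible_not: "expressible B V P \<Longrightarrow> expressible B V (\<lambda>e. \<not> P e)"
  unfolding expressible_def by (metis fvars.simps(2) sat.simps(2))

lemma expressible_conj:
  assumes "expressible B V P" "expressible B V Q" shows "expressible B V (\<lambda>e. P e \<and> Q e)"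
proof -
  obtain p q where "fvars p \<subseteq> V" "\<forall>e. range e \<subseteq> dom B \<longrightarrow> (sat B e p \<longleftrightarrow> P e)"
    "fvars q \<subseteq> V" "\<forall>e. range e \<subseteq> dom B \<longrightarrow> (sat B e q \<longleftrightarrow> Q e)"
    using assms unfolding expressible_def by blast
  then show ?thesis
    unfolding expressible_def by (intro exI[of _ "Conj p q"]) auto
qed

lemma expressible_ex:
  assumes "expressible B (insert i V) P"
  shows "expressible B V (\<lambda>e. \<exists>x\<in>dom B. P (e(i := x)))"
proof -
  obtain p where p: "fvars p \<subseteq> insert i V" "\<And>e. range e \<subseteq> dom B \<Longrightarrow> (sat B e p \<longleftrightarrow> P e)"
    using assms unfolding expressible_def by blast
  have "range (e(i := x)) \<subseteq> dom B" if "range e \<subseteq> dom B" "x \<in> dom B" for e x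
    using that by auto
  then show ?thesis
    unfolding expressible_def using p by (intro exI[of _ "Ex i p"]) auto
qed

lemma expressible_mono: "expressible B V P \<Longrightarrow> V \<subseteq> W \<Longrightarrow> expressible B W P"
  unfolding expressible_def by blast

lemma expressible_cong:
  assumes "expressible B V P" "\<And>e. range e \<subseteq> dom B \<Longrightarrow> P e \<longleftrightarrow> Q e" shows "expressible B V Q"
  using assms unfolding expressible_def by blast

lemma expressible_all:
  assumes "expressible B (insert i V) P"
  shows "expressible B V (\<lambda>e. \<forall>x\<in>dom B. P (e(i := x)))"
  using expressible_not[OF expressible_ex[OF expressible_not[OF assms]]] by simp

lemma definable_iff_expressible:
  "definable B m D \<longleftrightarrow> D \<subseteq> {xs. length xs = m \<and> set xs \<subseteq> dom B} \<and>
     expressible B {..<m} (\<lambda>e. map e [0..<m] \<in> D)"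
  unfolding definable_def expressible_def by blast

text \<open>Truth of formulas is invariant under isomorphism. The closure of \<open>dom A\<close>
  enters because \<open>h\<close> respects the operations only there, so every term has to take its
  value inside.\<close>

lemma expressible_iso:
  assumes h: "bij_betw h (dom A) (dom B)" "h (rzero A) = rzero B"
    "\<And>x y. x \<in> dom A \<Longrightarrow> y \<in> dom A \<Longrightarrow> h (radd A x y) = radd B (h x) (h y)"
    "\<And>x y. x \<in> dom A \<Longrightarrow> y \<in> dom A \<Longrightarrow> h (rmul A x y) = rmul B (h x) (h y)"
  and cl: "rzero A \<in> dom A" "\<And>x y. x \<in> dom A \<Longrightarrow> y \<in> dom A \<Longrightarrow> radd A x y \<in> dom A"
    "\<And>x y. x \<in> dom A \<Longrightarrow> y \<in> dom A \<Longrightarrow> rmul A x y \<in> dom A"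
  and P: "expressible A V P" "\<And>e. range e \<subseteq> dom A \<Longrightarrow> P e \<longleftrightarrow> Q (h \<circ> e)"
  shows "expressible B V Q"
proof -
  have tval: "tval A e t \<in> dom A \<and> tval B (\<lambda>n. h (e n)) t = h (tval A e t)" if "range e \<subseteq> dom A" for e t
    using that by (induction t) (auto simp: h cl)
  have sat: "sat B (\<lambda>n. h (e n)) p \<longleftrightarrow> sat A e p" if "range e \<subseteq> dom A" for e p
    using that
  proof (induction p arbitrary: e)
    case (Eq s t)
    have "h (tval A e s) = h (tval A e t) \<longleftrightarrow> tval A e s = tval A e t"
      using tval Eq h(1) by (intro inj_on_eq_iff[of h "dom A"]) (auto simp: bij_betw_def)
    then show ?case using tval[OF Eq, of s] tval[OF Eq, of t] by (simp only: sat.simps)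
  next
    case (Ex i p)
    have "sat B ((\<lambda>n. h (e n))(i := h x)) p \<longleftrightarrow> sat A (e(i := x)) p" if "x \<in> dom A" for x
    proof -
      have "range (e(i := x)) \<subseteq> dom A" using that Ex.prems by auto
      then have "sat B (\<lambda>n. h ((e(i := x)) n)) p \<longleftrightarrow> sat A (e(i := x)) p" by (rule Ex.IH)
      moreover have "(\<lambda>n. h ((e(i := x)) n)) = (\<lambda>n. h (e n))(i := h x)" by auto
      ultimately show ?thesis by simp
    qed
    moreover have "dom B = h ` dom A" using h(1) by (simp add: bij_betw_def)
    ultimately show ?case by (simp del: fun_upd_apply)
  qed auto
  obtain p where p: "fvars p \<subseteq> V" "\<And>e. range e \<subseteq> dom A \<Longrightarrow> sat A e p \<longleftrightarrow> P e"
    using P(1) unfolding expressible_def by blast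
  have "sat B e p \<longleftrightarrow> Q e" if "range e \<subseteq> dom B" for e
  proof -
    \<comment> \<open>Every environment over \<open>B\<close> is the image of one over
      \<open>A\<close>, because \<open>h\<close> is onto.\<close>
    define e' where "e' = inv_into (dom A) h \<circ> e"
    have "e = h \<circ> e'" "range e' \<subseteq> dom A"
      using that h(1) by (auto simp: e'_def fun_eq_iff bij_betw_def f_inv_into_f
          image_subset_iff inv_into_into)
    then have "sat B e p \<longleftrightarrow> sat A e' p" using sat[of e' p] by (simp add: o_def)
    then show ?thesis using p(2) P(2) \<open>e = h \<circ> e'\<close> \<open>range e' \<subseteq> dom A\<close> by simp
  qed
  then show ?thesis unfolding expressible_def using p by blast
qed

section \<open>Interpretations obtained from codings\<close>

text \<open>Surjections \<open>c s\<close> from definable sets of tuples replace the quotients: the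
  equivalence relation is the kernel of \<open>c s\<close>, and the isomorphism sends an element to
  its fiber. What remains is to show that certain preimages under \<open>c\<close> are
  definable.\<close>

lemma interpretable_by_coding:
  fixes A :: "('s, 'r, 'u) sorted_struct" and B :: "('a, 'z) rng_struct_scheme"
  assumes c: "\<And>s. c s ` D s = univ A s"
    and D: "\<And>s. definable B (m s) (D s)"
    and E: "\<And>s. definable B (m s + m s) {xs @ ys | xs ys. xs \<in> D s \<and> ys \<in> D s \<and> c s xs = c s ys}"
    and R: "\<And>r. definable B (\<Sum>s\<leftarrow>arity A r. m s)
         {concat xss | xss. list_all2 (\<lambda>s xs. xs \<in> D s) (arity A r) xss \<and> map2 c (arity A r) xss \<in> rel A r}"
  shows "zero_interpretable A B"
proof -
  define Er where "Er s = {(xs, ys). xs \<in> D s \<and> ys \<in> D s \<and> c s xs = c s ys}" for s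
  define h where "h s u = {xs \<in> D s. c s xs = u}" for s u
  \<comment> \<open>Only well-sorted tuples are pushed forward, since the fiber map is injective
    only on \<open>univ A s\<close>.\<close>
  define Q where "Q = \<lparr>univ = \<lambda>s. D s // Er s, arity = arity A,
     rel = \<lambda>r. {map2 h (arity A r) us | us. list_all2 (\<lambda>s u. u \<in> univ A s) (arity A r) us \<and> us \<in> rel A r}\<rparr>"
  have cls: "Er s `` {xs} = h s (c s xs)" if "xs \<in> D s" for s xs
    using that by (auto simp: Er_def h_def)
  have inj: "inj_on (h s) (univ A s)" for s
  proof (rule inj_onI)
    fix u v assume "u \<in> univ A s" "v \<in> univ A s" "h s u = h s v"
    moreover from this(1) obtain xs where "xs \<in> D s" "c s xs = u" by (auto simp: c[symmetric])
    ultimately show "u = v" by (auto simp: h_def)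
  qed
  have map_inj: "us = vs" if "list_all2 (\<lambda>s u. u \<in> univ A s) ss us" "list_all2 (\<lambda>s u. u \<in> univ A s) ss vs"
    "map2 h ss us = map2 h ss vs" for ss us vs
    using that
  proof (induction ss arbitrary: us vs)
    case (Cons s ss)
    then show ?case using inj[of s] by (auto simp: list_all2_Cons1 inj_on_eq_iff)
  qed auto
  have memQ: "map2 h (arity A r) us \<in> rel Q r \<longleftrightarrow> us \<in> rel A r"
    if "list_all2 (\<lambda>s u. u \<in> univ A s) (arity A r) us" for r us
    using that map_inj unfolding Q_def by auto
  have sorted: "list_all2 (\<lambda>s u. u \<in> univ A s) ss (map2 c ss xss) \<and>
      map2 (\<lambda>s xs. Er s `` {xs}) ss xss = map2 h ss (map2 c ss xss)"
    if "list_all2 (\<lambda>s xs. xs \<in> D s) ss xss" for ss xss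
    using that
  proof (induction ss arbitrary: xss)
    case (Cons s ss)
    then show ?case using c[of s] by (auto simp: list_all2_Cons1 cls)
  qed auto
  have "sorted_iso A Q"
    unfolding sorted_iso_def
  proof (intro conjI exI[of _ h] allI impI)
    show "arity Q = arity A" by (simp add: Q_def)
    show "bij_betw (h s) (univ A s) (univ Q s)" for s
      using inj[of s] by (auto simp: bij_betw_def Q_def quotient_def cls c[symmetric])
    show "us \<in> rel A r \<longleftrightarrow> map2 h (arity A r) us \<in> rel Q r"
      if "list_all2 (\<lambda>s u. u \<in> univ A s) (arity A r) us" for r us
      using memQ[OF that] by simp
  qed
  moreover have "equiv (D s) (Er s)" for s
    by (auto simp: Er_def equiv_def refl_on_def sym_def trans_def)
  moreover have "{concat xss | xss. list_all2 (\<lambda>s xs. xs \<in> D s) (arity Q r) xss \<and>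
        map2 (\<lambda>s xs. Er s `` {xs}) (arity Q r) xss \<in> rel Q r} =
      {concat xss | xss. list_all2 (\<lambda>s xs. xs \<in> D s) (arity A r) xss \<and> map2 c (arity A r) xss \<in> rel A r}" for r
    using sorted memQ by (fastforce simp: Q_def)
  moreover have "{xs @ ys | xs ys. (xs, ys) \<in> Er s} =
      {xs @ ys | xs ys. xs \<in> D s \<and> ys \<in> D s \<and> c s xs = c s ys}" for s
    by (simp add: Er_def)
  moreover have "arity Q = arity A" "univ Q s = D s // Er s" for s by (simp_all add: Q_def)
  ultimately show ?thesis
    unfolding zero_interpretable_def using D E R
    by (intro exI[of _ m] exI[of _ D] exI[of _ Er] exI[of _ Q]) (simp only: simp_thms)
qed

text \<open>Only those vector space laws that the interpretation uses are recorded here.\<close>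

definition vector_space_like :: "('k::field, 'a) kalg \<Rightarrow> bool" where
  "vector_space_like L \<longleftrightarrow>
     rzero L \<in> dom L \<and>
     (\<forall>x\<in>dom L. \<forall>y\<in>dom L. radd L x y \<in> dom L \<and> rmul L x y \<in> dom L) \<and>
     (\<forall>a. \<forall>x\<in>dom L. scale L a x \<in> dom L) \<and>
     (\<forall>x\<in>dom L. scale L 0 x = rzero L \<and> scale L 1 x = x) \<and>
     (\<forall>a b. \<forall>x\<in>dom L. scale L (a + b) x = radd L (scale L a x) (scale L b x)) \<and>
     (\<forall>a b. \<forall>x\<in>dom L. scale L (a * b) x = scale L a (scale L b x)) \<and>
     (\<forall>a b. \<forall>x\<in>dom L. scale L a x = scale L b x \<longrightarrow> x \<noteq> rzero L \<longrightarrow> a = b)"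

text \<open>A scalar \<open>a\<close> is coded by the pairs \<open>(x, a x)\<close> with \<open>x \<in> X\<close>. The indices are bounded because the
  formulas bind variables from 10 on and there is no renaming of bound variables.\<close>

definition defines_scalars :: "('k::field, 'a) kalg \<Rightarrow> 'a set \<Rightarrow> bool" where
  "defines_scalars L X \<longleftrightarrow> X \<noteq> {} \<and> X \<subseteq> dom L - {rzero L} \<and>
     (\<forall>i<10. \<forall>j<10. \<forall>k<10. \<forall>l<10.
        expressible L {i, j, k, l}
          (\<lambda>e. e i \<in> X \<and> (\<exists>a. e j = scale L a (e i) \<and> e l = scale L a (e k))))"

lemma defines_scalarsD:
  assumes "defines_scalars L X"
  shows "X \<noteq> {}" "X \<subseteq> dom L - {rzero L}"
    "\<And>i j k l. i < 10 \<Longrightarrow> j < 10 \<Longrightarrow> k < 10 \<Longrightarrow> l < 10 \<Longrightarrow> expressible L {i, j, k, l}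
       (\<lambda>e. e i \<in> X \<and> (\<exists>a. e j = scale L a (e i) \<and> e l = scale L a (e k)))"
  using assms unfolding defines_scalars_def by simp_all

lemma vector_space_like_iso:
  assumes h: "bij_betw h (dom A) (dom B)" "h (rzero A) = rzero B"
    "\<And>x y. x \<in> dom A \<Longrightarrow> y \<in> dom A \<Longrightarrow> h (radd A x y) = radd B (h x) (h y)"
    "\<And>x y. x \<in> dom A \<Longrightarrow> y \<in> dom A \<Longrightarrow> h (rmul A x y) = rmul B (h x) (h y)"
    "\<And>c x. x \<in> dom A \<Longrightarrow> h (scale A c x) = scale B c (h x)"
  and A: "vector_space_like A"
  shows "vector_space_like B"
proof -
  have B: "dom B = h ` dom A" and inj: "inj_on h (dom A)" using h(1) by (auto simp: bij_betw_def)
  show ?thesis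
    using A unfolding vector_space_like_def B
    by (simp add: h(2-5)[symmetric] inj_on_eq_iff[OF inj])
qed

lemma defines_scalars_iso:
  assumes h: "bij_betw h (dom A) (dom B)" "h (rzero A) = rzero B"
    "\<And>x y. x \<in> dom A \<Longrightarrow> y \<in> dom A \<Longrightarrow> h (radd A x y) = radd B (h x) (h y)"
    "\<And>x y. x \<in> dom A \<Longrightarrow> y \<in> dom A \<Longrightarrow> h (rmul A x y) = rmul B (h x) (h y)"
    "\<And>c x. x \<in> dom A \<Longrightarrow> h (scale A c x) = scale B c (h x)"
  and A: "vector_space_like A" and sc: "defines_scalars A X"
  shows "defines_scalars B (h ` X)"
proof -
  have inj: "inj_on h (dom A)" using h(1) by (auto simp: bij_betw_def)
  note X = defines_scalarsD[OF sc]
  have z: "rzero A \<in> dom A" and cl: "\<And>a x. x \<in> dom A \<Longrightarrow> scale A a x \<in> dom A"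
    "\<And>x y. x \<in> dom A \<Longrightarrow> y \<in> dom A \<Longrightarrow> radd A x y \<in> dom A"
    "\<And>x y. x \<in> dom A \<Longrightarrow> y \<in> dom A \<Longrightarrow> rmul A x y \<in> dom A"
    using A unfolding vector_space_like_def by auto
  show ?thesis
    unfolding defines_scalars_def
  proof (intro conjI allI impI)
    show "h ` X \<noteq> {}" using X by simp
    show "h ` X \<subseteq> dom B - {rzero B}"
    proof
      fix y assume "y \<in> h ` X"
      then obtain x where x: "x \<in> X" "y = h x" by blast
      then have "x \<in> dom A" "x \<noteq> rzero A" using X by auto
      then have "h x \<noteq> h (rzero A)" using z inj by (simp add: inj_on_eq_iff)
      moreover have "h x \<in> dom B" using \<open>x \<in> dom A\<close> h(1) by (auto simp: bij_betw_def)
      ultimately show "y \<in> dom B - {rzero B}" using x h(2) by simp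
    qed
    fix i j k l :: nat assume ijkl: "i < 10" "j < 10" "k < 10" "l < 10"
    let ?Q = "\<lambda>e :: nat \<Rightarrow> _. e i \<in> h ` X \<and> (\<exists>a. e j = scale B a (e i) \<and> e l = scale B a (e k))"
    show "expressible B {i, j, k, l} ?Q"
    proof (rule expressible_iso[where Q = ?Q, OF h(1,2) _ _ z _ _ X(3)[OF ijkl]])
      fix e :: "nat \<Rightarrow> _" assume "range e \<subseteq> dom A"
      then have e: "e n \<in> dom A" for n by auto
      have "h (e i) \<in> h ` X \<longleftrightarrow> e i \<in> X"
        using X(2) e[of i] inj by (intro inj_on_image_mem_iff[of h "dom A"]) auto
      then show "(e i \<in> X \<and> (\<exists>a. e j = scale A a (e i) \<and> e l = scale A a (e k))) \<longleftrightarrow>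
        ((h \<circ> e) i \<in> h ` X \<and> (\<exists>a. (h \<circ> e) j = scale B a ((h \<circ> e) i) \<and>
           (h \<circ> e) l = scale B a ((h \<circ> e) k)))"
        using e cl(1) by (simp add: h(5)[symmetric] inj_on_eq_iff[OF inj])
    qed (use h cl in auto)
  qed
qed

lemma concat_tuples_1:
  "{concat xss | xss. list_all2 P [s] xss \<and> map2 c [s] xss \<in> R} = {xs. P s xs \<and> [c s xs] \<in> R}"
proof (rule subset_antisym; rule subsetI)
  fix l assume "l \<in> {xs. P s xs \<and> [c s xs] \<in> R}"
  then show "l \<in> {concat xss | xss. list_all2 P [s] xss \<and> map2 c [s] xss \<in> R}"
    by (intro CollectI exI[of _ "[l]"]) simp
qed (auto simp: list_all2_Cons1)

lemma concat_tuples_3: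
  "{concat xss | xss. list_all2 P [s, t, u] xss \<and> map2 c [s, t, u] xss \<in> R} =
     {xs @ ys @ zs | xs ys zs. P s xs \<and> P t ys \<and> P u zs \<and> [c s xs, c t ys, c u zs] \<in> R}"
proof (rule subset_antisym; rule subsetI)
  fix l assume "l \<in> {xs @ ys @ zs | xs ys zs. P s xs \<and> P t ys \<and> P u zs \<and> [c s xs, c t ys, c u zs] \<in> R}"
  then obtain xs ys zs where "l = xs @ ys @ zs" "P s xs" "P t ys" "P u zs" "[c s xs, c t ys, c u zs] \<in> R"
    by blast
  then show "l \<in> {concat xss | xss. list_all2 P [s, t, u] xss \<and> map2 c [s, t, u] xss \<in> R}"
    by (intro CollectI exI[of _ "[xs, ys, zs]"]) simp
next
  fix l assume "l \<in> {concat xss | xss. list_all2 P [s, t, u] xss \<and> map2 c [s, t, u] xss \<in> R}"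
  then obtain xs ys zs where "l = concat [xs, ys, zs]" "P s xs" "P t ys" "P u zs"
    "[c s xs, c t ys, c u zs] \<in> R"
    by (auto simp: list_all2_Cons1)
  then show "l \<in> {xs @ ys @ zs | xs ys zs. P s xs \<and> P t ys \<and> P u zs \<and> [c s xs, c t ys, c u zs] \<in> R}"
    by auto
qed

text \<open>Elements of \<open>L\<close> code themselves. As distinct scalars act differently on a
  nonzero element, two pairs code the same scalar exactly when the four-place relation holds between
  them, whatever their base points.\<close>

lemma interpretable_if_defines_scalars:
  fixes L :: "('k::field, 'a) kalg"
  assumes V: "vector_space_like L" and "defines_scalars L X"
  shows "zero_interpretable (field_with_action L) L"
proof -
  note X = defines_scalarsD(1,2)[OF assms(2)] and ex = defines_scalarsD(3)[OF assms(2)]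
  have Xd: "x \<in> dom L" if "x \<in> X" for x using X(2) that by auto
  have z: "rzero L \<in> dom L" using V unfolding vector_space_like_def by simp
  have cl: "scale L a x \<in> dom L" if "x \<in> dom L" for a x
    using V that unfolding vector_space_like_def by auto
  have clop: "radd L x y \<in> dom L" "rmul L x y \<in> dom L" if "x \<in> dom L" "y \<in> dom L" for x y
    using V that unfolding vector_space_like_def by auto
  have clX: "scale L a x \<in> dom L" if "x \<in> X" for a x using that Xd cl by blast
  have vs: "scale L 0 x = rzero L" "scale L 1 x = x"
    "scale L (a + b) x = radd L (scale L a x) (scale L b x)"
    "scale L (a * b) x = scale L a (scale L b x)" if "x \<in> dom L" for a b x
    using V that unfolding vector_space_like_def by auto
  have inj: "scale L a x = scale L b x \<longleftrightarrow> a = b" if "x \<in> X" for a b x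
  proof -
    have "x \<in> dom L" "x \<noteq> rzero L" using X(2) that by auto
    moreover have "\<forall>a b. \<forall>x\<in>dom L. scale L a x = scale L b x \<longrightarrow> x \<noteq> rzero L \<longrightarrow> a = b"
      using V unfolding vector_space_like_def by simp
    ultimately show ?thesis by blast
  qed
  define m where "m s = (case s of FieldSort \<Rightarrow> 2 | AlgSort \<Rightarrow> (1 :: nat))" for s
  define D where "D s = (case s of FieldSort \<Rightarrow> {[x, scale L a x] | x a. x \<in> X}
      | AlgSort \<Rightarrow> {[z] | z. z \<in> dom L})" for s
  define c where "c s xs = (case s of FieldSort \<Rightarrow> Inl (THE a. xs ! 1 = scale L a (xs ! 0))
      | AlgSort \<Rightarrow> Inr (xs ! 0))" for s and xs :: "'a list"
  have D_simps: "xs \<in> D FieldSort \<longleftrightarrow> (\<exists>x a. x \<in> X \<and> xs = [x, scale L a x])"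
    "xs \<in> D AlgSort \<longleftrightarrow> (\<exists>z. z \<in> dom L \<and> xs = [z])" for xs
    by (auto simp: D_def)
  have cF: "c FieldSort [x, scale L a x] = Inl a" if "x \<in> X" for x a
    using inj[OF that] by (simp add: c_def)
  have cA: "c AlgSort [z] = Inr z" for z by (simp add: c_def)
  have DF: "[x, scale L a x] \<in> D FieldSort" if "x \<in> X" for x a using that by (auto simp: D_simps)
  have DA: "[z] \<in> D AlgSort" if "z \<in> dom L" for z using that by (auto simp: D_simps)
  have ex': "expressible L V (\<lambda>e. e i \<in> X \<and> (\<exists>a. e j = scale L a (e i) \<and> e l = scale L a (e k)))"
    if "i < 10" "j < 10" "k < 10" "l < 10" "{i, j, k, l} \<subseteq> V" for i j k l V
    by (rule expressible_mono[OF ex]) (use that in auto)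
  \<comment> \<open>With the second pair equal to the first, the relation only says that
    \<open>e j\<close> is a multiple of \<open>e i\<close>.\<close>
  have bin': "expressible L V (\<lambda>e. e i \<in> X \<and> (\<exists>a. e j = scale L a (e i)))"
    if "i < 10" "j < 10" "{i, j} \<subseteq> V" for i j V
    using ex'[of i j i j V] that by simp
  have upt: "[0..<1] = [0]" "[0..<2] = [0, 1]" "[0..<3] = [0, 1, 2]" "[0..<4] = [0, 1, 2, 3]"
    "[0..<6] = [0, 1, 2, 3, 4, 5 :: nat]"
    by (simp_all add: upt_rec)
  have definableI: "definable L n S" if "expressible L {..<n} P"
    "\<And>xs. xs \<in> S \<Longrightarrow> length xs = n \<and> set xs \<subseteq> dom L"
    "\<And>e. range e \<subseteq> dom L \<Longrightarrow> map e [0..<n] \<in> S \<longleftrightarrow> P e" for n S P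
    unfolding definable_iff_expressible using that by (auto intro: expressible_cong)
  have range: "e n \<in> dom L" if "range e \<subseteq> dom L" for e :: "nat \<Rightarrow> 'a" and n using that by auto
  show ?thesis
  proof (rule interpretable_by_coding[where c = c and D = D and m = m])
    show "c s ` D s = sorted_struct.univ (field_with_action L) s" for s
    proof (cases s)
      case FieldSort
      obtain x where "x \<in> X" using X by blast
      then have "Inl a \<in> c FieldSort ` D FieldSort" for a
        using cF[of x a] by (metis (mono_tags, lifting) D_simps(1) image_eqI)
      then show ?thesis using FieldSort by (auto simp: field_with_action_def D_simps cF)
    next
      case AlgSort
      have "Inr z \<in> c AlgSort ` D AlgSort" if "z \<in> dom L" for z
        using cA[of z] that by (metis (mono_tags, lifting) D_simps(2) image_eqI)
      then show ?thesis using AlgSort by (auto simp: field_with_action_def D_simps cA)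
    qed
    show "definable L (m s) (D s)" for s
    proof (cases s)
      case FieldSort
      have "expressible L {..<2} (\<lambda>e. e 0 \<in> X \<and> (\<exists>a. e 1 = scale L a (e 0)))"
        by (rule bin') auto
      then have "definable L 2 (D FieldSort)"
        by (rule definableI) (auto simp: upt D_simps Xd clX)
      then show ?thesis by (simp add: m_def FieldSort)
    next
      case AlgSort
      have "expressible L {..<1} (\<lambda>e. tval L e (Var 0) = tval L e (Var 0))"
        by (rule expressible_eq) auto
      then have "definable L 1 (D AlgSort)"
        by (rule definableI) (auto simp: upt D_simps range)
      then show ?thesis by (simp add: m_def AlgSort)
    qed
    show "definable L (m s + m s) {xs @ ys | xs ys. xs \<in> D s \<and> ys \<in> D s \<and> c s xs = c s ys}" for s
    proof (cases s)
      case FieldSort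
      have eq: "{xs @ ys | xs ys. xs \<in> D s \<and> ys \<in> D s \<and> c s xs = c s ys} =
          {[x, scale L a x, y, scale L a y] | a x y. x \<in> X \<and> y \<in> X}" (is "_ = ?S")
      proof (rule subset_antisym; rule subsetI)
        fix l assume "l \<in> ?S"
        then obtain a x y where l: "l = [x, scale L a x] @ [y, scale L a y]" "x \<in> X" "y \<in> X" by auto
        then show "l \<in> {xs @ ys | xs ys. xs \<in> D s \<and> ys \<in> D s \<and> c s xs = c s ys}"
          unfolding mem_Collect_eq l(1) FieldSort using DF cF
          by (intro exI[of _ "[x, scale L a x]"] exI[of _ "[y, scale L a y]"]) simp
      qed (auto simp: FieldSort D_simps cF)
      have "expressible L {..<4} (\<lambda>e. (e 0 \<in> X \<and> (\<exists>a. e 1 = scale L a (e 0) \<and> e 3 = scale L a (e 2))) \<and>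
          (e 2 \<in> X \<and> (\<exists>a. e 3 = scale L a (e 2))))"
        by (intro expressible_conj ex' bin') auto
      then have "definable L 4 ?S" by (rule definableI) (auto simp: upt Xd cl)
      then show ?thesis unfolding eq by (simp add: m_def FieldSort)
    next
      case AlgSort
      have eq: "{xs @ ys | xs ys. xs \<in> D s \<and> ys \<in> D s \<and> c s xs = c s ys} = {[z, z] | z. z \<in> dom L}"
        (is "_ = ?S")
      proof (rule subset_antisym; rule subsetI)
        fix l assume "l \<in> ?S"
        then obtain z where l: "l = [z] @ [z]" "z \<in> dom L" by auto
        then show "l \<in> {xs @ ys | xs ys. xs \<in> D s \<and> ys \<in> D s \<and> c s xs = c s ys}"
          unfolding mem_Collect_eq l(1) AlgSort using DA
          by (intro exI[of _ "[z]"]) simp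
      qed (auto simp: AlgSort D_simps cA)
      have "expressible L {..<2} (\<lambda>e. tval L e (Var 0) = tval L e (Var 1))"
        by (rule expressible_eq) auto
      then have "definable L 2 ?S" by (rule definableI) (auto simp: upt range)
      then show ?thesis unfolding eq by (simp add: m_def AlgSort numeral_2_eq_2)
    qed
    fix r
    let ?A = "field_with_action L"
    let ?S = "{concat xss | xss. list_all2 (\<lambda>s xs. xs \<in> D s) (arity ?A r) xss \<and>
        map2 c (arity ?A r) xss \<in> rel ?A r}"
    have S1: "?S = {xs. xs \<in> D s \<and> [c s xs] \<in> action_rel L r}" if "action_arity r = [s]" for s
      using that by (simp only: field_with_action_def sorted_struct.simps concat_tuples_1)
    have S3: "?S = {xs @ ys @ zs | xs ys zs. xs \<in> D s \<and> ys \<in> D t \<and> zs \<in> D u \<and>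
        [c s xs, c t ys, c u zs] \<in> action_rel L r}" if "action_arity r = [s, t, u]" for s t u
      using that by (simp only: field_with_action_def sorted_struct.simps concat_tuples_3)
    have S3I: "xs @ ys @ zs \<in> ?S" if "action_arity r = [s, t, u]" "xs \<in> D s" "ys \<in> D t" "zs \<in> D u"
        "[c s xs, c t ys, c u zs] \<in> action_rel L r" for s t u xs ys zs
      unfolding S3[OF that(1)] using that by blast
    have FFF: "[x, scale L a x, y, scale L b y, z, scale L d z] \<in> ?S"
      if "action_arity r = [FieldSort, FieldSort, FieldSort]" "x \<in> X" "y \<in> X" "z \<in> X"
        "[Inl a, Inl b, Inl d] \<in> action_rel L r" for x y z a b d
      using S3I[OF that(1) DF[OF that(2)] DF[OF that(3)] DF[OF that(4)]] that by (simp add: cF)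
    have AAA: "[x, y, z] \<in> ?S"
      if "action_arity r = [AlgSort, AlgSort, AlgSort]" "x \<in> dom L" "y \<in> dom L" "z \<in> dom L"
        "[Inr x, Inr y, Inr z] \<in> action_rel L r" for x y z
      using S3I[OF that(1) DA[OF that(2)] DA[OF that(3)] DA[OF that(4)]] that by (simp add: cA)
    have FAA: "[x, scale L a x, y, z] \<in> ?S"
      if "action_arity r = [FieldSort, AlgSort, AlgSort]" "x \<in> X" "y \<in> dom L" "z \<in> dom L"
        "[Inl a, Inr y, Inr z] \<in> action_rel L r" for x y z a
      using S3I[OF that(1) DF[OF that(2)] DA[OF that(3)] DA[OF that(4)]] that by (simp add: cF cA)
    show "definable L (\<Sum>s\<leftarrow>arity ?A r. m s) ?S"
    proof (cases r)
      case KZero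
      have eq: "?S = {[x, scale L 0 x] | x. x \<in> X}"
        by (subst S1[of FieldSort]) (auto simp: KZero D_simps cF)
      have "expressible L {..<2} (\<lambda>e. (e 0 \<in> X \<and> (\<exists>a. e 1 = scale L a (e 0))) \<and>
          tval L e (Var 1) = tval L e Zero)"
        by (intro expressible_conj bin' expressible_eq) auto
      then have "definable L 2 {[x, scale L 0 x] | x. x \<in> X}"
        by (rule definableI) (auto simp: upt Xd cl z vs)
      then show ?thesis unfolding eq by (simp add: field_with_action_def KZero m_def)
    next
      case KOne
      have eq: "?S = {[x, scale L 1 x] | x. x \<in> X}"
        by (subst S1[of FieldSort]) (auto simp: KOne D_simps cF)
      have "expressible L {..<2} (\<lambda>e. (e 0 \<in> X \<and> (\<exists>a. e 1 = scale L a (e 0))) \<and>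
          tval L e (Var 1) = tval L e (Var 0))"
        by (intro expressible_conj bin' expressible_eq) auto
      then have "definable L 2 {[x, scale L 1 x] | x. x \<in> X}"
        by (rule definableI) (auto simp: upt Xd cl vs)
      then show ?thesis unfolding eq by (simp add: field_with_action_def KOne m_def)
    next
      case KAdd
      let ?T = "{[x, scale L a x, y, scale L b y, z, scale L (a + b) z] | a b x y z.
          x \<in> X \<and> y \<in> X \<and> z \<in> X}"
      have ar: "action_arity r = [FieldSort, FieldSort, FieldSort]" by (simp add: KAdd)
      have eq: "?S = ?T"
      proof
        show "?S \<subseteq> ?T" by (subst S3[OF ar]) (auto simp: KAdd D_simps cF inj)
        show "?T \<subseteq> ?S" using FFF[OF ar] by (auto simp: KAdd)
      qed
      \<comment> \<open>The second scalar is moved to the base point of the first: \<open>u\<close>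
        is the corresponding multiple of \<open>e 0\<close>. Then \<open>v\<close> is the sum of the
        two multiples of \<open>e 0\<close> and is compared with the third pair.\<close>
      let ?P = "\<lambda>e. (e 0 \<in> X \<and> (\<exists>a. e 1 = scale L a (e 0))) \<and>
          (\<exists>u\<in>dom L. \<exists>v\<in>dom L. (e 2 \<in> X \<and> (\<exists>a. e 3 = scale L a (e 2) \<and> u = scale L a (e 0))) \<and>
             v = radd L (e 1) u \<and> (e 4 \<in> X \<and> (\<exists>a. e 5 = scale L a (e 4) \<and> v = scale L a (e 0))))"
      have "expressible L {..<6} ?P"
      proof -
        \<comment> \<open>Positions 6 and 7 hold \<open>u\<close> and \<open>v\<close>. They stay
          below 10, where the four-place relation is available.\<close>
        have "expressible L (insert 7 (insert 6 {..<6})) (\<lambda>e.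
          (e 2 \<in> X \<and> (\<exists>a. e 3 = scale L a (e 2) \<and> e 6 = scale L a (e 0))) \<and>
             tval L e (Var 7) = tval L e (Plus (Var 1) (Var 6)) \<and>
             (e 4 \<in> X \<and> (\<exists>a. e 5 = scale L a (e 4) \<and> e 7 = scale L a (e 0))))"
          by (intro expressible_conj ex' expressible_eq) auto
        from expressible_ex[OF expressible_ex[OF this]] show ?thesis
          by (intro expressible_conj bin') auto
      qed
      then have "definable L 6 ?T"
      proof (rule definableI)
        show "length xs = 6 \<and> set xs \<subseteq> dom L" if "xs \<in> ?T" for xs
          using that by (auto simp: Xd cl)
        show "map e [0..<6] \<in> ?T \<longleftrightarrow> ?P e" if "range e \<subseteq> dom L" for e
        proof
          assume "map e [0..<6] \<in> ?T"
          then obtain a b where e: "e 0 \<in> X" "e 2 \<in> X" "e 4 \<in> X" "e 1 = scale L a (e 0)"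
            "e 3 = scale L b (e 2)" "e 5 = scale L (a + b) (e 4)"
            by (auto simp: upt)
          have "radd L (e 1) (scale L b (e 0)) = scale L (a + b) (e 0)"
            using e Xd vs(3) by simp
          with e show "?P e"
            by (intro conjI bexI[of _ "scale L b (e 0)"] bexI[of _ "scale L (a + b) (e 0)"])
              (auto simp: Xd cl)
        next
          assume "?P e"
          then obtain a b d where e: "e 0 \<in> X" "e 2 \<in> X" "e 4 \<in> X" "e 1 = scale L a (e 0)"
            "e 3 = scale L b (e 2)" "e 5 = scale L d (e 4)"
            "radd L (e 1) (scale L b (e 0)) = scale L d (e 0)"
            by auto
          then have "scale L (a + b) (e 0) = scale L d (e 0)" using Xd vs(3) by simp
          then have "d = a + b" using inj e(1) by simp
          then show "map e [0..<6] \<in> ?T" using e by (simp add: upt) blast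
        qed
      qed
      then show ?thesis unfolding eq by (simp add: field_with_action_def KAdd m_def)
    next
      case KMul
      let ?T = "{[x, scale L a x, y, scale L b y, z, scale L (a * b) z] | a b x y z.
          x \<in> X \<and> y \<in> X \<and> z \<in> X}"
      have ar: "action_arity r = [FieldSort, FieldSort, FieldSort]" by (simp add: KMul)
      have eq: "?S = ?T"
      proof
        show "?S \<subseteq> ?T" by (subst S3[OF ar]) (auto simp: KMul D_simps cF inj)
        show "?T \<subseteq> ?S" using FFF[OF ar] by (auto simp: KMul)
      qed
      \<comment> \<open>The second scalar is applied to \<open>e 1\<close>, which is already a
        multiple of \<open>e 0\<close>, so \<open>u\<close> is the product of both scalars applied
        to \<open>e 0\<close>.\<close>
      let ?P = "\<lambda>e. (e 0 \<in> X \<and> (\<exists>a. e 1 = scale L a (e 0))) \<and>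
          (\<exists>u\<in>dom L. (e 2 \<in> X \<and> (\<exists>a. e 3 = scale L a (e 2) \<and> u = scale L a (e 1))) \<and>
             (e 4 \<in> X \<and> (\<exists>a. e 5 = scale L a (e 4) \<and> u = scale L a (e 0))))"
      have "expressible L {..<6} ?P"
      proof -
        have "expressible L (insert 6 {..<6}) (\<lambda>e.
          (e 2 \<in> X \<and> (\<exists>a. e 3 = scale L a (e 2) \<and> e 6 = scale L a (e 1))) \<and>
             (e 4 \<in> X \<and> (\<exists>a. e 5 = scale L a (e 4) \<and> e 6 = scale L a (e 0))))"
          by (intro expressible_conj ex') auto
        from expressible_ex[OF this] show ?thesis
          by (intro expressible_conj bin') auto
      qed
      then have "definable L 6 ?T"
      proof (rule definableI)
        show "length xs = 6 \<and> set xs \<subseteq> dom L" if "xs \<in> ?T" for xs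
          using that by (auto simp: Xd cl)
        show "map e [0..<6] \<in> ?T \<longleftrightarrow> ?P e" if "range e \<subseteq> dom L" for e
        proof
          assume "map e [0..<6] \<in> ?T"
          then obtain a b where e: "e 0 \<in> X" "e 2 \<in> X" "e 4 \<in> X" "e 1 = scale L a (e 0)"
            "e 3 = scale L b (e 2)" "e 5 = scale L (a * b) (e 4)"
            by (auto simp: upt)
          have "scale L b (e 1) = scale L (a * b) (e 0)"
            using e Xd vs(4)[of "e 0" b a] by (simp add: mult.commute)
          with e show "?P e"
            by (intro conjI bexI[of _ "scale L b (e 1)"]) (auto simp: Xd cl)
        next
          assume "?P e"
          then obtain a b d where e: "e 0 \<in> X" "e 2 \<in> X" "e 4 \<in> X" "e 1 = scale L a (e 0)"
            "e 3 = scale L b (e 2)" "e 5 = scale L d (e 4)" "scale L b (e 1) = scale L d (e 0)"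
            by auto
          then have "scale L (b * a) (e 0) = scale L d (e 0)" using Xd vs(4) by simp
          then have "d = a * b" using inj e(1) by (simp add: mult.commute)
          then show "map e [0..<6] \<in> ?T" using e by (simp add: upt) blast
        qed
      qed
      then show ?thesis unfolding eq by (simp add: field_with_action_def KMul m_def)
    next
      case LZero
      have eq: "?S = {[rzero L]}"
        by (subst S1[of AlgSort]) (use z in \<open>auto simp: LZero D_simps cA\<close>)
      have "expressible L {..<1} (\<lambda>e. tval L e (Var 0) = tval L e Zero)"
        by (rule expressible_eq) auto
      then have "definable L 1 {[rzero L]}"
        by (rule definableI) (auto simp: upt z)
      then show ?thesis unfolding eq by (simp add: field_with_action_def LZero m_def)
    next
      case LAdd
      let ?T = "{[x, y, radd L x y] | x y. x \<in> dom L \<and> y \<in> dom L}"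
      have ar: "action_arity r = [AlgSort, AlgSort, AlgSort]" by (simp add: LAdd)
      have eq: "?S = ?T"
      proof
        show "?S \<subseteq> ?T" by (subst S3[OF ar]) (auto simp: LAdd D_simps cA)
        show "?T \<subseteq> ?S" using AAA[OF ar] by (auto simp: LAdd clop)
      qed
      have "expressible L {..<3} (\<lambda>e. tval L e (Var 2) = tval L e (Plus (Var 0) (Var 1)))"
        by (rule expressible_eq) auto
      then have "definable L 3 ?T"
        by (rule definableI) (auto simp: upt clop range)
      then show ?thesis unfolding eq by (simp add: field_with_action_def LAdd m_def numeral_3_eq_3)
    next
      case LMul
      let ?T = "{[x, y, rmul L x y] | x y. x \<in> dom L \<and> y \<in> dom L}"
      have ar: "action_arity r = [AlgSort, AlgSort, AlgSort]" by (simp add: LMul)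
      have eq: "?S = ?T"
      proof
        show "?S \<subseteq> ?T" by (subst S3[OF ar]) (auto simp: LMul D_simps cA)
        show "?T \<subseteq> ?S" using AAA[OF ar] by (auto simp: LMul clop)
      qed
      have "expressible L {..<3} (\<lambda>e. tval L e (Var 2) = tval L e (Times (Var 0) (Var 1)))"
        by (rule expressible_eq) auto
      then have "definable L 3 ?T"
        by (rule definableI) (auto simp: upt clop range)
      then show ?thesis unfolding eq by (simp add: field_with_action_def LMul m_def numeral_3_eq_3)
    next
      case Act
      let ?T = "{[x, scale L a x, z, scale L a z] | a x z. x \<in> X \<and> z \<in> dom L}"
      have ar: "action_arity r = [FieldSort, AlgSort, AlgSort]" by (simp add: Act)
      have eq: "?S = ?T"
      proof
        show "?S \<subseteq> ?T" by (subst S3[OF ar]) (auto simp: Act D_simps cA cF inj)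
        show "?T \<subseteq> ?S" using FAA[OF ar] by (auto simp: Act cl)
      qed
      have "expressible L {..<4} (\<lambda>e. e 0 \<in> X \<and> (\<exists>a. e 1 = scale L a (e 0) \<and> e 3 = scale L a (e 2)))"
        by (rule ex') auto
      then have "definable L 4 ?T"
        by (rule definableI) (auto simp: upt cl range Xd)
      then show ?thesis unfolding eq by (simp add: field_with_action_def Act m_def)
    qed
  qed
qed

section \<open>Three algebraic criteria for defining the scalars\<close>

text \<open>A two-sided identity is unique, so \<open>u\<close> is definable and can serve as the
  only base point. Centrality is definable as well, and \<open>center\<close> turns it into being a
  multiple of \<open>u\<close>.\<close>

lemma defines_scalars_unital:
  fixes L :: "('k::field, 'a) kalg"
  assumes u: "u \<in> dom L" "u \<noteq> rzero L"
    and unit: "\<And>z. z \<in> dom L \<Longrightarrow> rmul L u z = z \<and> rmul L z u = z"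
    and scale: "\<And>a z. z \<in> dom L \<Longrightarrow> rmul L (scale L a u) z = scale L a z \<and> rmul L z (scale L a u) = scale L a z"
    and center: "\<And>y. y \<in> dom L \<Longrightarrow> \<forall>z\<in>dom L. rmul L y z = rmul L z y \<Longrightarrow> \<exists>a. y = scale L a u"
  shows "defines_scalars L {u}"
  unfolding defines_scalars_def
proof (intro conjI allI impI)
  fix i j k l :: nat assume ijkl: "i < 10" "j < 10" "k < 10" "l < 10"
  have 1: "expressible L {i, j, k, l} (\<lambda>e. \<forall>z\<in>dom L. tval L (e(10 := z)) (Times (Var i) (Var 10)) = tval L (e(10 := z)) (Var 10))"
    by (rule expressible_all, rule expressible_eq) auto
  have 2: "expressible L {i, j, k, l} (\<lambda>e. \<forall>z\<in>dom L. tval L (e(10 := z)) (Times (Var 10) (Var i)) = tval L (e(10 := z)) (Var 10))"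
    by (rule expressible_all, rule expressible_eq) auto
  have 3: "expressible L {i, j, k, l} (\<lambda>e. \<forall>z\<in>dom L. tval L (e(10 := z)) (Times (Var j) (Var 10)) = tval L (e(10 := z)) (Times (Var 10) (Var j)))"
    by (rule expressible_all, rule expressible_eq) auto
  have 4: "expressible L {i, j, k, l} (\<lambda>e. tval L e (Var l) = tval L e (Times (Var j) (Var k)))"
    by (rule expressible_eq) auto
  show "expressible L {i, j, k, l} (\<lambda>e. e i \<in> {u} \<and> (\<exists>a. e j = scale L a (e i) \<and> e l = scale L a (e k)))"
  proof (rule expressible_cong[OF expressible_conj[OF 1 expressible_conj[OF 2 expressible_conj[OF 3 4]]]])
    fix e :: "nat \<Rightarrow> _" assume "range e \<subseteq> dom L"
    then have e: "e n \<in> dom L" for n by auto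
    have ne: "i \<noteq> 10" "j \<noteq> 10" "k \<noteq> 10" "l \<noteq> 10" using ijkl by auto
    have "(\<forall>z\<in>dom L. rmul L (e i) z = z) \<and> (\<forall>z\<in>dom L. rmul L z (e i) = z) \<longleftrightarrow> e i = u"
      using unit u(1) e by metis
    moreover have "(\<forall>z\<in>dom L. rmul L (e j) z = rmul L z (e j)) \<longleftrightarrow> (\<exists>a. e j = scale L a u)"
      using center[OF e[of j]] scale by auto
    ultimately show "((\<forall>z\<in>dom L. tval L (e(10 := z)) (Times (Var i) (Var 10)) = tval L (e(10 := z)) (Var 10)) \<and>
        (\<forall>z\<in>dom L. tval L (e(10 := z)) (Times (Var 10) (Var i)) = tval L (e(10 := z)) (Var 10)) \<and>
        (\<forall>z\<in>dom L. tval L (e(10 := z)) (Times (Var j) (Var 10)) = tval L (e(10 := z)) (Times (Var 10) (Var j))) \<and>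
        tval L e (Var l) = tval L e (Times (Var j) (Var k))) \<longleftrightarrow>
        (e i \<in> {u} \<and> (\<exists>a. e j = scale L a (e i) \<and> e l = scale L a (e k)))"
      using scale[OF e[of k]] ne by auto metis
  qed
qed (use u in auto)

text \<open>Once \<open>e j\<close> is a multiple of \<open>e i\<close>, the equation between
  \<open>rmul L (e j) (e k)\<close> and \<open>rmul L (e i) (e l)\<close> determines
  \<open>e l\<close>: the scalar moves across the product and \<open>e i\<close> cancels.\<close>

lemma defines_scalars_cancellative:
  fixes L :: "('k::field, 'a) kalg"
  assumes V: "vector_space_like L" and ne: "dom L - {rzero L} \<noteq> {}"
    and scale: "\<And>a x y. x \<in> dom L \<Longrightarrow> y \<in> dom L \<Longrightarrow>
      rmul L (scale L a x) y = scale L a (rmul L x y) \<and> rmul L x (scale L a y) = scale L a (rmul L x y)"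
    and cancel: "\<And>x y z. x \<in> dom L \<Longrightarrow> x \<noteq> rzero L \<Longrightarrow> y \<in> dom L \<Longrightarrow> z \<in> dom L \<Longrightarrow>
      rmul L x y = rmul L x z \<Longrightarrow> y = z"
    and multiple: "\<And>x y. x \<in> dom L \<Longrightarrow> y \<in> dom L \<Longrightarrow> x \<noteq> rzero L \<Longrightarrow> y \<noteq> rzero L \<Longrightarrow>
      \<forall>z\<in>dom L. \<exists>w\<in>dom L. rmul L y z = rmul L x w \<Longrightarrow>
      \<forall>z\<in>dom L. \<exists>w\<in>dom L. rmul L x z = rmul L y w \<Longrightarrow> \<exists>a. y = scale L a x"
  shows "defines_scalars L (dom L - {rzero L})"
  unfolding defines_scalars_def
proof (intro conjI allI impI)
  fix i j k l :: nat assume ijkl: "i < 10" "j < 10" "k < 10" "l < 10"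
  let ?R = "\<lambda>i j e. \<forall>z\<in>dom L. \<exists>w\<in>dom L. tval L (e(10 := z, 11 := w)) (Times (Var j) (Var 10)) =
      tval L (e(10 := z, 11 := w)) (Times (Var i) (Var 11))"
  have R: "expressible L {i, j, k, l} (?R p q)" if "p \<in> {i, j, k, l}" "q \<in> {i, j, k, l}" for p q
    by (rule expressible_all, rule expressible_ex, rule expressible_eq) (use that in auto)
  have 1: "expressible L {i, j, k, l} (\<lambda>e. tval L e (Var i) \<noteq> tval L e Zero)"
    by (rule expressible_not, rule expressible_eq) auto
  have 2: "expressible L {i, j, k, l} (\<lambda>e. \<not> (tval L e (Var j) \<noteq> tval L e Zero \<and> \<not> (?R i j e \<and> ?R j i e)))"
    by (intro expressible_not expressible_conj R expressible_eq) auto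
  have 3: "expressible L {i, j, k, l} (\<lambda>e. tval L e (Times (Var j) (Var k)) = tval L e (Times (Var i) (Var l)))"
    by (rule expressible_eq) auto
  show "expressible L {i, j, k, l} (\<lambda>e. e i \<in> dom L - {rzero L} \<and> (\<exists>a. e j = scale L a (e i) \<and> e l = scale L a (e k)))"
  proof (rule expressible_cong[OF expressible_conj[OF 1 expressible_conj[OF 2 3]]])
    fix e :: "nat \<Rightarrow> _" assume "range e \<subseteq> dom L"
    then have e: "e n \<in> dom L" for n by auto
    have neq: "i \<noteq> 10" "j \<noteq> 10" "i \<noteq> 11" "j \<noteq> 11" using ijkl by auto
    have R: "?R i j e \<longleftrightarrow> (\<forall>z\<in>dom L. \<exists>w\<in>dom L. rmul L (e j) z = rmul L (e i) w)"
      "?R j i e \<longleftrightarrow> (\<forall>z\<in>dom L. \<exists>w\<in>dom L. rmul L (e i) z = rmul L (e j) w)"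
      using neq by auto
    have cl: "scale L a x \<in> dom L" if "x \<in> dom L" for a x
      using V that unfolding vector_space_like_def by auto
    have vs: "scale L 0 x = rzero L" "scale L 1 x = x" "scale L (a * b) x = scale L a (scale L b x)"
      if "x \<in> dom L" for a b x
      using V that unfolding vector_space_like_def by auto
    have mult: "(e j = rzero L \<or> ?R i j e \<and> ?R j i e) \<longleftrightarrow> (\<exists>a. e j = scale L a (e i))" if "e i \<noteq> rzero L"
    proof
      assume "e j = rzero L \<or> ?R i j e \<and> ?R j i e"
      then show "\<exists>a. e j = scale L a (e i)"
        unfolding R using multiple[OF e[of i] e[of j] that] vs(1)[OF e[of i]] by metis
    next
      assume "\<exists>a. e j = scale L a (e i)"
      then obtain a where a: "e j = scale L a (e i)" by blast
      show "e j = rzero L \<or> ?R i j e \<and> ?R j i e"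
      proof (cases "a = 0")
        case True
        then show ?thesis using a vs(1) e by simp
      next
        case False
        have "rmul L (e j) z = rmul L (e i) (scale L a z)" if "z \<in> dom L" for z
          using scale[OF e[of i] that] a by simp
        moreover have "rmul L (e i) z = rmul L (e j) (scale L (1 / a) z)" if "z \<in> dom L" for z
        proof -
          have "rmul L (e j) (scale L (1 / a) z) = rmul L (e i) (scale L a (scale L (1 / a) z))"
            using scale[OF e[of i] cl[OF that]] a by simp
          also have "scale L a (scale L (1 / a) z) = z"
            using vs(3)[OF that, of a "1 / a"] vs(2)[OF that] False by simp
          finally show ?thesis by simp
        qed
        ultimately show ?thesis unfolding R using cl by blast
      qed
    qed
    have act: "rmul L (e j) (e k) = rmul L (e i) (e l) \<longleftrightarrow> e l = scale L a (e k)"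
      if "e i \<noteq> rzero L" "e j = scale L a (e i)" for a
      using scale[OF e e] that(2) cancel[OF e that(1) e cl[OF e]] by metis
    show "(tval L e (Var i) \<noteq> tval L e Zero \<and>
        \<not> (tval L e (Var j) \<noteq> tval L e Zero \<and> \<not> (?R i j e \<and> ?R j i e)) \<and>
        tval L e (Times (Var j) (Var k)) = tval L e (Times (Var i) (Var l))) \<longleftrightarrow>
      (e i \<in> dom L - {rzero L} \<and> (\<exists>a. e j = scale L a (e i) \<and> e l = scale L a (e k)))"
    proof (cases "e i = rzero L")
      case False
      have A: "(\<not> (tval L e (Var j) \<noteq> tval L e Zero \<and> \<not> (?R i j e \<and> ?R j i e))) =
        (\<exists>a. e j = scale L a (e i))"
        unfolding mult[OF False, symmetric] by simp
      have B: "(tval L e (Times (Var j) (Var k)) = tval L e (Times (Var i) (Var l))) =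
        (e l = scale L a (e k))" if "e j = scale L a (e i)" for a
        using act[OF False that] by simp
      \<comment> \<open>By \<open>act\<close>, the last equation says the same for every scalar that
        witnesses the first part, so it can be moved under the quantifier.\<close>
      have "(P \<and> Q) = (\<exists>a. P' a \<and> Q' a)" if "P = (\<exists>a. P' a)" "\<And>a. P' a \<Longrightarrow> Q = Q' a"
        for P Q and P' Q' :: "'k \<Rightarrow> bool"
        using that by blast
      note AB = this[OF A B]
      show ?thesis
        by (subst AB) (use False e[of i] in auto)
    qed simp
  qed
qed (use ne in auto)

text \<open>In the formula, \<open>x\<close> is an element that does not commute with \<open>e i\<close>, and \<open>x'\<close> is the same multiple of
  \<open>x\<close> as \<open>e j\<close> is of \<open>e i\<close>; two independent elements are needed since a bracket with a single one
  determines \<open>e l\<close> only up to its centralizer.\<close>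

lemma defines_scalars_lie:
  fixes L :: "('k::field, 'a) kalg"
  assumes V: "vector_space_like L" and ne: "nonabelian L"
    and scale: "\<And>a x y. x \<in> dom L \<Longrightarrow> y \<in> dom L \<Longrightarrow>
      rmul L (scale L a x) y = scale L a (rmul L x y) \<and> rmul L x (scale L a y) = scale L a (rmul L x y)"
    and zero: "\<And>x. x \<in> dom L \<Longrightarrow> rmul L x x = rzero L \<and> rmul L (rzero L) x = rzero L"
    and scale_zero: "\<And>a. scale L a (rzero L) = rzero L"
    and centralizer: "\<And>x y. x \<in> dom L \<Longrightarrow> y \<in> dom L \<Longrightarrow> x \<noteq> rzero L \<Longrightarrow> rmul L x y = rzero L \<Longrightarrow>
      \<exists>a. y = scale L a x"
    and faithful: "\<And>x x' y z. x \<in> dom L \<Longrightarrow> x' \<in> dom L \<Longrightarrow> y \<in> dom L \<Longrightarrow> z \<in> dom L \<Longrightarrow>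
      rmul L x x' \<noteq> rzero L \<Longrightarrow> rmul L x y = rmul L x z \<Longrightarrow> rmul L x' y = rmul L x' z \<Longrightarrow> y = z"
  shows "defines_scalars L (dom L - {rzero L})"
  unfolding defines_scalars_def
proof (intro conjI allI impI)
  show "dom L - {rzero L} \<noteq> {}"
    using ne zero unfolding nonabelian_def by force
  fix i j k l :: nat assume ijkl: "i < 10" "j < 10" "k < 10" "l < 10"
  let ?T = "\<lambda>e x x' s t. tval L (e(10 := x, 11 := x')) s = tval L (e(10 := x, 11 := x')) t"
  let ?Q = "\<lambda>e. tval L e (Var i) \<noteq> tval L e Zero \<and> tval L e (Times (Var i) (Var j)) = tval L e Zero \<and>
    (\<exists>x\<in>dom L. \<exists>x'\<in>dom L. \<not> ?T e x x' (Times (Var i) (Var 10)) Zero \<and>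
      ?T e x x' (Times (Var 10) (Var 11)) Zero \<and>
      ?T e x x' (Times (Var j) (Var 10)) (Times (Var i) (Var 11)) \<and>
      ?T e x x' (Times (Var j) (Var k)) (Times (Var i) (Var l)) \<and>
      ?T e x x' (Times (Var 11) (Var k)) (Times (Var 10) (Var l)))"
  have "expressible L (insert 11 (insert 10 {i, j, k, l})) (\<lambda>e. \<not> tval L e (Times (Var i) (Var 10)) = tval L e Zero \<and>
      tval L e (Times (Var 10) (Var 11)) = tval L e Zero \<and>
      tval L e (Times (Var j) (Var 10)) = tval L e (Times (Var i) (Var 11)) \<and>
      tval L e (Times (Var j) (Var k)) = tval L e (Times (Var i) (Var l)) \<and>
      tval L e (Times (Var 11) (Var k)) = tval L e (Times (Var 10) (Var l)))"
    by (intro expressible_conj expressible_not expressible_eq) auto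
  note E = expressible_ex[OF expressible_ex[OF this]]
  have Q: "expressible L {i, j, k, l} ?Q"
    by (intro expressible_conj E expressible_not expressible_eq) auto
  show "expressible L {i, j, k, l} (\<lambda>e. e i \<in> dom L - {rzero L} \<and> (\<exists>a. e j = scale L a (e i) \<and> e l = scale L a (e k)))"
  proof (rule expressible_cong[OF Q])
    fix e :: "nat \<Rightarrow> _" assume "range e \<subseteq> dom L"
    then have e: "e n \<in> dom L" for n by auto
    have neq: "i \<noteq> 10" "j \<noteq> 10" "k \<noteq> 10" "l \<noteq> 10" "i \<noteq> 11" "j \<noteq> 11" "k \<noteq> 11" "l \<noteq> 11"
      using ijkl by auto
    have Qe: "?Q e \<longleftrightarrow> e i \<noteq> rzero L \<and> rmul L (e i) (e j) = rzero L \<and>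
      (\<exists>x\<in>dom L. \<exists>x'\<in>dom L. rmul L (e i) x \<noteq> rzero L \<and> rmul L x x' = rzero L \<and>
        rmul L (e j) x = rmul L (e i) x' \<and> rmul L (e j) (e k) = rmul L (e i) (e l) \<and>
        rmul L x' (e k) = rmul L x (e l))"
      using neq by simp
    have cl: "scale L a x \<in> dom L" if "x \<in> dom L" for a x
      using V that unfolding vector_space_like_def by auto
    have clm: "rmul L x y \<in> dom L" if "x \<in> dom L" "y \<in> dom L" for x y
      using V that unfolding vector_space_like_def by auto
    have inj: "a = b" if "x \<in> dom L" "x \<noteq> rzero L" "scale L a x = scale L b x" for a b x
    proof -
      have "\<forall>a b. \<forall>x\<in>dom L. scale L a x = scale L b x \<longrightarrow> x \<noteq> rzero L \<longrightarrow> a = b"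
        using V unfolding vector_space_like_def by simp
      then show ?thesis using that by blast
    qed
    show "?Q e \<longleftrightarrow> (e i \<in> dom L - {rzero L} \<and> (\<exists>a. e j = scale L a (e i) \<and> e l = scale L a (e k)))"
      unfolding Qe
    proof
      assume "e i \<noteq> rzero L \<and> rmul L (e i) (e j) = rzero L \<and>
      (\<exists>x\<in>dom L. \<exists>x'\<in>dom L. rmul L (e i) x \<noteq> rzero L \<and> rmul L x x' = rzero L \<and>
        rmul L (e j) x = rmul L (e i) x' \<and> rmul L (e j) (e k) = rmul L (e i) (e l) \<and>
        rmul L x' (e k) = rmul L x (e l))"
      then obtain x x' where x: "x \<in> dom L" "x' \<in> dom L" "rmul L (e i) x \<noteq> rzero L"
        "rmul L x x' = rzero L" "rmul L (e j) x = rmul L (e i) x'"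
        "rmul L (e j) (e k) = rmul L (e i) (e l)" "rmul L x' (e k) = rmul L x (e l)"
        and i: "e i \<noteq> rzero L" "rmul L (e i) (e j) = rzero L" by blast
      obtain a where a: "e j = scale L a (e i)" using centralizer[OF e e i] by blast
      have "x \<noteq> rzero L"
        using x(3) scale[OF e[of i] x(1), of 0] V e[of i] clm[OF e[of i] x(1)]
        unfolding vector_space_like_def by metis
      then obtain b where b: "x' = scale L b x" using centralizer[OF x(1,2) _ x(4)] by blast
      \<comment> \<open>The equation between \<open>rmul L (e j) x\<close> and
        \<open>rmul L (e i) x'\<close> makes both scalars act on one and the same nonzero
        bracket.\<close>
      have "scale L a (rmul L (e i) x) = scale L b (rmul L (e i) x)"
        using x(5) scale[OF e[of i] x(1)] a b by simp
      then have "a = b" using inj[OF clm[OF e[of i] x(1)] x(3)] by blast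
      have "rmul L (e i) (scale L a (e k)) = rmul L (e i) (e l)"
        using x(6) a scale[OF e e] by simp
      moreover have "rmul L x (scale L a (e k)) = rmul L x (e l)"
        using x(7) b \<open>a = b\<close> scale[OF x(1) e] by simp
      \<comment> \<open>The elements \<open>e i\<close> and \<open>x\<close> each have equal
        brackets with both sides; as \<open>e i\<close> and \<open>x\<close> do not commute,
        \<open>faithful\<close> applies.\<close>
      ultimately have "e l = scale L a (e k)"
        using faithful[OF e[of i] x(1) cl[OF e[of k]] e[of l] x(3)] by metis
      with a i e[of i] show "e i \<in> dom L - {rzero L} \<and> (\<exists>a. e j = scale L a (e i) \<and> e l = scale L a (e k))"
        by blast
    next
      assume "e i \<in> dom L - {rzero L} \<and> (\<exists>a. e j = scale L a (e i) \<and> e l = scale L a (e k))"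
      then obtain a where a: "e i \<noteq> rzero L" "e j = scale L a (e i)" "e l = scale L a (e k)" by auto
      \<comment> \<open>If \<open>e i\<close> commuted with everything, all of \<open>L\<close>
        would consist of its multiples and would be abelian.\<close>
      obtain x where x: "x \<in> dom L" "rmul L (e i) x \<noteq> rzero L"
      proof (rule ccontr)
        assume "\<not> thesis"
        then have *: "\<exists>b. y = scale L b (e i)" if "y \<in> dom L" for y
          using that centralizer[OF e[of i] that a(1)] \<open>\<And>x. x \<in> dom L \<Longrightarrow> rmul L (e i) x \<noteq> rzero L \<Longrightarrow> thesis\<close> by blast
        obtain p q where pq: "p \<in> dom L" "q \<in> dom L" "rmul L p q \<noteq> rzero L"
          using ne unfolding nonabelian_def by blast
        obtain b d where "p = scale L b (e i)" "q = scale L d (e i)" using * pq by blast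
        then show False
          using pq(3) scale[OF e[of i] cl[OF e[of i]]] scale[OF e[of i] e[of i]] zero[OF e[of i]] scale_zero
          by metis
      qed
      have 1: "rmul L x (scale L a x) = rzero L" "rmul L (e i) (e j) = rzero L"
        using scale[OF x(1) x(1)] scale[OF e[of i] e[of i]] zero[OF x(1)] zero[OF e[of i]] scale_zero a(2)
        by simp_all
      have 2: "rmul L (e j) x = rmul L (e i) (scale L a x)" "rmul L (e j) (e k) = rmul L (e i) (e l)"
        "rmul L (scale L a x) (e k) = rmul L x (e l)"
        using scale[OF e[of i] x(1)] scale[OF e[of i] e[of k]] scale[OF x(1) e[of k]] a by simp_all
      show "e i \<noteq> rzero L \<and> rmul L (e i) (e j) = rzero L \<and>
      (\<exists>x\<in>dom L. \<exists>x'\<in>dom L. rmul L (e i) x \<noteq> rzero L \<and> rmul L x x' = rzero L \<and>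
        rmul L (e j) x = rmul L (e i) x' \<and> rmul L (e j) (e k) = rmul L (e i) (e l) \<and>
        rmul L x' (e k) = rmul L x (e l))"
        using a(1) x 1 2 cl[OF x(1)] by blast
    qed
  qed
qed auto

section \<open>Algebras with a multiplicative basis\<close>

abbreviation pscale :: "'k::semiring_0 \<Rightarrow> ('b \<Rightarrow>\<^sub>0 'k) \<Rightarrow> ('b \<Rightarrow>\<^sub>0 'k)" where
  "pscale c \<equiv> Poly_Mapping.map ((*) c)"

lemma lookup_pscale [simp]: "Poly_Mapping.lookup (pscale c p) x = c * Poly_Mapping.lookup p x"
  by (simp add: Poly_Mapping.map.rep_eq when_def)

lemma keys_pscale: "Poly_Mapping.keys (pscale c p) \<subseteq> Poly_Mapping.keys p"
  by (auto simp: in_keys_iff)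

lemma pscale_add: "pscale c (p + q) = pscale c p + pscale c q"
  by (rule poly_mapping_eqI) (simp add: lookup_add algebra_simps)

lemma pscale_zero [simp]: "pscale c 0 = 0" "pscale 0 p = 0"
  by (rule poly_mapping_eqI; simp)+

lemma pscale_single: "pscale c (Poly_Mapping.single k a) = Poly_Mapping.single k (c * a)"
  by (rule poly_mapping_eqI) (simp add: lookup_single when_def)

lemma pscale_sum: "pscale c (\<Sum>i\<in>I. p i) = (\<Sum>i\<in>I. pscale c (p i))"
  by (induction I rule: infinite_finite_induct) (simp_all add: pscale_add)

lemma sum_pscale_single:
  fixes p :: "'b \<Rightarrow>\<^sub>0 'k::semiring_1"
  shows "p = (\<Sum>u\<in>Poly_Mapping.keys p. pscale (Poly_Mapping.lookup p u) (Poly_Mapping.single u 1))"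
  by (rule poly_mapping_eqI)
    (simp add: lookup_sum lookup_single when_def in_keys_iff sum.delta')

lemma single_one_nonzero [simp]: "Poly_Mapping.single k (1 :: 'k::zero_neq_one) \<noteq> 0"
  by (metis lookup_single_eq lookup_zero zero_neq_one)

text \<open>Bilinearity becomes a termwise identity once all products are summed over common
  supersets of the supports; the added terms vanish.\<close>

lemma convolve_superset:
  assumes "finite A" "finite B" "Poly_Mapping.keys p \<subseteq> A" "Poly_Mapping.keys q \<subseteq> B"
  shows "convolve f p q =
     (\<Sum>u\<in>A. \<Sum>v\<in>B. Poly_Mapping.single (f u v) (Poly_Mapping.lookup p u * Poly_Mapping.lookup q v))"
proof -
  have "convolve f p q = (\<Sum>u\<in>Poly_Mapping.keys p. \<Sum>v\<in>B.
      Poly_Mapping.single (f u v) (Poly_Mapping.lookup p u * Poly_Mapping.lookup q v))"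
    unfolding convolve_def
    by (intro sum.cong refl sum.mono_neutral_left) (use assms in \<open>auto simp: in_keys_iff\<close>)
  also have "\<dots> = (\<Sum>u\<in>A. \<Sum>v\<in>B.
      Poly_Mapping.single (f u v) (Poly_Mapping.lookup p u * Poly_Mapping.lookup q v))"
    by (intro sum.mono_neutral_left) (use assms in \<open>auto simp: in_keys_iff\<close>)
  finally show ?thesis .
qed

lemma convolve_add_left: "convolve f (p + p') q = convolve f p q + convolve f p' q"
proof -
  let ?A = "Poly_Mapping.keys p \<union> Poly_Mapping.keys p'" and ?B = "Poly_Mapping.keys q"
  note c = convolve_superset[of ?A ?B _ q f]
  show ?thesis
    using c[of "p + p'"] c[of p] c[of p'] Poly_Mapping.keys_add[of p p']
    by (simp add: lookup_add distrib_right single_add sum.distrib)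
qed

lemma convolve_add_right: "convolve f p (q + q') = convolve f p q + convolve f p q'"
proof -
  let ?A = "Poly_Mapping.keys p" and ?B = "Poly_Mapping.keys q \<union> Poly_Mapping.keys q'"
  note c = convolve_superset[of ?A ?B p _ f]
  show ?thesis
    using c[of "q + q'"] c[of q] c[of q'] Poly_Mapping.keys_add[of q q']
    by (simp add: lookup_add distrib_left single_add sum.distrib)
qed

lemma convolve_zero [simp]: "convolve f 0 q = 0" "convolve f p 0 = 0"
  by (simp_all add: convolve_def)

lemma convolve_sum_left: "convolve f (\<Sum>i\<in>I. p i) q = (\<Sum>i\<in>I. convolve f (p i) q)"
  by (induction I rule: infinite_finite_induct) (simp_all add: convolve_add_left)

lemma convolve_sum_right: "convolve f p (\<Sum>i\<in>I. q i) = (\<Sum>i\<in>I. convolve f p (q i))"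
  by (induction I rule: infinite_finite_induct) (simp_all add: convolve_add_right)

lemma convolve_scale_left: "convolve f (pscale c p) q = pscale c (convolve f p q)"
proof -
  have "convolve f (pscale c p) q = (\<Sum>u\<in>Poly_Mapping.keys p. \<Sum>v\<in>Poly_Mapping.keys q.
      Poly_Mapping.single (f u v) (Poly_Mapping.lookup (pscale c p) u * Poly_Mapping.lookup q v))"
    by (rule convolve_superset) (auto intro: keys_pscale[THEN subsetD])
  then show ?thesis
    unfolding convolve_def[of f p q] by (simp add: pscale_sum pscale_single mult.assoc)
qed

lemma convolve_scale_right:
  fixes c :: "'k::comm_semiring_0"
  shows "convolve f p (pscale c q) = pscale c (convolve f p q)"
proof -
  have "convolve f p (pscale c q) = (\<Sum>u\<in>Poly_Mapping.keys p. \<Sum>v\<in>Poly_Mapping.keys q.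
      Poly_Mapping.single (f u v) (Poly_Mapping.lookup p u * Poly_Mapping.lookup (pscale c q) v))"
    by (rule convolve_superset) (auto intro: keys_pscale[THEN subsetD])
  then show ?thesis
    unfolding convolve_def[of f p q] by (simp add: pscale_sum pscale_single mult.left_commute)
qed

lemma convolve_diff_left:
  fixes p :: "'b \<Rightarrow>\<^sub>0 'k::ring"
  shows "convolve f (p - p') q = convolve f p q - convolve f p' q"
  using convolve_add_left[of f "p - p'" p' q] by (simp add: algebra_simps)

lemma convolve_diff_right:
  fixes p :: "'b \<Rightarrow>\<^sub>0 'k::ring"
  shows "convolve f p (q - q') = convolve f p q - convolve f p q'"
  using convolve_add_right[of f p "q - q'" q'] by (simp add: algebra_simps)

lemma convolve_single:
  "convolve f (Poly_Mapping.single u a) (Poly_Mapping.single v b) = Poly_Mapping.single (f u v) (a * b)"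
  using convolve_superset[of "{u}" "{v}" "Poly_Mapping.single u a" "Poly_Mapping.single v b" f]
  by simp

lemma keys_convolve:
  assumes "w \<in> Poly_Mapping.keys (convolve f p q)"
  obtains u v where "u \<in> Poly_Mapping.keys p" "v \<in> Poly_Mapping.keys q" "w = f u v"
proof -
  have "\<exists>u\<in>Poly_Mapping.keys p. \<exists>v\<in>Poly_Mapping.keys q. f u v = w"
  proof (rule ccontr)
    assume "\<not> ?thesis"
    then have "Poly_Mapping.lookup (convolve f p q) w = 0"
      by (auto simp: convolve_def lookup_sum lookup_single when_def intro!: sum.neutral)
    with assms show False by (simp add: in_keys_iff)
  qed
  then show ?thesis using that by blast
qed

text \<open>If a basis element has only one factorization over the supports, nothing can cancel
  there. The pair \<open>u\<close>, \<open>v\<close> itself may lie outside the supports, in which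
  case both sides are zero; this allows comparing coefficients at arbitrary words.\<close>

lemma lookup_convolve_unique:
  assumes "\<And>u' v'. u' \<in> Poly_Mapping.keys p \<Longrightarrow> v' \<in> Poly_Mapping.keys q \<Longrightarrow> f u' v' = f u v \<Longrightarrow> u' = u \<and> v' = v"
  shows "Poly_Mapping.lookup (convolve f p q) (f u v) = Poly_Mapping.lookup p u * Poly_Mapping.lookup q v"
proof -
  let ?A = "insert u (Poly_Mapping.keys p)" and ?B = "insert v (Poly_Mapping.keys q)"
  have *: "Poly_Mapping.lookup p u' * Poly_Mapping.lookup q v' = 0"
    if "f u' v' = f u v" "u' \<noteq> u \<or> v' \<noteq> v" for u' v'
    using assms[of u' v'] that
    by (cases "Poly_Mapping.lookup p u' = 0"; cases "Poly_Mapping.lookup q v' = 0") (auto simp: in_keys_iff)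
  have "Poly_Mapping.lookup (convolve f p q) (f u v) =
      (\<Sum>u'\<in>?A. \<Sum>v'\<in>?B. Poly_Mapping.lookup p u' * Poly_Mapping.lookup q v' when f u' v' = f u v)"
    by (subst convolve_superset[of ?A ?B]) (auto simp: lookup_sum lookup_single)
  also have "\<dots> = (\<Sum>u'\<in>?A. \<Sum>v'\<in>?B. if v' = v then (if u' = u then Poly_Mapping.lookup p u' * Poly_Mapping.lookup q v' else 0) else 0)"
    by (intro sum.cong refl) (use * in \<open>auto simp: when_def\<close>)
  also have "\<dots> = Poly_Mapping.lookup p u * Poly_Mapping.lookup q v"
    by (simp add: sum.delta)
  finally show ?thesis .
qed

lemma convolve_commute:
  fixes p :: "'b \<Rightarrow>\<^sub>0 'k::comm_semiring_0"
  assumes "\<And>u v. u \<in> Poly_Mapping.keys p \<Longrightarrow> v \<in> Poly_Mapping.keys q \<Longrightarrow> f u v = f v u"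
  shows "convolve f p q = convolve f q p"
  unfolding convolve_def using assms
  by (subst sum.swap) (auto intro!: sum.cong simp: mult.commute)

lemma vector_space_like_magma_algebra:
  assumes "\<And>u v. u \<in> M \<Longrightarrow> v \<in> M \<Longrightarrow> f u v \<in> M"
  shows "vector_space_like (magma_algebra M f :: ('k::field, 'b \<Rightarrow>\<^sub>0 'k) kalg)"
proof -
  have "a = b" if eq: "pscale a p = pscale b p" and ne: "p \<noteq> 0" for a b and p :: "'b \<Rightarrow>\<^sub>0 'k"
  proof -
    obtain k where "Poly_Mapping.lookup p k \<noteq> 0"
      using ne by (metis poly_mapping_eqI lookup_zero)
    then show ?thesis using eq by (metis lookup_pscale mult_right_cancel)
  qed
  moreover have "Poly_Mapping.keys (convolve f p q) \<subseteq> M"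
    if "Poly_Mapping.keys p \<subseteq> M" "Poly_Mapping.keys q \<subseteq> M" for p q :: "'b \<Rightarrow>\<^sub>0 'k"
    using that assms by (auto elim!: keys_convolve)
  moreover have "Poly_Mapping.keys (p + q) \<subseteq> M"
    if "Poly_Mapping.keys p \<subseteq> M" "Poly_Mapping.keys q \<subseteq> M" for p q :: "'b \<Rightarrow>\<^sub>0 'k"
    using that Poly_Mapping.keys_add[of p q] by blast
  moreover have "Poly_Mapping.keys (pscale a p) \<subseteq> M" if "Poly_Mapping.keys p \<subseteq> M" for a and p :: "'b \<Rightarrow>\<^sub>0 'k"
    using that keys_pscale[of a p] by blast
  moreover have "pscale 1 p = p" "pscale (a + b) p = pscale a p + pscale b p"
    "pscale (a * b) p = pscale a (pscale b p)" for a b and p :: "'b \<Rightarrow>\<^sub>0 'k"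
    by (rule poly_mapping_eqI; simp add: lookup_add algebra_simps)+
  ultimately show ?thesis
    unfolding vector_space_like_def magma_algebra_def by simp
qed

text \<open>By bilinearity the basis element \<open>e\<close> is the identity of the algebra, and an
  element supported on \<open>{e}\<close> is a multiple of it. So only the support of central
  elements has to be found, by testing them against basis elements.\<close>

lemma defines_scalars_magma_algebra_with_unit:
  assumes cl: "\<And>u v. u \<in> M \<Longrightarrow> v \<in> M \<Longrightarrow> f u v \<in> M"
    and e: "e \<in> M" "\<And>u. u \<in> M \<Longrightarrow> f e u = u \<and> f u e = u"
    and center: "\<And>p :: 'b \<Rightarrow>\<^sub>0 'k::field. Poly_Mapping.keys p \<subseteq> M \<Longrightarrow>
      (\<And>u. u \<in> M \<Longrightarrow> convolve f p (Poly_Mapping.single u 1) = convolve f (Poly_Mapping.single u 1) p) \<Longrightarrow>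
      Poly_Mapping.keys p \<subseteq> {e}"
  shows "defines_scalars (magma_algebra M f :: ('k, 'b \<Rightarrow>\<^sub>0 'k) kalg) {Poly_Mapping.single e 1}"
proof -
  let ?u = "Poly_Mapping.single e 1 :: 'b \<Rightarrow>\<^sub>0 'k"
  have unit: "convolve f ?u p = p" "convolve f p ?u = p" if "Poly_Mapping.keys p \<subseteq> M" for p
  proof -
    have "convolve f ?u p = (\<Sum>u\<in>{e}. \<Sum>v\<in>Poly_Mapping.keys p. Poly_Mapping.single (f u v) (Poly_Mapping.lookup ?u u * Poly_Mapping.lookup p v))"
      by (rule convolve_superset) auto
    also have "\<dots> = (\<Sum>v\<in>Poly_Mapping.keys p. pscale (Poly_Mapping.lookup p v) (Poly_Mapping.single v 1))"
      using that e by (auto intro!: sum.cong simp: pscale_single)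
    finally show "convolve f ?u p = p" using sum_pscale_single[of p] by simp
    have "convolve f p ?u = (\<Sum>u\<in>Poly_Mapping.keys p. \<Sum>v\<in>{e}. Poly_Mapping.single (f u v) (Poly_Mapping.lookup p u * Poly_Mapping.lookup ?u v))"
      by (rule convolve_superset) auto
    also have "\<dots> = (\<Sum>v\<in>Poly_Mapping.keys p. pscale (Poly_Mapping.lookup p v) (Poly_Mapping.single v 1))"
      using that e by (auto intro!: sum.cong simp: pscale_single)
    finally show "convolve f p ?u = p" using sum_pscale_single[of p] by simp
  qed
  have "\<exists>a. p = pscale a ?u" if "Poly_Mapping.keys p \<subseteq> M"
    "\<forall>q. Poly_Mapping.keys q \<subseteq> M \<longrightarrow> convolve f p q = convolve f q p" for p
  proof -
    have "Poly_Mapping.keys p \<subseteq> {e}"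
      using that by (intro center) auto
    then have "p = pscale (Poly_Mapping.lookup p e) ?u"
      by (intro poly_mapping_eqI) (auto simp: lookup_single when_def in_keys_iff)
    then show ?thesis ..
  qed
  moreover define u where "u = ?u"
  moreover from this have "u \<noteq> 0" "Poly_Mapping.keys u \<subseteq> {e}" by simp_all
  ultimately show ?thesis
    using e(1) unit unfolding u_def[symmetric]
    by (intro defines_scalars_unital)
      (auto simp: magma_algebra_def convolve_scale_left convolve_scale_right)
qed

section \<open>Free associative algebras\<close>

text \<open>With at most one generator all words are powers of the letter \<open>0\<close>, and
  these commute.\<close>

lemma noncommutative_free_assoc_unital_rank:
  assumes "noncommutative (free_assoc_unital n :: ('k::field, nat list \<Rightarrow>\<^sub>0 'k) kalg)"
  shows "2 \<le> n"
proof (rule ccontr)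
  assume "\<not> 2 \<le> n"
  then have "n \<le> 1" by simp
  have "u @ v = v @ u" if "u \<in> lists {..<n}" "v \<in> lists {..<n}" for u v :: "nat list"
  proof -
    have "w = replicate (length w) 0" if "w \<in> lists {..<n}" for w
      using that \<open>n \<le> 1\<close> by (intro replicate_eqI) auto
    then have "u = replicate (length u) 0" "v = replicate (length v) 0" using that by blast+
    then show ?thesis by (metis replicate_add add.commute)
  qed
  then show False
    using assms unfolding noncommutative_def free_assoc_unital_def magma_algebra_def
    by (auto simp: subset_iff intro!: convolve_commute)
qed

lemma free_assoc_unital_defines_scalars:
  assumes "noncommutative (free_assoc_unital n :: ('k::field, nat list \<Rightarrow>\<^sub>0 'k) kalg)"
  shows "\<exists>X. defines_scalars (free_assoc_unital n :: ('k, nat list \<Rightarrow>\<^sub>0 'k) kalg) X"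
  unfolding free_assoc_unital_def
proof (rule exI, rule defines_scalars_magma_algebra_with_unit)
  have n: "2 \<le> n" using assms by (rule noncommutative_free_assoc_unital_rank)
  fix p :: "nat list \<Rightarrow>\<^sub>0 'k"
  assume comm: "\<And>u. u \<in> lists {..<n} \<Longrightarrow>
    convolve (@) p (Poly_Mapping.single u 1) = convolve (@) (Poly_Mapping.single u 1) p"
  \<comment> \<open>The word \<open>w @ [i]\<close> arises in only one way in the product of
    \<open>p\<close> with the letter \<open>i\<close>, so it survives there. By commutativity it
    also occurs in the product with the letter on the left.\<close>
  have hd: "\<exists>v. w @ [i] = i # v" if "w \<in> Poly_Mapping.keys p" "i < n" for w i
  proof -
    have "Poly_Mapping.lookup (convolve (@) p (Poly_Mapping.single [i] 1)) (w @ [i]) =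
        Poly_Mapping.lookup p w * Poly_Mapping.lookup (Poly_Mapping.single [i] 1) [i]"
      by (rule lookup_convolve_unique) auto
    then have "w @ [i] \<in> Poly_Mapping.keys (convolve (@) p (Poly_Mapping.single [i] 1))"
      using that(1) by (simp add: in_keys_iff)
    also have "convolve (@) p (Poly_Mapping.single [i] 1) = convolve (@) (Poly_Mapping.single [i] 1) p"
      using comm that(2) by simp
    finally show ?thesis by (rule keys_convolve) (auto split: if_splits)
  qed
  show "Poly_Mapping.keys p \<subseteq> {[]}"
  proof
    fix w assume w: "w \<in> Poly_Mapping.keys p"
    \<comment> \<open>A nonempty \<open>w\<close> would have to begin with both 0 and 1, which are
      letters since \<open>n\<close> is at least 2.\<close>
    show "w \<in> {[]}"
      using hd[OF w, of 0] hd[OF w, of 1] n by (cases w) auto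
  qed
qed auto

text \<open>At \<open>p = 0\<close> this is the maximum of the empty set, so the degree is only
  meaningful for nonzero \<open>p\<close>.\<close>

definition word_degree :: "('x list \<Rightarrow>\<^sub>0 'k::zero) \<Rightarrow> nat" where
  "word_degree p = Max (length ` Poly_Mapping.keys p)"

lemma word_degree_ge: "u \<in> Poly_Mapping.keys p \<Longrightarrow> length u \<le> word_degree p"
  by (simp add: word_degree_def)

lemma word_degree_witness:
  assumes "p \<noteq> 0" obtains u where "u \<in> Poly_Mapping.keys p" "length u = word_degree p"
proof -
  have "word_degree p \<in> length ` Poly_Mapping.keys p"
    unfolding word_degree_def using assms by (intro Max_in) auto
  then show ?thesis using that by auto
qed

text \<open>Take words of maximal length in both supports. Another factorization of their
  concatenation would need a longer word on one side, so their product does not cancel; hence there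
  are no zero divisors and degrees add.\<close>

lemma convolve_append_leading:
  fixes p q :: "'x list \<Rightarrow>\<^sub>0 'k::field"
  assumes "p \<noteq> 0" "q \<noteq> 0"
  shows "convolve (@) p q \<noteq> 0" "word_degree (convolve (@) p q) = word_degree p + word_degree q"
proof -
  obtain u where u: "u \<in> Poly_Mapping.keys p" "length u = word_degree p"
    using word_degree_witness[OF assms(1)] .
  obtain v where v: "v \<in> Poly_Mapping.keys q" "length v = word_degree q"
    using word_degree_witness[OF assms(2)] .
  have "Poly_Mapping.lookup (convolve (@) p q) (u @ v) = Poly_Mapping.lookup p u * Poly_Mapping.lookup q v"
  proof (rule lookup_convolve_unique)
    fix u' v' assume *: "u' \<in> Poly_Mapping.keys p" "v' \<in> Poly_Mapping.keys q" "u' @ v' = u @ v"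
    have "length u' + length v' = length u + length v" using arg_cong[OF *(3), of length] by simp
    then have "length u' = length u"
      using word_degree_ge[OF *(1)] word_degree_ge[OF *(2)] u(2) v(2) by linarith
    then show "u' = u \<and> v' = v" using *(3) by simp
  qed
  then have uv: "u @ v \<in> Poly_Mapping.keys (convolve (@) p q)" using u v by (simp add: in_keys_iff)
  then show "convolve (@) p q \<noteq> 0" by auto
  have "length w \<le> word_degree p + word_degree q" if "w \<in> Poly_Mapping.keys (convolve (@) p q)" for w
    using that by (rule keys_convolve) (auto intro: add_mono word_degree_ge)
  then show "word_degree (convolve (@) p q) = word_degree p + word_degree q"
    unfolding word_degree_def[of "convolve (@) p q"] using uv u(2) v(2)
    by (intro Max_eqI) (auto simp: image_iff intro!: bexI[of _ "u @ v"])
qed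

lemma free_assoc_nonunital_defines_scalars:
  assumes "noncommutative (free_assoc_nonunital n :: ('k::field, nat list \<Rightarrow>\<^sub>0 'k) kalg)"
  shows "\<exists>X. defines_scalars (free_assoc_nonunital n :: ('k, nat list \<Rightarrow>\<^sub>0 'k) kalg) X"
proof -
  let ?M = "lists {..<n} - {[]}"
  let ?L = "free_assoc_nonunital n :: ('k, nat list \<Rightarrow>\<^sub>0 'k) kalg"
  have L: "dom ?L = {p. Poly_Mapping.keys p \<subseteq> ?M}" "rzero ?L = 0" "rmul ?L = convolve (@)" "scale ?L = pscale"
    by (simp_all add: free_assoc_nonunital_def magma_algebra_def)
  have n: "n \<noteq> 0"
  proof
    assume "n = 0"
    then have "dom ?L = {0}" unfolding L by auto
    then show False using assms by (simp add: noncommutative_def L)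
  qed
  let ?x = "Poly_Mapping.single [0] 1 :: nat list \<Rightarrow>\<^sub>0 'k"
  have x: "?x \<in> dom ?L" "?x \<noteq> 0" using n by (auto simp: L)
  have deg_pos: "1 \<le> word_degree p" if p: "p \<in> dom ?L" "p \<noteq> 0" for p
  proof -
    obtain u where "u \<in> Poly_Mapping.keys p" "length u = word_degree p"
      using word_degree_witness[OF p(2)] .
    then show ?thesis using p(1) by (cases u) (auto simp: L)
  qed
  have degx: "word_degree ?x = 1" by (simp add: word_degree_def)
  have multiple: "\<exists>a. q = pscale a p" if p: "p \<in> dom ?L" "p \<noteq> 0" and q: "q \<in> dom ?L" "q \<noteq> 0"
    and 1: "\<forall>z\<in>dom ?L. \<exists>w\<in>dom ?L. convolve (@) q z = convolve (@) p w"
    and 2: "\<forall>z\<in>dom ?L. \<exists>w\<in>dom ?L. convolve (@) p z = convolve (@) q w" for p q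
  proof -
    obtain w where w: "w \<in> dom ?L" "convolve (@) q ?x = convolve (@) p w" using 1 x by blast
    obtain w' where w': "w' \<in> dom ?L" "convolve (@) p ?x = convolve (@) q w'" using 2 x by blast
    have "w \<noteq> 0" "w' \<noteq> 0"
      using convolve_append_leading(1)[OF q(2) x(2)] convolve_append_leading(1)[OF p(2) x(2)] w w' by auto
    \<comment> \<open>Testing both containments on a single letter gives two degree equations whose
      sum is \<open>word_degree w + word_degree w' = 2\<close>. Without the empty word both degrees
      are positive, hence 1.\<close>
    have "word_degree q + 1 = word_degree p + word_degree w"
      using convolve_append_leading(2)[OF q(2) x(2)] convolve_append_leading(2)[OF p(2) \<open>w \<noteq> 0\<close>] w degx by simp
    moreover have "word_degree p + 1 = word_degree q + word_degree w'"
      using convolve_append_leading(2)[OF p(2) x(2)] convolve_append_leading(2)[OF q(2) \<open>w' \<noteq> 0\<close>] w' degx by simp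
    ultimately have "word_degree w = 1"
      using deg_pos[OF w(1) \<open>w \<noteq> 0\<close>] deg_pos[OF w'(1) \<open>w' \<noteq> 0\<close>] by linarith
    then have len: "length v = 1" if "v \<in> Poly_Mapping.keys w" for v
      using word_degree_ge[OF that] w(1) that by (cases v) (auto simp: L)
    \<comment> \<open>At words ending in the letter 0 only the coefficient of \<open>[0]\<close> in
      \<open>w\<close> contributes, so this coefficient is the scalar.\<close>
    have "Poly_Mapping.lookup q u = Poly_Mapping.lookup p u * Poly_Mapping.lookup w [0]" for u
    proof -
      have "Poly_Mapping.lookup (convolve (@) q ?x) (u @ [0]) = Poly_Mapping.lookup q u * Poly_Mapping.lookup ?x [0]"
        by (rule lookup_convolve_unique) auto
      moreover have "Poly_Mapping.lookup (convolve (@) p w) (u @ [0]) = Poly_Mapping.lookup p u * Poly_Mapping.lookup w [0]"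
        by (rule lookup_convolve_unique) (auto dest!: len simp: length_Suc_conv)
      ultimately show ?thesis using w(2) by simp
    qed
    then have "q = pscale (Poly_Mapping.lookup w [0]) p"
      by (intro poly_mapping_eqI) simp
    then show ?thesis ..
  qed
  have cancel: "q = r" if "p \<noteq> 0" "convolve (@) p q = convolve (@) p r" for p q r :: "nat list \<Rightarrow>\<^sub>0 'k"
    using convolve_append_leading(1)[OF that(1), of "q - r"] that(2) by (auto simp: convolve_diff_right)
  have "defines_scalars ?L (dom ?L - {rzero ?L})"
  proof (rule defines_scalars_cancellative)
    show "vector_space_like ?L"
      unfolding free_assoc_nonunital_def by (rule vector_space_like_magma_algebra) auto
    show "dom ?L - {rzero ?L} \<noteq> {}" using x by (auto simp: L(2))
    show "rmul ?L (scale ?L a p) q = scale ?L a (rmul ?L p q) \<and>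
        rmul ?L p (scale ?L a q) = scale ?L a (rmul ?L p q)" for a p q
      by (simp add: L(3,4) convolve_scale_left convolve_scale_right)
    show "q = r" if "p \<noteq> rzero ?L" "rmul ?L p q = rmul ?L p r" for p q r
      using that cancel unfolding L(2,3) by blast
    show "\<exists>a. q = scale ?L a p" if "p \<in> dom ?L" "q \<in> dom ?L" "p \<noteq> rzero ?L" "q \<noteq> rzero ?L"
      "\<forall>z\<in>dom ?L. \<exists>w\<in>dom ?L. rmul ?L q z = rmul ?L p w"
      "\<forall>z\<in>dom ?L. \<exists>w\<in>dom ?L. rmul ?L p z = rmul ?L q w" for p q
      using multiple[of p q] that unfolding L(2-4) by blast
  qed
  then show ?thesis ..
qed

section \<open>Lyndon words and free Lie algebras\<close>

lemma append_less_cancel_left [simp]: "w @ x < w @ y \<longleftrightarrow> (x :: 'x::linorder list) < y"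
  by (induction w) auto

lemma less_append [simp]: "x < x @ y \<longleftrightarrow> (y :: 'x::linorder list) \<noteq> []"
  using append_less_cancel_left[of x "[]" y] by (cases y) simp_all

lemma append_less_if_not_prefix:
  fixes u v :: "'x::linorder list"
  assumes "u < v" "\<nexists>z. v = u @ z"
  shows "u @ x < v @ y"
  using assms
proof (induction u arbitrary: v)
  case (Cons a u)
  then show ?case by (cases v) auto
qed simp

lemma append_less_same_length:
  fixes u v :: "'x::linorder list"
  assumes "u < v" "length u = length v"
  shows "u @ x < v @ y"
  using assms by (intro append_less_if_not_prefix) auto

definition lyndon :: "'x::linorder list \<Rightarrow> bool" where
  "lyndon w \<longleftrightarrow> w \<noteq> [] \<and> (\<forall>x y. w = x @ y \<longrightarrow> x \<noteq> [] \<longrightarrow> y \<noteq> [] \<longrightarrow> w < y)"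

lemma lyndon_less_suffix: "lyndon (x @ y) \<Longrightarrow> x \<noteq> [] \<Longrightarrow> y \<noteq> [] \<Longrightarrow> x @ y < y"
  by (simp add: lyndon_def)

text \<open>If \<open>u\<close> is a prefix of \<open>v\<close>, the rest of \<open>v\<close> is a
  proper suffix and so exceeds \<open>v\<close>; putting \<open>u\<close> in front of both sides
  preserves the inequality. Otherwise the first difference between \<open>u\<close> and
  \<open>v\<close> decides.\<close>

lemma lyndon_append_less:
  assumes "lyndon u" "lyndon v" "u < v"
  shows "u @ v < v"
proof (cases "\<exists>z. v = u @ z")
  case True
  then obtain z where z: "v = u @ z" by blast
  then have "v < z" using assms by (auto simp: lyndon_def)
  then show ?thesis using append_less_cancel_left[of u v z] z by simp
next
  case False
  then show ?thesis using append_less_if_not_prefix[OF assms(3), of v "[]"] by simp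
qed

text \<open>The word \<open>v\<close> lies strictly between the two products. This tells which term
  of a commutator leads, and it shows that distinct Lyndon words do not commute.\<close>

lemma lyndon_append_less_append:
  assumes "lyndon u" "lyndon v" "u < v"
  shows "u @ v < v @ u"
proof -
  have "v < v @ u" using assms(1) by (simp add: lyndon_def)
  with lyndon_append_less[OF assms] show ?thesis by (rule less_trans)
qed

primrec foliage :: "'x magma \<Rightarrow> 'x list" where
  "foliage (Gen i) = [i]"
| "foliage (Br s t) = foliage s @ foliage t"

lemma foliage_nonempty [simp]: "foliage t \<noteq> []"
  by (induction t) auto

lemma set_foliage: "set (foliage t) = set_magma t"
  by (induction t) auto

text \<open>The standard bracketings of Lyndon words.\<close>

primrec hall_tree :: "'x::linorder magma \<Rightarrow> bool" where
  "hall_tree (Gen i) \<longleftrightarrow> True"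
| "hall_tree (Br s t) \<longleftrightarrow> hall_tree s \<and> hall_tree t \<and> foliage s < foliage t \<and>
     (\<forall>s1 s2. s = Br s1 s2 \<longrightarrow> foliage t \<le> foliage s2)"

lemma append_not_singleton: "x \<noteq> [] \<Longrightarrow> y \<noteq> [] \<Longrightarrow> x @ y \<noteq> [i]" "x \<noteq> [] \<Longrightarrow> y \<noteq> [] \<Longrightarrow> [i] \<noteq> x @ y"
  by (cases x; simp)+

text \<open>The right factor of a standard bracketing is its least proper suffix. A suffix that
  starts inside \<open>s\<close> exceeds a proper suffix of \<open>foliage s\<close>, which by
  induction is at least \<open>foliage s2\<close> and hence at least \<open>foliage t\<close>; one
  that starts inside \<open>t\<close> is larger because \<open>foliage t\<close> is Lyndon. The two
  claims need each other in the induction.\<close>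

lemma hall_tree_suffix_and_lyndon:
  assumes "hall_tree r"
  shows "(\<forall>s t x y. r = Br s t \<longrightarrow> foliage r = x @ y \<longrightarrow> x \<noteq> [] \<longrightarrow> y \<noteq> [] \<longrightarrow> foliage t \<le> y) \<and>
    lyndon (foliage r)"
  using assms
proof (induction r)
  case (Gen i)
  have "lyndon [i]"
    unfolding lyndon_def
  proof (intro conjI allI impI)
    fix x y assume "[i] = x @ y" "x \<noteq> []" "y \<noteq> []"
    then show "[i] < y" by (cases x) simp_all
  qed simp
  then show ?case by simp
next
  case (Br s t)
  from Br.prems have s: "hall_tree s" and t: "hall_tree t" and less: "foliage s < foliage t"
    and le: "\<And>s1 s2. s = Br s1 s2 \<Longrightarrow> foliage t \<le> foliage s2" by simp_all
  have suffix: "foliage t \<le> y" if xy: "foliage s @ foliage t = x @ y" "x \<noteq> []" "y \<noteq> []" for x y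
    using xy(1) unfolding append_eq_append_conv2
  proof (elim exE disjE conjE)
    fix us assume us: "foliage s = x @ us" "us @ foliage t = y"
    show ?thesis
    proof (cases "us = []")
      case True
      then show ?thesis using us by simp
    next
      case False
      then have "us < y" using us less_append[of us "foliage t"] by simp
      moreover have "foliage t \<le> us"
      proof (cases s)
        case (Gen i)
        then show ?thesis using us(1) append_not_singleton(1)[OF xy(2) False] by (metis foliage.simps(1))
      next
        case Br': (Br s1 s2)
        then have "foliage s2 \<le> us" using Br.IH(1)[OF s] us(1) xy(2) False by blast
        then show ?thesis using le[OF Br'] by simp
      qed
      ultimately show ?thesis by simp
    qed
  next
    fix us assume us: "foliage s @ us = x" "foliage t = us @ y"
    then show ?thesis
      using lyndon_less_suffix[of us y] Br.IH(2)[OF t] xy(3) by (cases "us = []") simp_all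
  qed
  have "foliage s @ foliage t < foliage t"
    using lyndon_append_less less Br.IH s t by blast
  then have "lyndon (foliage (Br s t))"
    unfolding lyndon_def using suffix by (auto intro: less_le_trans)
  then show ?case using suffix by simp
qed

lemma lyndon_foliage: "hall_tree r \<Longrightarrow> lyndon (foliage r)"
  using hall_tree_suffix_and_lyndon by blast

lemma foliage_le_suffix:
  "hall_tree (Br s t) \<Longrightarrow> foliage s @ foliage t = x @ y \<Longrightarrow> x \<noteq> [] \<Longrightarrow> y \<noteq> [] \<Longrightarrow> foliage t \<le> y"
  using hall_tree_suffix_and_lyndon[of "Br s t"] by (metis foliage.simps(2))

text \<open>For two bracketings of one word, the word of either right factor is the least proper
  suffix. So the right factors have the same word, and both bracketings split at the same
  place.\<close>

lemma foliage_inject: "hall_tree r \<Longrightarrow> hall_tree r' \<Longrightarrow> foliage r = foliage r' \<longleftrightarrow> r = r'"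
proof (induction r arbitrary: r')
  case (Gen i)
  then show ?case by (cases r') (simp_all add: append_not_singleton)
next
  case (Br s t)
  show ?case
  proof (cases r')
    case (Gen i)
    then show ?thesis by (simp add: append_not_singleton)
  next
    case r': (Br s' t')
    show ?thesis
    proof
      assume eq: "foliage (Br s t) = foliage r'"
      have "foliage t \<le> foliage t'" using foliage_le_suffix[OF Br.prems(1), of "foliage s'" "foliage t'"] eq r' by simp
      moreover have "foliage t' \<le> foliage t"
        using foliage_le_suffix[OF Br.prems(2)[unfolded r'], of "foliage s" "foliage t"] eq r' by simp
      ultimately have "foliage t = foliage t'" by simp
      moreover from this have "foliage s = foliage s'" using eq r' by simp
      ultimately show "Br s t = r'"
        using Br.IH(1)[of s'] Br.IH(2)[of t'] Br.prems r' by simp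
    qed simp
  qed
qed

text \<open>The order on words in which products of leading words are leading: longer words come first, and
  words of the same length are compared lexicographically.\<close>

definition precedes :: "'x::linorder list \<Rightarrow> 'x list \<Rightarrow> bool" where
  "precedes u v \<longleftrightarrow> length v < length u \<or> length v = length u \<and> u < v"

lemma precedes_trans: "precedes u v \<Longrightarrow> precedes v w \<Longrightarrow> precedes u w"
  unfolding precedes_def by auto

lemma precedes_irrefl [simp]: "\<not> precedes u u"
  unfolding precedes_def by auto

lemma precedes_linear: "u = v \<or> precedes u v \<or> precedes v u"
  unfolding precedes_def by (metis linorder_neqE)

section \<open>Leading words in the free associative algebra\<close>

lemma first_word:
  fixes W :: "'x::linorder list set"
  assumes "finite W" "W \<noteq> {}"
  obtains u where "u \<in> W" "\<And>v. v \<in> W \<Longrightarrow> v \<noteq> u \<Longrightarrow> precedes u v"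
proof -
  have "\<exists>u\<in>W. \<forall>v\<in>W. v \<noteq> u \<longrightarrow> precedes u v"
    using assms
  proof (induction W rule: finite_ne_induct)
    case (insert w W)
    then obtain u where "u \<in> W" "\<forall>v\<in>W. v \<noteq> u \<longrightarrow> precedes u v" by blast
    then show ?case
      using precedes_linear[of u w] by (metis insert_iff precedes_trans)
  qed simp
  then show ?thesis using that by blast
qed

definition leading :: "('x::linorder list \<Rightarrow>\<^sub>0 'k::zero) \<Rightarrow> 'x list \<Rightarrow> bool" where
  "leading p u \<longleftrightarrow> u \<in> Poly_Mapping.keys p \<and> (\<forall>v\<in>Poly_Mapping.keys p. v \<noteq> u \<longrightarrow> precedes u v)"

lemma leading_exists: "p \<noteq> 0 \<Longrightarrow> \<exists>u. leading p u"
  using first_word[of "Poly_Mapping.keys p"] unfolding leading_def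
  by (metis finite_keys keys_eq_empty)

lemma leading_unique: "leading p u \<Longrightarrow> leading p v \<Longrightarrow> u = v"
  unfolding leading_def by (metis precedes_irrefl precedes_trans)

lemma precedes_append:
  assumes "u' = u \<or> precedes u u'" "v' = v \<or> precedes v v'" "u' \<noteq> u \<or> v' \<noteq> v"
  shows "precedes (u @ v) (u' @ v')"
  using assms append_less_same_length[of u u' v v'] by (auto simp: precedes_def)

text \<open>Concatenation is strictly monotone for \<open>precedes\<close>, so the two leading words
  are the only pair in the supports that yields \<open>u @ v\<close>, and no cancellation occurs
  there.\<close>

lemma leading_convolve:
  fixes p q :: "'x::linorder list \<Rightarrow>\<^sub>0 'k::field"
  assumes "leading p u" "leading q v"
  shows "leading (convolve (@) p q) (u @ v)"
    and "Poly_Mapping.lookup (convolve (@) p q) (u @ v) = Poly_Mapping.lookup p u * Poly_Mapping.lookup q v"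
proof -
  have *: "precedes (u @ v) (u' @ v')"
    if "u' \<in> Poly_Mapping.keys p" "v' \<in> Poly_Mapping.keys q" "u' \<noteq> u \<or> v' \<noteq> v" for u' v'
    using assms that unfolding leading_def by (intro precedes_append) auto
  show l: "Poly_Mapping.lookup (convolve (@) p q) (u @ v) = Poly_Mapping.lookup p u * Poly_Mapping.lookup q v"
    by (rule lookup_convolve_unique) (metis * precedes_irrefl)
  then have "u @ v \<in> Poly_Mapping.keys (convolve (@) p q)"
    using assms unfolding leading_def by (simp add: in_keys_iff)
  moreover have "precedes (u @ v) w" if "w \<in> Poly_Mapping.keys (convolve (@) p q)" "w \<noteq> u @ v" for w
    using that * by (auto elim!: keys_convolve)
  ultimately show "leading (convolve (@) p q) (u @ v)" unfolding leading_def by blast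
qed

lemma leading_diff:
  fixes p q :: "'x::linorder list \<Rightarrow>\<^sub>0 'k::field"
  assumes "leading p u" "leading q v" "precedes u v"
  shows "leading (p - q) u" "Poly_Mapping.lookup (p - q) u = Poly_Mapping.lookup p u"
proof -
  have "u \<notin> Poly_Mapping.keys q"
    using assms(2,3) unfolding leading_def by (metis precedes_irrefl precedes_trans)
  then show l: "Poly_Mapping.lookup (p - q) u = Poly_Mapping.lookup p u"
    by (simp add: lookup_minus in_keys_iff)
  have "precedes u w" if "w \<in> Poly_Mapping.keys (p - q)" "w \<noteq> u" for w
  proof -
    have "w \<in> Poly_Mapping.keys p \<or> w \<in> Poly_Mapping.keys q"
      using that(1) by (auto simp: in_keys_iff lookup_minus)
    then show ?thesis
      using assms that(2) unfolding leading_def by (metis precedes_trans)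
  qed
  moreover have "u \<in> Poly_Mapping.keys (p - q)"
    using assms(1) l by (simp add: leading_def in_keys_iff)
  ultimately show "leading (p - q) u" unfolding leading_def by blast
qed

section \<open>Commutators and the values of bracketings\<close>

definition bracket :: "('x list \<Rightarrow>\<^sub>0 'k) \<Rightarrow> ('x list \<Rightarrow>\<^sub>0 'k) \<Rightarrow> ('x list \<Rightarrow>\<^sub>0 'k::field)" where
  "bracket p q = convolve (@) p q - convolve (@) q p"

lemma pscale_diff:
  fixes p :: "'b \<Rightarrow>\<^sub>0 'k::ring"
  shows "pscale c (p - q) = pscale c p - pscale c q"
  using pscale_add[of c "p - q" q] by (simp add: algebra_simps)

lemma bracket_scale: "bracket (pscale c p) q = pscale c (bracket p q)" "bracket p (pscale c q) = pscale c (bracket p q)"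
  by (simp_all add: bracket_def convolve_scale_left convolve_scale_right pscale_diff)

lemma bracket_zero [simp]: "bracket 0 p = 0" "bracket p 0 = 0" "bracket p p = 0"
  by (simp_all add: bracket_def)

lemma bracket_diff: "bracket (p - p') q = bracket p q - bracket p' q" "bracket p (q - q') = bracket p q - bracket p q'"
  by (simp_all add: bracket_def convolve_diff_left convolve_diff_right)

lemma bracket_sum: "bracket (\<Sum>i\<in>I. p i) q = (\<Sum>i\<in>I. bracket (p i) q)" "bracket p' (\<Sum>i\<in>I. q' i) = (\<Sum>i\<in>I. bracket p' (q' i))"
  by (simp_all add: bracket_def convolve_sum_left convolve_sum_right sum_subtractf)

lemma convolve_append_assoc:
  fixes p q r :: "'x list \<Rightarrow>\<^sub>0 'k::field"
  shows "convolve (@) (convolve (@) p q) r = convolve (@) p (convolve (@) q r)"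
proof -
  let ?s = "\<lambda>u. Poly_Mapping.single u (1::'k)"
  have "convolve (@) (convolve (@) (\<Sum>u\<in>Poly_Mapping.keys p. pscale (Poly_Mapping.lookup p u) (?s u))
      (\<Sum>u\<in>Poly_Mapping.keys q. pscale (Poly_Mapping.lookup q u) (?s u)))
      (\<Sum>u\<in>Poly_Mapping.keys r. pscale (Poly_Mapping.lookup r u) (?s u)) =
    convolve (@) (\<Sum>u\<in>Poly_Mapping.keys p. pscale (Poly_Mapping.lookup p u) (?s u))
      (convolve (@) (\<Sum>u\<in>Poly_Mapping.keys q. pscale (Poly_Mapping.lookup q u) (?s u))
      (\<Sum>u\<in>Poly_Mapping.keys r. pscale (Poly_Mapping.lookup r u) (?s u)))"
    by (simp only: convolve_sum_left convolve_sum_right convolve_scale_left convolve_scale_right convolve_single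
        append_assoc pscale_sum mult_1)
  then show ?thesis by (simp only: sum_pscale_single[symmetric])
qed

lemma bracket_jacobi: "bracket (bracket p q) r + bracket (bracket q r) p + bracket (bracket r p) q = 0"
  by (simp add: bracket_def convolve_diff_left convolve_diff_right convolve_append_assoc)

primrec tree_value :: "'x magma \<Rightarrow> ('x list \<Rightarrow>\<^sub>0 'k::field)" where
  "tree_value (Gen i) = Poly_Mapping.single [i] 1"
| "tree_value (Br s t) = bracket (tree_value s) (tree_value t)"

text \<open>The two products in the commutator have leading words
  \<open>foliage s @ foliage t\<close> and \<open>foliage t @ foliage s\<close>. The former is
  smaller because both factors are Lyndon and in increasing order, and it keeps the coefficient
  1.\<close>

lemma leading_hall_tree:
  assumes "hall_tree r"
  shows "leading (tree_value r :: _ \<Rightarrow>\<^sub>0 'k::field) (foliage r) \<and>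
    Poly_Mapping.lookup (tree_value r :: _ \<Rightarrow>\<^sub>0 'k) (foliage r) = 1"
  using assms
proof (induction r)
  case (Gen i)
  then show ?case by (simp add: leading_def)
next
  case (Br s t)
  let ?s = "tree_value s :: _ \<Rightarrow>\<^sub>0 'k" and ?t = "tree_value t :: _ \<Rightarrow>\<^sub>0 'k"
  have IH: "leading ?s (foliage s)" "Poly_Mapping.lookup ?s (foliage s) = 1"
    "leading ?t (foliage t)" "Poly_Mapping.lookup ?t (foliage t) = 1"
    using Br by auto
  have prec: "precedes (foliage s @ foliage t) (foliage t @ foliage s)"
    using lyndon_append_less_append[of "foliage s" "foliage t"] Br.prems
    by (simp add: precedes_def lyndon_foliage)
  note lead = leading_diff[OF leading_convolve(1)[OF IH(1,3)] leading_convolve(1)[OF IH(3,1)] prec]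
  show ?case
    using lead leading_convolve(2)[OF IH(1,3)] IH(2,4) by (simp add: bracket_def)
qed

text \<open>The homomorphism from the free non-associative algebra to the free associative algebra
  with its commutator bracket.\<close>

definition evaluate :: "('x magma \<Rightarrow>\<^sub>0 'k) \<Rightarrow> ('x list \<Rightarrow>\<^sub>0 'k::field)" where
  "evaluate p = (\<Sum>t\<in>Poly_Mapping.keys p. pscale (Poly_Mapping.lookup p t) (tree_value t))"

lemma evaluate_superset:
  assumes "finite T" "Poly_Mapping.keys p \<subseteq> T"
  shows "evaluate p = (\<Sum>t\<in>T. pscale (Poly_Mapping.lookup p t) (tree_value t))"
  unfolding evaluate_def using assms by (intro sum.mono_neutral_left) (auto simp: in_keys_iff)

lemma evaluate_zero [simp]: "evaluate 0 = 0"
  by (simp add: evaluate_def)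

lemma evaluate_add:
  fixes p q :: "'x magma \<Rightarrow>\<^sub>0 'k::field"
  shows "evaluate (p + q) = evaluate p + evaluate q"
proof -
  let ?T = "Poly_Mapping.keys p \<union> Poly_Mapping.keys q"
  have "pscale (a + b) r = pscale a r + pscale b r" for a b and r :: "'x list \<Rightarrow>\<^sub>0 'k"
    by (rule poly_mapping_eqI) (simp add: lookup_add algebra_simps)
  then show ?thesis
    using evaluate_superset[of ?T "p + q"] evaluate_superset[of ?T p] evaluate_superset[of ?T q]
      Poly_Mapping.keys_add[of p q]
    by (simp add: lookup_add sum.distrib)
qed

lemma pscale_pscale: "pscale a (pscale b p) = pscale (a * b) (p :: 'b \<Rightarrow>\<^sub>0 'k::field)"
  by (rule poly_mapping_eqI) (simp add: algebra_simps)

lemma evaluate_scale: "evaluate (pscale c p) = pscale c (evaluate p)"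
proof -
  have "evaluate (pscale c p) =
      (\<Sum>t\<in>Poly_Mapping.keys p. pscale (Poly_Mapping.lookup (pscale c p) t) (tree_value t))"
    by (rule evaluate_superset) (auto intro: keys_pscale[THEN subsetD])
  then show ?thesis by (simp add: evaluate_def pscale_sum pscale_pscale)
qed

lemma evaluate_diff: "evaluate (p - q) = evaluate p - evaluate q"
  using evaluate_add[of "p - q" q] by (simp add: algebra_simps)

lemma evaluate_sum: "evaluate (\<Sum>i\<in>I. p i) = (\<Sum>i\<in>I. evaluate (p i))"
  by (induction I rule: infinite_finite_induct) (simp_all add: evaluate_add)

lemma evaluate_single: "evaluate (Poly_Mapping.single t a) = pscale a (tree_value t)"
  using evaluate_superset[of "{t}" "Poly_Mapping.single t a"] by simp

lemma evaluate_convolve: "evaluate (convolve Br p q) = bracket (evaluate p) (evaluate q)"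
  by (simp add: convolve_def evaluate_sum evaluate_single evaluate_def[of p] evaluate_def[of q]
      bracket_sum bracket_scale pscale_sum pscale_pscale)
    (subst sum.swap, simp add: mult.commute)

lemma evaluate_lie_ideal: "p \<in> lie_ideal n \<Longrightarrow> evaluate p = 0"
  by (induction rule: lie_ideal.induct)
    (simp_all add: evaluate_convolve evaluate_add evaluate_scale bracket_jacobi)

text \<open>Distinct standard bracketings have distinct leading words. The first of these words
  among the keys occurs in the value of one tree only and survives, so the values are linearly
  independent.\<close>

lemma leading_evaluate:
  fixes q :: "'x::linorder magma \<Rightarrow>\<^sub>0 'k::field"
  assumes "q \<noteq> 0" "\<And>t. t \<in> Poly_Mapping.keys q \<Longrightarrow> hall_tree t"
  shows "\<exists>t\<in>Poly_Mapping.keys q. leading (evaluate q) (foliage t)"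
proof -
  let ?v = "tree_value :: _ \<Rightarrow> _ \<Rightarrow>\<^sub>0 'k"
  obtain t where t: "t \<in> Poly_Mapping.keys q"
    "\<And>s. s \<in> Poly_Mapping.keys q \<Longrightarrow> s \<noteq> t \<Longrightarrow> precedes (foliage t) (foliage s)"
  proof -
    obtain u where "u \<in> foliage ` Poly_Mapping.keys q"
      "\<And>v. v \<in> foliage ` Poly_Mapping.keys q \<Longrightarrow> v \<noteq> u \<Longrightarrow> precedes u v"
      using first_word[of "foliage ` Poly_Mapping.keys q"] assms(1)
      by (metis finite_imageI finite_keys image_is_empty keys_eq_empty)
    then show ?thesis using that foliage_inject assms(2) by (metis image_iff)
  qed
  have hall: "leading (?v s) (foliage s)" "Poly_Mapping.lookup (?v s) (foliage s) = 1"
    if "s \<in> Poly_Mapping.keys q" for s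
    using leading_hall_tree assms(2) that by blast+
  have key: "w = foliage t \<and> s = t \<or> precedes (foliage t) w"
    if "s \<in> Poly_Mapping.keys q" "w \<in> Poly_Mapping.keys (?v s)" for s w
    using hall(1)[OF that(1)] that t(2)[OF that(1)] unfolding leading_def by (metis precedes_trans)
  have l: "Poly_Mapping.lookup (evaluate q) w = (\<Sum>s\<in>Poly_Mapping.keys q. Poly_Mapping.lookup q s * Poly_Mapping.lookup (?v s) w)" for w
    by (simp add: evaluate_def lookup_sum)
  have "Poly_Mapping.lookup (evaluate q) (foliage t) = (\<Sum>s\<in>Poly_Mapping.keys q. if s = t then Poly_Mapping.lookup q t else 0)"
    unfolding l
  proof (intro sum.cong refl)
    fix s assume s: "s \<in> Poly_Mapping.keys q"
    show "Poly_Mapping.lookup q s * Poly_Mapping.lookup (?v s) (foliage t) = (if s = t then Poly_Mapping.lookup q t else 0)"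
    proof (cases "s = t")
      case True
      then show ?thesis using hall(2)[OF s] by simp
    next
      case False
      then have "foliage t \<notin> Poly_Mapping.keys (?v s)" using key[OF s, of "foliage t"] by (metis precedes_irrefl)
      then show ?thesis using False by (simp add: in_keys_iff)
    qed
  qed
  also have "\<dots> = Poly_Mapping.lookup q t" using t(1) by simp
  finally have "foliage t \<in> Poly_Mapping.keys (evaluate q)" using t(1) by (simp add: in_keys_iff)
  moreover have "precedes (foliage t) w" if w: "w \<in> Poly_Mapping.keys (evaluate q)" "w \<noteq> foliage t" for w
  proof -
    have "\<exists>s\<in>Poly_Mapping.keys q. Poly_Mapping.lookup (?v s) w \<noteq> 0"
    proof (rule ccontr)
      assume "\<not> ?thesis"
      then have "Poly_Mapping.lookup (evaluate q) w = 0"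
        unfolding l by (intro sum.neutral) simp
      then show False using w(1) by (simp add: in_keys_iff)
    qed
    then obtain s where "s \<in> Poly_Mapping.keys q" "w \<in> Poly_Mapping.keys (?v s)"
      by (metis in_keys_iff)
    then show ?thesis using key[of s w] w(2) by simp
  qed
  ultimately show ?thesis using t(1) unfolding leading_def by blast
qed

section \<open>Rewriting to standard bracketings modulo the Lie ideal\<close>

lemma in_dom_free_nonassoc:
  "p \<in> dom (free_nonassoc n) \<longleftrightarrow> (\<forall>t\<in>Poly_Mapping.keys p. set_magma t \<subseteq> {..<n})"
  by (auto simp: free_nonassoc_def magma_algebra_def)

lemma lie_ideal_uminus:
  fixes p :: "nat magma \<Rightarrow>\<^sub>0 'k::field"
  assumes "p \<in> lie_ideal n" shows "- p \<in> lie_ideal n"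
proof -
  have "- p = pscale (- 1) p" by (rule poly_mapping_eqI) simp
  then show ?thesis using lie_ideal.scale[OF assms, of "- 1"] by simp
qed

lemma lie_ideal_diff: "p \<in> lie_ideal n \<Longrightarrow> q \<in> lie_ideal n \<Longrightarrow> p - q \<in> lie_ideal n"
  using lie_ideal.add[OF _ lie_ideal_uminus, of p n q] by simp

text \<open>The predicate \<open>R\<close> carries bounds on length and word of the trees used; the
  termination of the rewriting depends on these bounds.\<close>

definition hall_spanned :: "nat \<Rightarrow> (nat magma \<Rightarrow> bool) \<Rightarrow> (nat magma \<Rightarrow>\<^sub>0 'k::field) \<Rightarrow> bool" where
  "hall_spanned n R p \<longleftrightarrow>
     (\<exists>q. Poly_Mapping.keys q \<subseteq> {r. hall_tree r \<and> set_magma r \<subseteq> {..<n} \<and> R r} \<and> p - q \<in> lie_ideal n)"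

lemma hall_spanned_mod: "p - p' \<in> lie_ideal n \<Longrightarrow> hall_spanned n R p' \<Longrightarrow> hall_spanned n R p"
  unfolding hall_spanned_def using lie_ideal.add[of "p - p'" n] by fastforce

lemma hall_spanned_zero: "hall_spanned n R 0"
  unfolding hall_spanned_def by (rule exI[of _ 0]) (simp add: lie_ideal.zero)

lemma hall_spanned_add:
  assumes "hall_spanned n R p" "hall_spanned n R p'" shows "hall_spanned n R (p + p')"
proof -
  obtain q q' where q: "Poly_Mapping.keys q \<subseteq> {r. hall_tree r \<and> set_magma r \<subseteq> {..<n} \<and> R r}" "p - q \<in> lie_ideal n"
    "Poly_Mapping.keys q' \<subseteq> {r. hall_tree r \<and> set_magma r \<subseteq> {..<n} \<and> R r}" "p' - q' \<in> lie_ideal n"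
    using assms unfolding hall_spanned_def by blast
  have "p + p' - (q + q') \<in> lie_ideal n" using lie_ideal.add[OF q(2,4)] by (simp add: algebra_simps)
  moreover have "Poly_Mapping.keys (q + q') \<subseteq> {r. hall_tree r \<and> set_magma r \<subseteq> {..<n} \<and> R r}"
    using q(1,3) Poly_Mapping.keys_add[of q q'] by blast
  ultimately show ?thesis unfolding hall_spanned_def by blast
qed

lemma hall_spanned_scale:
  assumes "hall_spanned n R p" shows "hall_spanned n R (pscale c p)"
proof -
  obtain q where q: "Poly_Mapping.keys q \<subseteq> {r. hall_tree r \<and> set_magma r \<subseteq> {..<n} \<and> R r}" "p - q \<in> lie_ideal n"
    using assms unfolding hall_spanned_def by blast
  have "pscale c p - pscale c q \<in> lie_ideal n" using lie_ideal.scale[OF q(2)] by (simp add: pscale_diff)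
  moreover have "Poly_Mapping.keys (pscale c q) \<subseteq> {r. hall_tree r \<and> set_magma r \<subseteq> {..<n} \<and> R r}"
    using q(1) keys_pscale[of c q] by blast
  ultimately show ?thesis unfolding hall_spanned_def by blast
qed

lemma hall_spanned_sum: "(\<And>i. i \<in> I \<Longrightarrow> hall_spanned n R (p i)) \<Longrightarrow> hall_spanned n R (\<Sum>i\<in>I. p i)"
  by (induction I rule: infinite_finite_induct) (simp_all add: hall_spanned_zero hall_spanned_add)

lemma hall_spanned_tree:
  "hall_tree r \<Longrightarrow> set_magma r \<subseteq> {..<n} \<Longrightarrow> R r \<Longrightarrow> hall_spanned n R (Poly_Mapping.single r 1)"
  unfolding hall_spanned_def
  by (rule exI[of _ "Poly_Mapping.single r 1"]) (auto simp: lie_ideal.zero)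

lemma hall_spanned_mono: "hall_spanned n R p \<Longrightarrow> (\<And>r. R r \<Longrightarrow> R' r) \<Longrightarrow> hall_spanned n R' p"
  unfolding hall_spanned_def by blast

text \<open>Factors may be replaced modulo the ideal one after the other: the change is
  \<open>(p - q) p' + q (p' - q')\<close>, where the cofactors \<open>p'\<close> and
  \<open>q\<close> lie in the algebra.\<close>

lemma hall_spanned_convolve:
  fixes p p' :: "nat magma \<Rightarrow>\<^sub>0 'k::field"
  assumes "hall_spanned n R p" "hall_spanned n R' p'" "p' \<in> dom (free_nonassoc n)"
    and tree: "\<And>r r'. hall_tree r \<Longrightarrow> set_magma r \<subseteq> {..<n} \<Longrightarrow> R r \<Longrightarrow> hall_tree r' \<Longrightarrow> set_magma r' \<subseteq> {..<n} \<Longrightarrow> R' r' \<Longrightarrow>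
      hall_spanned n S (Poly_Mapping.single (Br r r') 1 :: _ \<Rightarrow>\<^sub>0 'k)"
  shows "hall_spanned n S (convolve Br p p')"
proof -
  obtain q q' where q: "Poly_Mapping.keys q \<subseteq> {r. hall_tree r \<and> set_magma r \<subseteq> {..<n} \<and> R r}" "p - q \<in> lie_ideal n"
    "Poly_Mapping.keys q' \<subseteq> {r. hall_tree r \<and> set_magma r \<subseteq> {..<n} \<and> R' r}" "p' - q' \<in> lie_ideal n"
    using assms unfolding hall_spanned_def by blast
  have "q \<in> dom (free_nonassoc n)" using q(1) by (auto simp: in_dom_free_nonassoc)
  then have "convolve Br (p - q) p' + convolve Br q (p' - q') \<in> lie_ideal n"
    using q(2,4) assms(3) by (intro lie_ideal.add lie_ideal.left lie_ideal.right)
  then have "convolve Br p p' - convolve Br q q' \<in> lie_ideal n"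
    by (simp add: convolve_diff_left convolve_diff_right algebra_simps)
  moreover have "convolve Br q q' = (\<Sum>u\<in>Poly_Mapping.keys q. \<Sum>v\<in>Poly_Mapping.keys q'.
      pscale (Poly_Mapping.lookup q u * Poly_Mapping.lookup q' v) (Poly_Mapping.single (Br u v) 1))"
    by (simp add: convolve_def pscale_single)
  moreover have "hall_spanned n S \<dots>"
    using q(1,3) by (intro hall_spanned_sum hall_spanned_scale tree) auto
  ultimately show ?thesis using hall_spanned_mod by metis
qed

text \<open>Antisymmetry modulo the ideal comes from polarizing squares: the square of a sum minus
  the two squares leaves \<open>Br s t\<close> plus \<open>Br t s\<close>.\<close>

lemma hall_spanned_bracket_swap:
  assumes "set_magma s \<subseteq> {..<n}" "set_magma t \<subseteq> {..<n}"
    and "hall_spanned n R (Poly_Mapping.single (Br s t) 1 :: _ \<Rightarrow>\<^sub>0 'k::field)"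
  shows "hall_spanned n R (Poly_Mapping.single (Br t s) 1 :: _ \<Rightarrow>\<^sub>0 'k)"
proof (rule hall_spanned_mod)
  let ?s = "Poly_Mapping.single s 1 :: _ \<Rightarrow>\<^sub>0 'k" and ?t = "Poly_Mapping.single t 1 :: _ \<Rightarrow>\<^sub>0 'k"
  have d: "?s \<in> dom (free_nonassoc n)" "?t \<in> dom (free_nonassoc n)" "?s + ?t \<in> dom (free_nonassoc n)"
    using assms Poly_Mapping.keys_add[of ?s ?t] by (auto simp: in_dom_free_nonassoc)
  have "convolve Br (?s + ?t) (?s + ?t) - convolve Br ?s ?s - convolve Br ?t ?t \<in> lie_ideal n"
    by (intro lie_ideal_diff lie_ideal.square d)
  also have "convolve Br (?s + ?t) (?s + ?t) - convolve Br ?s ?s - convolve Br ?t ?t =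
    Poly_Mapping.single (Br t s) 1 - pscale (- 1) (Poly_Mapping.single (Br s t) 1)"
    by (simp add: convolve_add_left convolve_add_right convolve_single pscale_single single_uminus)
  finally show "Poly_Mapping.single (Br t s) 1 - pscale (- 1) (Poly_Mapping.single (Br s t) 1 :: _ \<Rightarrow>\<^sub>0 'k) \<in> lie_ideal n" .
  show "hall_spanned n R (pscale (- 1) (Poly_Mapping.single (Br s t) 1 :: _ \<Rightarrow>\<^sub>0 'k))"
    by (rule hall_spanned_scale) fact
qed

text \<open>The lexicographic order has infinite descending chains such as \<open>[1]\<close>,
  \<open>[0, 1]\<close>, \<open>[0, 0, 1]\<close>. Under a length bound over a finite alphabet the
  number of smaller words is finite and serves as a rank.\<close>

definition words_below :: "nat \<Rightarrow> nat \<Rightarrow> nat list \<Rightarrow> nat list set" where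
  "words_below n N w = {v. set v \<subseteq> {..<n} \<and> length v \<le> N \<and> v < w}"

lemma card_words_below:
  assumes "v < w" "set v \<subseteq> {..<n}" "length v \<le> N"
  shows "card (words_below n N v) < card (words_below n N w)"
proof (rule psubset_card_mono)
  show "finite (words_below n N w)"
    by (rule finite_subset[OF _ finite_lists_length_le[of "{..<n}" N]]) (auto simp: words_below_def)
  show "words_below n N v \<subset> words_below n N w" using assms by (auto simp: words_below_def)
qed

text \<open>Rewriting with the Jacobi identity as long as the bracketing is not standard. It terminates since
  the larger of the two words decreases while the length of their concatenation stays the same.\<close>

lemma hall_spanned_bracket:
  assumes "hall_tree s" "hall_tree t" "set_magma s \<subseteq> {..<n}" "set_magma t \<subseteq> {..<n}"
  shows "hall_spanned n (\<lambda>r. length (foliage r) = length (foliage s) + length (foliage t) \<and>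
      foliage r < max (foliage s) (foliage t)) (Poly_Mapping.single (Br s t) 1 :: _ \<Rightarrow>\<^sub>0 'k::field)"
    (is "?P s t")
  using assms
proof (induction "(length (foliage s) + length (foliage t),
      card (words_below n (length (foliage s) + length (foliage t)) (max (foliage s) (foliage t))))"
    arbitrary: s t rule: wf_induct_rule[OF wf_lex_prod[OF wf_less_than wf_less_than]])
  case (1 s t)
  let ?m = "\<lambda>t. Poly_Mapping.single t 1 :: _ \<Rightarrow>\<^sub>0 'k"
  have IH1: "?P s' t'" if "hall_tree s'" "hall_tree t'" "set_magma s' \<subseteq> {..<n}" "set_magma t' \<subseteq> {..<n}"
    "length (foliage s') + length (foliage t') < length (foliage s) + length (foliage t)" for s' t'
    by (rule 1(1)) (use that in auto)
  have IH2: "?P s' t'" if "hall_tree s'" "hall_tree t'" "set_magma s' \<subseteq> {..<n}" "set_magma t' \<subseteq> {..<n}"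
    "length (foliage s') + length (foliage t') = length (foliage s) + length (foliage t)"
    "max (foliage s') (foliage t') < max (foliage s) (foliage t)" for s' t'
  proof (rule 1(1))
    have "set (max (foliage s') (foliage t')) \<subseteq> {..<n}"
      using that by (simp add: max_def set_foliage)
    moreover have "length (max (foliage s') (foliage t')) \<le> length (foliage s) + length (foliage t)"
      using that(5) by (simp add: max_def)
    ultimately have "card (words_below n (length (foliage s) + length (foliage t)) (max (foliage s') (foliage t'))) <
        card (words_below n (length (foliage s) + length (foliage t)) (max (foliage s) (foliage t)))"
      by (intro card_words_below that(6))
    then show "((length (foliage s') + length (foliage t'),
        card (words_below n (length (foliage s') + length (foliage t')) (max (foliage s') (foliage t')))),
      length (foliage s) + length (foliage t),
        card (words_below n (length (foliage s) + length (foliage t)) (max (foliage s) (foliage t))))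
      \<in> less_than <*lex*> less_than"
      using that(5) by simp
  qed (use that in auto)
  \<comment> \<open>This is the case of increasing words. The induction hypotheses are restated for
    its own \<open>s\<close> and \<open>t\<close>, because it is also applied to the swapped
    pair.\<close>
  have main: "?P s t" if st: "foliage s < foliage t" "hall_tree s" "hall_tree t" "set_magma s \<subseteq> {..<n}" "set_magma t \<subseteq> {..<n}"
    and IH1: "\<And>s' t'. hall_tree s' \<Longrightarrow> hall_tree t' \<Longrightarrow> set_magma s' \<subseteq> {..<n} \<Longrightarrow> set_magma t' \<subseteq> {..<n} \<Longrightarrow>
      length (foliage s') + length (foliage t') < length (foliage s) + length (foliage t) \<Longrightarrow> ?P s' t'"
    and IH2: "\<And>s' t'. hall_tree s' \<Longrightarrow> hall_tree t' \<Longrightarrow> set_magma s' \<subseteq> {..<n} \<Longrightarrow> set_magma t' \<subseteq> {..<n} \<Longrightarrow>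
      length (foliage s') + length (foliage t') = length (foliage s) + length (foliage t) \<Longrightarrow>
      foliage s' < foliage t \<Longrightarrow> foliage t' < foliage t \<Longrightarrow> ?P s' t'" for s t
  proof (cases "\<forall>s1 s2. s = Br s1 s2 \<longrightarrow> foliage t \<le> foliage s2")
    case True
    \<comment> \<open>Here \<open>Br s t\<close> is itself standard, and its word lies below
      \<open>foliage t\<close>.\<close>
    then show ?thesis
      using st lyndon_append_less[of "foliage s" "foliage t"]
      by (intro hall_spanned_tree) (auto simp: lyndon_foliage max_def)
  next
    case False
    then obtain s1 s2 where s: "s = Br s1 s2" "foliage s2 < foliage t" by (auto simp: not_le)
    have h: "hall_tree s1" "hall_tree s2" "set_magma s1 \<subseteq> {..<n}" "set_magma s2 \<subseteq> {..<n}"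
      using s st by auto
    have "foliage s1 < foliage t"
      using s(1) st(1) less_append[of "foliage s1" "foliage s2"]
      by (metis foliage.simps(2) foliage_nonempty less_trans)
    let ?R = "\<lambda>r. length (foliage r) = length (foliage s) + length (foliage t) \<and> foliage r < max (foliage s) (foliage t)"
    \<comment> \<open>The inner bracket is expanded first. The words it yields lie strictly below
      \<open>foliage t\<close>, and so does \<open>foliage w\<close>; hence the larger word has
      decreased when the outer bracket is expanded.\<close>
    have nested: "hall_spanned n ?R (convolve Br (?m (Br u v)) (?m w))"
      if sp: "?P u v" and uvw: "hall_tree w" "set_magma w \<subseteq> {..<n}" "max (foliage u) (foliage v) \<le> foliage t"
        "length (foliage u) + length (foliage v) + length (foliage w) = length (foliage s) + length (foliage t)"
        "foliage w < foliage t" for u v w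
    proof (rule hall_spanned_convolve[OF sp])
      show "hall_spanned n (\<lambda>r. r = w) (?m w)" using uvw by (intro hall_spanned_tree) auto
      show "?m w \<in> dom (free_nonassoc n)" using uvw by (simp add: in_dom_free_nonassoc)
      fix r r' assume r: "hall_tree r" "set_magma r \<subseteq> {..<n}"
        "length (foliage r) = length (foliage u) + length (foliage v) \<and> foliage r < max (foliage u) (foliage v)"
        "hall_tree r'" "set_magma r' \<subseteq> {..<n}" "r' = w"
      then have "foliage r < foliage t" using uvw(3) by (metis less_le_trans)
      then have "?P r w" using r uvw by (intro IH2) auto
      moreover have "max (foliage r) (foliage w) < foliage t" using \<open>foliage r < foliage t\<close> uvw(5) by simp
      ultimately show "hall_spanned n ?R (?m (Br r r'))"
        using r uvw(4) st(1) unfolding \<open>r' = w\<close> by (elim hall_spanned_mono) (auto simp: max_def)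
    qed
    have A: "hall_spanned n ?R (convolve Br (?m (Br s2 t)) (?m s1))"
      using s h st \<open>foliage s1 < foliage t\<close> by (intro nested IH1) auto
    have B: "hall_spanned n ?R (convolve Br (?m (Br t s1)) (?m s2))"
      using s h st \<open>foliage s1 < foliage t\<close> by (intro nested IH1) auto
    \<comment> \<open>Since \<open>s = Br s1 s2\<close>, the Jacobi identity trades
      \<open>Br s t\<close> for nested brackets in which \<open>t\<close> first meets
      \<open>s2\<close> or \<open>s1\<close>; these inner pairs have smaller total length.\<close>
    have "convolve Br (convolve Br (?m s1) (?m s2)) (?m t) + convolve Br (convolve Br (?m s2) (?m t)) (?m s1) +
        convolve Br (convolve Br (?m t) (?m s1)) (?m s2) \<in> lie_ideal n"
      using h st by (intro lie_ideal.jacobi) (auto simp: in_dom_free_nonassoc)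
    also have "convolve Br (convolve Br (?m s1) (?m s2)) (?m t) + convolve Br (convolve Br (?m s2) (?m t)) (?m s1) +
        convolve Br (convolve Br (?m t) (?m s1)) (?m s2) =
      ?m (Br s t) - pscale (- 1) (convolve Br (?m (Br s2 t)) (?m s1) + convolve Br (?m (Br t s1)) (?m s2))"
      by (simp add: convolve_single s(1) pscale_add pscale_single single_uminus)
    finally show ?thesis
      by (rule hall_spanned_mod) (intro hall_spanned_scale hall_spanned_add A B)
  qed
  consider "foliage s = foliage t" | "foliage s < foliage t" | "foliage t < foliage s"
    by (meson linorder_neqE)
  then show ?case
  proof cases
    case 1
    then have "s = t" using \<open>hall_tree s\<close> \<open>hall_tree t\<close> foliage_inject by blast
    have "?m s \<in> dom (free_nonassoc n)" using \<open>set_magma s \<subseteq> {..<n}\<close> by (simp add: in_dom_free_nonassoc)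
    then have "convolve Br (?m s) (?m s) \<in> lie_ideal n" by (rule lie_ideal.square)
    then have "?m (Br s t) - 0 \<in> lie_ideal n" using \<open>s = t\<close> by (simp add: convolve_single)
    then show ?thesis using hall_spanned_zero by (rule hall_spanned_mod)
  next
    case 2
    show ?thesis
    proof (rule main[OF 2 "1.prems"])
      show "?P s' t'" if "hall_tree s'" "hall_tree t'" "set_magma s' \<subseteq> {..<n}" "set_magma t' \<subseteq> {..<n}"
        "length (foliage s') + length (foliage t') = length (foliage s) + length (foliage t)"
        "foliage s' < foliage t" "foliage t' < foliage t" for s' t'
        by (rule IH2[OF that(1-5)]) (use that(6,7) 2 in \<open>simp add: max_absorb2 less_imp_le\<close>)
    qed (rule IH1)
  next
    case 3
    have "?P t s"
    proof (rule main[OF 3 "1.prems"(2,1,4,3)])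
      show "?P s' t'" if "hall_tree s'" "hall_tree t'" "set_magma s' \<subseteq> {..<n}" "set_magma t' \<subseteq> {..<n}"
        "length (foliage s') + length (foliage t') < length (foliage t) + length (foliage s)" for s' t'
        by (rule IH1[OF that(1-4)]) (use that(5) in simp)
      show "?P s' t'" if "hall_tree s'" "hall_tree t'" "set_magma s' \<subseteq> {..<n}" "set_magma t' \<subseteq> {..<n}"
        "length (foliage s') + length (foliage t') = length (foliage t) + length (foliage s)"
        "foliage s' < foliage s" "foliage t' < foliage s" for s' t'
        by (rule IH2[OF that(1-4)]) (use that(5-7) 3 in \<open>simp_all add: max_absorb1 less_imp_le\<close>)
    qed
    then have "hall_spanned n (\<lambda>r. length (foliage r) = length (foliage s) + length (foliage t) \<and>
        foliage r < max (foliage s) (foliage t)) (?m (Br t s))"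
      by (simp add: max.commute add.commute)
    then show ?thesis using "1.prems" by (intro hall_spanned_bracket_swap[of t n s])
  qed
qed

lemma hall_spanned_free_nonassoc:
  fixes p :: "nat magma \<Rightarrow>\<^sub>0 'k::field"
  assumes "p \<in> dom (free_nonassoc n)"
  shows "hall_spanned n (\<lambda>r. True) p"
proof -
  have tree: "hall_spanned n (\<lambda>r. True) (Poly_Mapping.single t 1 :: _ \<Rightarrow>\<^sub>0 'k)" if "set_magma t \<subseteq> {..<n}" for t
    using that
  proof (induction t)
    case (Gen i)
    then show ?case by (intro hall_spanned_tree) auto
  next
    case (Br s t)
    have "hall_spanned n (\<lambda>r. True) (convolve Br (Poly_Mapping.single s 1 :: _ \<Rightarrow>\<^sub>0 'k) (Poly_Mapping.single t 1))"
    proof (rule hall_spanned_convolve)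
      show "hall_spanned n (\<lambda>r. True) (Poly_Mapping.single (Br r r') 1 :: _ \<Rightarrow>\<^sub>0 'k)"
        if "hall_tree r" "set_magma r \<subseteq> {..<n}" "hall_tree r'" "set_magma r' \<subseteq> {..<n}" for r r'
        using hall_spanned_bracket[OF that(1,3,2,4)] by (rule hall_spanned_mono) simp
    qed (use Br in \<open>auto simp: in_dom_free_nonassoc\<close>)
    then show ?case by (simp add: convolve_single)
  qed
  have "hall_spanned n (\<lambda>r. True) (\<Sum>u\<in>Poly_Mapping.keys p. pscale (Poly_Mapping.lookup p u) (Poly_Mapping.single u 1))"
    using assms by (intro hall_spanned_sum hall_spanned_scale tree) (auto simp: in_dom_free_nonassoc)
  then show ?thesis using sum_pscale_single[of p] by simp
qed

lemma hall_representative: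
  fixes p :: "nat magma \<Rightarrow>\<^sub>0 'k::field"
  assumes "p \<in> dom (free_nonassoc n)"
  shows "\<exists>q. (\<forall>t\<in>Poly_Mapping.keys q. hall_tree t) \<and> p - q \<in> lie_ideal n \<and> evaluate p = evaluate q"
proof -
  obtain q where q: "Poly_Mapping.keys q \<subseteq> {r. hall_tree r \<and> set_magma r \<subseteq> {..<n} \<and> True}" "p - q \<in> lie_ideal n"
    using hall_spanned_free_nonassoc[OF assms] unfolding hall_spanned_def by blast
  have "evaluate p = evaluate q" using evaluate_lie_ideal[OF q(2)] by (simp add: evaluate_diff)
  then show ?thesis using q by (intro exI[of _ q]) auto
qed

text \<open>Modulo the ideal, \<open>p\<close> is a combination of standard bracketings with the
  same value. A nonzero combination would have a leading word in its value, so value zero forces the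
  combination to vanish.\<close>

lemma evaluate_eq_zero_iff:
  fixes p :: "nat magma \<Rightarrow>\<^sub>0 'k::field"
  assumes "p \<in> dom (free_nonassoc n)"
  shows "evaluate p = 0 \<longleftrightarrow> p \<in> lie_ideal n"
proof
  assume 0: "evaluate p = 0"
  obtain q where q: "\<forall>t\<in>Poly_Mapping.keys q. hall_tree t" "p - q \<in> lie_ideal n" "evaluate p = evaluate q"
    using hall_representative[OF assms] by blast
  have "q = 0"
  proof (rule ccontr)
    assume "q \<noteq> 0"
    then obtain t where "leading (evaluate q) (foliage t)" using leading_evaluate[of q] q(1) by blast
    then show False using 0 q(3) by (simp add: leading_def)
  qed
  then show "p \<in> lie_ideal n" using q(2) by simp
qed (rule evaluate_lie_ideal)

section \<open>The free Lie algebra as an algebra of Lie polynomials\<close>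

definition lie_polynomials :: "nat \<Rightarrow> ('k::field, nat list \<Rightarrow>\<^sub>0 'k) kalg" where
  "lie_polynomials n =
     \<lparr>dom = evaluate ` dom (free_nonassoc n), rzero = 0, radd = (+), rmul = bracket, scale = pscale\<rparr>"

lemma lie_polynomials_simps [simp]:
  "dom (lie_polynomials n) = evaluate ` dom (free_nonassoc n)" "rzero (lie_polynomials n) = 0"
  "radd (lie_polynomials n) = (+)" "rmul (lie_polynomials n) = bracket" "scale (lie_polynomials n) = pscale"
  by (simp_all add: lie_polynomials_def)

lemma dom_free_nonassoc_closed:
  "0 \<in> dom (free_nonassoc n)"
  "p \<in> dom (free_nonassoc n) \<Longrightarrow> q \<in> dom (free_nonassoc n) \<Longrightarrow> p + q \<in> dom (free_nonassoc n)"
  "p \<in> dom (free_nonassoc n) \<Longrightarrow> q \<in> dom (free_nonassoc n) \<Longrightarrow> convolve Br p q \<in> dom (free_nonassoc n)"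
  "p \<in> dom (free_nonassoc n) \<Longrightarrow> pscale c p \<in> dom (free_nonassoc n)"
  using keys_pscale[of c p] Poly_Mapping.keys_add[of p q]
  by (auto simp: in_dom_free_nonassoc elim!: keys_convolve) blast+

lemma dom_lie_polynomials_closed:
  fixes x y :: "nat list \<Rightarrow>\<^sub>0 'k::field"
  assumes "x \<in> evaluate ` dom (free_nonassoc n)"
  shows "pscale c x \<in> evaluate ` dom (free_nonassoc n)"
    and "y \<in> evaluate ` dom (free_nonassoc n) \<Longrightarrow> x + y \<in> evaluate ` dom (free_nonassoc n)"
    and "y \<in> evaluate ` dom (free_nonassoc n) \<Longrightarrow> x - y \<in> evaluate ` dom (free_nonassoc n)"
    and "y \<in> evaluate ` dom (free_nonassoc n) \<Longrightarrow> bracket x y \<in> evaluate ` dom (free_nonassoc n)"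
proof -
  have s: "pscale c x \<in> evaluate ` dom (free_nonassoc n)"
    if "x \<in> evaluate ` dom (free_nonassoc n)" for c and x :: "nat list \<Rightarrow>\<^sub>0 'k"
    using that by (auto simp: evaluate_scale[symmetric] dom_free_nonassoc_closed)
  have a: "x + y \<in> evaluate ` dom (free_nonassoc n)" if "y \<in> evaluate ` dom (free_nonassoc n)" for y
    using that assms by (auto simp: evaluate_add[symmetric] dom_free_nonassoc_closed)
  show "pscale c x \<in> evaluate ` dom (free_nonassoc n)" by (rule s) fact
  show "x + y \<in> evaluate ` dom (free_nonassoc n)" if "y \<in> evaluate ` dom (free_nonassoc n)"
    by (rule a) fact
  show "bracket x y \<in> evaluate ` dom (free_nonassoc n)" if "y \<in> evaluate ` dom (free_nonassoc n)"
    using that assms by (auto simp: evaluate_convolve[symmetric] dom_free_nonassoc_closed)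
  show "x - y \<in> evaluate ` dom (free_nonassoc n)" if "y \<in> evaluate ` dom (free_nonassoc n)"
  proof -
    have "x - y = x + pscale (- 1) y" by (rule poly_mapping_eqI) (simp add: lookup_add lookup_minus)
    then show ?thesis using a[OF s[OF that]] by metis
  qed
qed

text \<open>The kernel of \<open>evaluate\<close> is the ideal, so the cosets are its fibers, and
  sending a Lie polynomial to its fiber inverts the map induced on the quotient.\<close>

lemma alg_iso_free_lie: "alg_iso (lie_polynomials n) (free_lie n :: ('k::field, _) kalg)"
proof -
  let ?N = "dom (free_nonassoc n) :: (nat magma \<Rightarrow>\<^sub>0 'k) set"
  define fib where "fib x = {q \<in> ?N. evaluate q = x}" for x
  have N: "p - q \<in> ?N" if "p \<in> ?N" "q \<in> ?N" for p q
  proof -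
    have "p - q = p + pscale (- 1) q" by (rule poly_mapping_eqI) (simp add: lookup_add lookup_minus)
    then show ?thesis using that dom_free_nonassoc_closed by metis
  qed
  have coset: "ideal_coset (free_nonassoc n) (lie_ideal n) p = fib (evaluate p)" if "p \<in> ?N" for p
    using that N evaluate_eq_zero_iff[OF N[OF _ that]]
    by (auto simp: ideal_coset_def fib_def evaluate_diff[symmetric] simp flip: evaluate_eq_zero_iff)
       (simp_all add: evaluate_diff)
  have fib: "p \<in> fib (evaluate p)" "fib (evaluate p) \<subseteq> ?N" if "p \<in> ?N" for p
    using that by (auto simp: fib_def)
  have in_fib: "q \<in> ?N" "evaluate q = x" if "q \<in> fib x" for q x
    using that by (auto simp: fib_def)
  have inj: "x = y" if "x \<in> evaluate ` ?N" "fib x = fib y" for x y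
    using that by (auto simp: fib_def)
  have N_simps: "rzero (free_nonassoc n) = (0 :: nat magma \<Rightarrow>\<^sub>0 'k)"
    "radd (free_nonassoc n) = ((+) :: _ \<Rightarrow> _ \<Rightarrow> nat magma \<Rightarrow>\<^sub>0 'k)"
    "rmul (free_nonassoc n) = (convolve Br :: _ \<Rightarrow> _ \<Rightarrow> nat magma \<Rightarrow>\<^sub>0 'k)"
    "scale (free_nonassoc n) = (pscale :: _ \<Rightarrow> _ \<Rightarrow> nat magma \<Rightarrow>\<^sub>0 'k)"
    by (simp_all add: free_nonassoc_def magma_algebra_def)
  \<comment> \<open>All members of this nonempty union are the same fiber, so the union is that
    fiber.\<close>
  have UN2: "(\<Union>p\<in>fib x. \<Union>q\<in>fib y. ideal_coset (free_nonassoc n) (lie_ideal n) (g p q)) = fib (h x y)"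
    if xy: "x \<in> evaluate ` ?N" "y \<in> evaluate ` ?N"
      and g: "\<And>p q. p \<in> ?N \<Longrightarrow> q \<in> ?N \<Longrightarrow> g p q \<in> ?N \<and> evaluate (g p q) = h (evaluate p) (evaluate q)" for x y g h
  proof -
    have "ideal_coset (free_nonassoc n) (lie_ideal n) (g p q) = fib (h x y)" if "p \<in> fib x" "q \<in> fib y" for p q
      using coset[of "g p q"] in_fib[OF that(1)] in_fib[OF that(2)] g by simp
    moreover have "fib x \<noteq> {}" "fib y \<noteq> {}" using xy by (auto simp: fib_def)
    ultimately show ?thesis by simp
  qed
  have UN1: "(\<Union>p\<in>fib x. ideal_coset (free_nonassoc n) (lie_ideal n) (pscale c p)) = fib (pscale c x)"
    if "x \<in> evaluate ` ?N" for x c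
  proof -
    have "ideal_coset (free_nonassoc n) (lie_ideal n) (pscale c p) = fib (pscale c x)" if "p \<in> fib x" for p
      using coset[of "pscale c p"] in_fib[OF that] by (simp add: dom_free_nonassoc_closed evaluate_scale)
    moreover have "fib x \<noteq> {}" using that by (auto simp: fib_def)
    ultimately show ?thesis by simp
  qed
  show ?thesis
    unfolding alg_iso_def
  proof (intro exI[of _ fib] conjI ballI allI)
    show "bij_betw fib (dom (lie_polynomials n)) (dom (free_lie n))"
      unfolding bij_betw_def
    proof
      show "inj_on fib (dom (lie_polynomials n))" using inj by (intro inj_onI) simp
      show "fib ` dom (lie_polynomials n) = dom (free_lie n)"
        using coset by (simp add: free_lie_def quotient_algebra_def image_image)
    qed
    show "fib (rzero (lie_polynomials n)) = rzero (free_lie n)"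
      using coset[OF dom_free_nonassoc_closed(1)] by (simp add: free_lie_def quotient_algebra_def N_simps)
    show "fib (radd (lie_polynomials n) x y) = radd (free_lie n) (fib x) (fib y)"
      if "x \<in> dom (lie_polynomials n)" "y \<in> dom (lie_polynomials n)" for x y
    proof -
      have "(\<Union>p\<in>fib x. \<Union>q\<in>fib y. ideal_coset (free_nonassoc n) (lie_ideal n) (p + q)) = fib (x + y)"
        by (rule UN2) (use that in \<open>simp_all add: dom_free_nonassoc_closed evaluate_add\<close>)
      then show ?thesis by (simp add: free_lie_def quotient_algebra_def N_simps)
    qed
    show "fib (rmul (lie_polynomials n) x y) = rmul (free_lie n) (fib x) (fib y)"
      if "x \<in> dom (lie_polynomials n)" "y \<in> dom (lie_polynomials n)" for x y
    proof -
      have "(\<Union>p\<in>fib x. \<Union>q\<in>fib y. ideal_coset (free_nonassoc n) (lie_ideal n) (convolve Br p q)) = fib (bracket x y)"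
        by (rule UN2) (use that in \<open>simp_all add: dom_free_nonassoc_closed evaluate_convolve\<close>)
      then show ?thesis by (simp add: free_lie_def quotient_algebra_def N_simps)
    qed
    show "fib (scale (lie_polynomials n) c x) = scale (free_lie n) c (fib x)"
      if "x \<in> dom (lie_polynomials n)" for c x
      using UN1[of x c] that by (simp add: free_lie_def quotient_algebra_def N_simps)
  qed
qed

lemma leading_lie_polynomial:
  fixes x :: "nat list \<Rightarrow>\<^sub>0 'k::field"
  assumes "x \<in> evaluate ` dom (free_nonassoc n)" "leading x u"
  shows "lyndon u"
proof -
  obtain p where p: "p \<in> dom (free_nonassoc n)" "x = evaluate p" using assms(1) by blast
  obtain q where q: "\<forall>t\<in>Poly_Mapping.keys q. hall_tree t" "x = evaluate q"
    using hall_representative[OF p(1)] p(2) by blast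
  have "q \<noteq> 0" using assms(2) q(2) by (auto simp: leading_def)
  then obtain t where "t \<in> Poly_Mapping.keys q" "leading x (foliage t)"
    using leading_evaluate[of q] q by blast
  then show ?thesis using leading_unique[OF assms(2)] lyndon_foliage q(1) by metis
qed

lemma commuting_lie_polynomials_leading:
  fixes x y :: "nat list \<Rightarrow>\<^sub>0 'k::field"
  assumes "x \<in> evaluate ` dom (free_nonassoc n)" "y \<in> evaluate ` dom (free_nonassoc n)"
    "bracket x y = 0" "leading x u" "leading y v"
  shows "u = v"
proof (rule ccontr)
  assume "u \<noteq> v"
  have l: "lyndon u" "lyndon v" using assms leading_lie_polynomial by blast+
  have "leading (convolve (@) x y) (u @ v)" "leading (convolve (@) y x) (v @ u)"
    using leading_convolve(1) assms by blast+
  moreover have "convolve (@) x y = convolve (@) y x" using assms(3) by (simp add: bracket_def)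
  ultimately have "u @ v = v @ u" using leading_unique by metis
  then show False
    using lyndon_append_less_append[OF l] lyndon_append_less_append[OF l(2,1)] \<open>u \<noteq> v\<close>
    by (metis less_irrefl linorder_neqE)
qed

text \<open>Subtracting a suitable multiple of \<open>x\<close> from \<open>y\<close> removes the
  coefficient at the leading word \<open>u\<close> of \<open>x\<close>. The difference still
  commutes with \<open>x\<close>, so if it were nonzero its leading word would again be
  \<open>u\<close>.\<close>

lemma lie_polynomial_centralizer:
  fixes x y :: "nat list \<Rightarrow>\<^sub>0 'k::field"
  assumes x: "x \<in> evaluate ` dom (free_nonassoc n)" "x \<noteq> 0" and y: "y \<in> evaluate ` dom (free_nonassoc n)"
    and "bracket x y = 0"
  shows "\<exists>a. y = pscale a x"
proof -
  obtain u where u: "leading x u" using leading_exists[OF x(2)] ..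
  define a where "a = Poly_Mapping.lookup y u / Poly_Mapping.lookup x u"
  have "Poly_Mapping.lookup x u \<noteq> 0" using u by (simp add: leading_def in_keys_iff)
  then have "Poly_Mapping.lookup (y - pscale a x) u = 0" by (simp add: lookup_minus a_def)
  moreover have "y - pscale a x \<in> evaluate ` dom (free_nonassoc n)"
    by (intro dom_lie_polynomials_closed x(1) y)
  moreover have "bracket x (y - pscale a x) = 0" using assms(4) by (simp add: bracket_diff bracket_scale)
  ultimately have "y - pscale a x = 0"
    using commuting_lie_polynomials_leading[OF x(1) _ _ u] leading_exists
    by (metis in_keys_iff leading_def)
  then show ?thesis by auto
qed

lemma vector_space_like_subspace:
  fixes B :: "('b \<Rightarrow>\<^sub>0 'k::field) set"
  assumes "0 \<in> B" "\<And>x y. x \<in> B \<Longrightarrow> y \<in> B \<Longrightarrow> x + y \<in> B \<and> g x y \<in> B" "\<And>c x. x \<in> B \<Longrightarrow> pscale c x \<in> B"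
  shows "vector_space_like \<lparr>dom = B, rzero = 0, radd = (+), rmul = g, scale = pscale\<rparr>"
proof -
  \<comment> \<open>The laws are inherited from the space of all finitely supported functions, which
    becomes an instance once it is given some product, here from the first projection.\<close>
  have "vector_space_like (magma_algebra UNIV (\<lambda>u v. u) :: ('k, 'b \<Rightarrow>\<^sub>0 'k) kalg)"
    by (rule vector_space_like_magma_algebra) simp
  then show ?thesis
    unfolding vector_space_like_def magma_algebra_def using assms by simp
qed

lemma lie_polynomials_vector_space_like:
  "vector_space_like (lie_polynomials n :: ('k::field, _) kalg)"
  unfolding lie_polynomials_def
proof (rule vector_space_like_subspace)
  show "0 \<in> evaluate ` (dom (free_nonassoc n) :: (nat magma \<Rightarrow>\<^sub>0 'k) set)"
    using dom_free_nonassoc_closed(1) evaluate_zero by (metis image_eqI)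
qed (intro conjI dom_lie_polynomials_closed; assumption)+

lemma bracket_antisym: "bracket p q = - bracket q p"
  by (simp add: bracket_def)

lemma lie_polynomials_defines_scalars:
  assumes "nonabelian (lie_polynomials n :: ('k::field, _) kalg)"
  shows "\<exists>X. defines_scalars (lie_polynomials n :: ('k, _) kalg) X"
proof (rule exI, rule defines_scalars_lie[OF lie_polynomials_vector_space_like assms])
  let ?B = "evaluate ` (dom (free_nonassoc n) :: (nat magma \<Rightarrow>\<^sub>0 'k) set)"
  show "y = z"
    if "x \<in> dom (lie_polynomials n)" "x' \<in> dom (lie_polynomials n)" "y \<in> dom (lie_polynomials n)"
      "z \<in> dom (lie_polynomials n)" "rmul (lie_polynomials n) x x' \<noteq> rzero (lie_polynomials n)"
      "rmul (lie_polynomials n) x y = rmul (lie_polynomials n) x z"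
      "rmul (lie_polynomials n) x' y = rmul (lie_polynomials n) x' z"
    for x x' y z :: "nat list \<Rightarrow>\<^sub>0 'k"
  proof (rule ccontr)
    assume "y \<noteq> z"
    have B: "x \<in> ?B" "x' \<in> ?B" "y - z \<in> ?B" using that dom_lie_polynomials_closed(3) by simp_all
    \<comment> \<open>Both \<open>x\<close> and \<open>x'\<close> centralize the nonzero element
      \<open>y - z\<close>, so both are multiples of it and commute, contrary to the
      assumption.\<close>
    have "bracket (y - z) x = 0" "bracket (y - z) x' = 0"
      using that(6,7) bracket_antisym[of "y - z" x] bracket_antisym[of "y - z" x']
      by (simp_all add: bracket_diff)
    then obtain a b where "x = pscale a (y - z)" "x' = pscale b (y - z)"
      using lie_polynomial_centralizer[OF B(3) _ B(1)] lie_polynomial_centralizer[OF B(3) _ B(2)] \<open>y \<noteq> z\<close>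
      by auto
    then show False using that(5) by (simp add: bracket_scale)
  qed
  show "\<exists>a. y = scale (lie_polynomials n) a x"
    if "x \<in> dom (lie_polynomials n)" "y \<in> dom (lie_polynomials n)" "x \<noteq> rzero (lie_polynomials n)"
      "rmul (lie_polynomials n) x y = rzero (lie_polynomials n)" for x y :: "nat list \<Rightarrow>\<^sub>0 'k"
    using lie_polynomial_centralizer[of x n y] that by simp
qed (simp_all add: bracket_scale)

section \<open>Torsion-free hyperbolic groups\<close>

locale finitely_generated_group = group G for G (structure) +
  fixes S
  assumes finite_S: "finite S" and S_carrier: "S \<subseteq> carrier G" and generates: "generate G S = carrier G"
begin

abbreviation word_product :: "'a list \<Rightarrow> 'a" where
  "word_product ws \<equiv> foldr (\<otimes>) ws \<one>"

abbreviation letters :: "'a set" where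
  "letters \<equiv> S \<union> m_inv G ` S"

abbreviation len :: "'a \<Rightarrow> nat" where
  "len \<equiv> word_length G S"

lemma letters_carrier: "letters \<subseteq> carrier G"
  using S_carrier by auto

lemma word_product_closed: "set ws \<subseteq> letters \<Longrightarrow> word_product ws \<in> carrier G"
  using letters_carrier by (induction ws) auto

lemma word_product_append:
  "set us \<subseteq> letters \<Longrightarrow> set vs \<subseteq> letters \<Longrightarrow> word_product (us @ vs) = word_product us \<otimes> word_product vs"
proof (induction us)
  case Nil
  then show ?case using word_product_closed by simp
next
  case (Cons a us)
  then have "a \<in> carrier G" "word_product us \<in> carrier G" "word_product vs \<in> carrier G"
    using word_product_closed letters_carrier by auto
  then show ?case using Cons by (simp add: m_assoc)
qed

lemma word_product_exists:
  assumes "g \<in> carrier G" shows "\<exists>ws. set ws \<subseteq> letters \<and> word_product ws = g"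
proof -
  have "g \<in> generate G S" using assms generates by simp
  then show ?thesis
  proof (induction rule: generate.induct)
    case one
    show ?case by (rule exI[of _ "[]"]) simp
  next
    case (incl h)
    then show ?case using S_carrier by (intro exI[of _ "[h]"]) auto
  next
    case (inv h)
    then show ?case using S_carrier by (intro exI[of _ "[inv h]"]) auto
  next
    case (eng h1 h2)
    then obtain us vs where "set us \<subseteq> letters" "word_product us = h1" "set vs \<subseteq> letters" "word_product vs = h2"
      by blast
    then show ?case using word_product_append by (intro exI[of _ "us @ vs"]) auto
  qed
qed

lemma word_length_witness:
  assumes "g \<in> carrier G"
  obtains ws where "length ws = len g" "set ws \<subseteq> letters" "word_product ws = g"
proof -
  have "\<exists>n ws. length ws = n \<and> set ws \<subseteq> letters \<and> word_product ws = g"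
    using word_product_exists[OF assms] by blast
  then have "\<exists>ws. length ws = len g \<and> set ws \<subseteq> letters \<and> word_product ws = g"
    unfolding word_length_def by (rule LeastI_ex)
  then show ?thesis using that by blast
qed

lemma word_length_le: "set ws \<subseteq> letters \<Longrightarrow> word_product ws = g \<Longrightarrow> len g \<le> length ws"
  unfolding word_length_def by (rule Least_le) blast

lemma word_length_one [simp]: "len \<one> = 0"
  using word_length_le[of "[]"] by simp

lemma word_length_mult:
  assumes "g \<in> carrier G" "h \<in> carrier G" shows "len (g \<otimes> h) \<le> len g + len h"
proof -
  obtain us where us: "length us = len g" "set us \<subseteq> letters" "word_product us = g"
    using word_length_witness[OF assms(1)] .
  obtain vs where vs: "length vs = len h" "set vs \<subseteq> letters" "word_product vs = h"
    using word_length_witness[OF assms(2)] .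
  show ?thesis
    using word_length_le[of "us @ vs"] word_product_append[OF us(2) vs(2)] us vs by simp
qed

lemma word_length_inv_le: "g \<in> carrier G \<Longrightarrow> len (inv g) \<le> len g"
proof -
  assume g: "g \<in> carrier G"
  obtain ws where ws: "length ws = len g" "set ws \<subseteq> letters" "word_product ws = g"
    using word_length_witness[OF g] .
  have "set (rev (map (m_inv G) ws)) \<subseteq> letters \<and> word_product (rev (map (m_inv G) ws)) = inv (word_product ws)"
    using ws(2)
  proof (induction ws)
    case (Cons a ws)
    then have a: "a \<in> carrier G" "inv a \<in> letters" "word_product ws \<in> carrier G"
      using word_product_closed letters_carrier S_carrier by auto
    have IH: "set (rev (map (m_inv G) ws)) \<subseteq> letters"
      "word_product (rev (map (m_inv G) ws)) = inv (word_product ws)" using Cons by auto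
    have "word_product (rev (map (m_inv G) ws) @ [inv a]) = inv (word_product ws) \<otimes> inv a"
      using word_product_append[OF IH(1), of "[inv a]"] IH(2) a by simp
    also have "\<dots> = inv (word_product (a # ws))" using a by (simp add: inv_mult_group)
    finally show ?case using IH(1) a(2) by simp
  qed simp
  then show ?thesis using word_length_le[of "rev (map (m_inv G) ws)" "inv g"] ws by simp
qed

lemma word_length_inv: "g \<in> carrier G \<Longrightarrow> len (inv g) = len g"
  using word_length_inv_le[of g] word_length_inv_le[of "inv g"] by simp

lemma finite_word_ball: "finite {g \<in> carrier G. len g \<le> r}"
proof -
  have "finite (word_product ` {ws. set ws \<subseteq> letters \<and> length ws \<le> r})"
    using finite_S by (intro finite_imageI finite_lists_length_le) auto
  moreover have "{g \<in> carrier G. len g \<le> r} \<subseteq> word_product ` {ws. set ws \<subseteq> letters \<and> length ws \<le> r}"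
  proof
    fix g assume "g \<in> {g \<in> carrier G. len g \<le> r}"
    then obtain ws where "length ws = len g" "set ws \<subseteq> letters" "word_product ws = g" "len g \<le> r"
      using word_length_witness[of g] by blast
    then show "g \<in> word_product ` {ws. set ws \<subseteq> letters \<and> length ws \<le> r}" by force
  qed
  ultimately show ?thesis by (rule rev_finite_subset)
qed

text \<open>A shortest word is cut after \<open>k\<close> letters; by the triangle inequality
  neither piece can be shortened. The elements \<open>x\<close> are the points of a geodesic from
  \<open>\<one>\<close> to \<open>g\<close>.\<close>

lemma word_length_split:
  assumes g: "g \<in> carrier G" and "k \<le> len g"
  shows "\<exists>x\<in>carrier G. len x = k \<and> len (inv x \<otimes> g) = len g - k"
proof -
  obtain ws where ws: "length ws = len g" "set ws \<subseteq> letters" "word_product ws = g"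
    using word_length_witness[OF g] .
  define x where "x = word_product (take k ws)"
  define y where "y = word_product (drop k ws)"
  have s: "set (take k ws) \<subseteq> letters" "set (drop k ws) \<subseteq> letters"
    using ws(2) set_take_subset[of k ws] set_drop_subset[of k ws] by blast+
  have xy: "x \<in> carrier G" "y \<in> carrier G" "g = x \<otimes> y"
    using word_product_closed s word_product_append[OF s] ws(3) by (auto simp: x_def y_def)
  have "len x \<le> k" "len y \<le> len g - k"
    using word_length_le[OF s(1) x_def[symmetric]] word_length_le[OF s(2) y_def[symmetric]] ws(1) assms(2) by auto
  moreover have "len g \<le> len x + len y" using word_length_mult[OF xy(1,2)] xy(3) by simp
  ultimately have "len x = k" "len y = len g - k" using assms(2) by auto
  moreover have "inv x \<otimes> g = y" using xy by (simp add: m_assoc[symmetric])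
  ultimately show ?thesis using xy by auto
qed

abbreviation word_distance :: "'a \<Rightarrow> 'a \<Rightarrow> real" where
  "word_distance x y \<equiv> real (word_dist G S x y)"

lemma word_dist_commute: "x \<in> carrier G \<Longrightarrow> y \<in> carrier G \<Longrightarrow> word_dist G S x y = word_dist G S y x"
  using word_length_inv[of "inv x \<otimes> y"] by (simp add: word_dist_def inv_mult_group)

lemma word_dist_left_mult:
  assumes "g \<in> carrier G" "x \<in> carrier G" "y \<in> carrier G"
  shows "word_dist G S (g \<otimes> x) (g \<otimes> y) = word_dist G S x y"
proof -
  have "inv (g \<otimes> x) \<otimes> (g \<otimes> y) = inv x \<otimes> (inv g \<otimes> (g \<otimes> y))"
    using assms by (simp add: inv_mult_group m_assoc)
  also have "inv g \<otimes> (g \<otimes> y) = y" using assms by (simp add: m_assoc[symmetric])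
  finally show ?thesis by (simp add: word_dist_def)
qed

lemma word_dist_one [simp]: "x \<in> carrier G \<Longrightarrow> word_dist G S \<one> x = len x"
  "x \<in> carrier G \<Longrightarrow> word_dist G S x \<one> = len x"
  by (simp_all add: word_dist_def word_length_inv)

lemma word_dist_self [simp]: "x \<in> carrier G \<Longrightarrow> word_dist G S x x = 0"
  by (simp add: word_dist_def)

end

section \<open>Consequences of the four-point condition\<close>

locale hyperbolic_word_metric = finitely_generated_group +
  fixes \<delta> :: real
  assumes four_point: "\<And>w x y z. w \<in> carrier G \<Longrightarrow> x \<in> carrier G \<Longrightarrow> y \<in> carrier G \<Longrightarrow> z \<in> carrier G \<Longrightarrow>
    min (gromov_product G S w x y) (gromov_product G S w y z) - \<delta> \<le> gromov_product G S w x z"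
begin

text \<open>Clearing denominators in the Gromov products gives their symmetric form: of the three
  sums over opposite pairs of four points, the two largest differ by at most
  \<open>2 * \<delta>\<close>.\<close>

lemma four_point_sums:
  assumes "w \<in> carrier G" "x \<in> carrier G" "y \<in> carrier G" "z \<in> carrier G"
  shows "word_distance x z + word_distance y w \<le>
    max (word_distance x y + word_distance z w) (word_distance x w + word_distance y z) + 2 * \<delta>"
  using four_point[OF assms] unfolding gromov_product_def by (auto simp: min_def max_def field_simps split: if_splits)

lemma delta_nonneg: "0 \<le> \<delta>"
  using four_point_sums[OF one_closed one_closed one_closed one_closed] by simp

text \<open>The element \<open>x\<close> is the midpoint of a geodesic from \<open>\<one>\<close> to \<open>g\<close>.\<close>

lemma short_conjugate:
  assumes g: "g \<in> carrier G" and short: "real (len (g \<otimes> g)) \<le> real (len g) + 4 * \<delta>"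
  shows "\<exists>x\<in>carrier G. real (len (inv x \<otimes> (g \<otimes> x))) \<le> 1 + 8 * \<delta>"
proof -
  obtain x where x: "x \<in> carrier G" "len x = len g div 2" "len (inv x \<otimes> g) = len g - len g div 2"
    using word_length_split[OF g, of "len g div 2"] by auto
  have d: "word_dist G S g (g \<otimes> x) = len x" "word_dist G S (g \<otimes> x) (g \<otimes> g) = len (inv x \<otimes> g)"
    "word_dist G S g (g \<otimes> g) = len g" "word_dist G S x g = len (inv x \<otimes> g)"
    using word_dist_left_mult[OF g one_closed x(1)] word_dist_left_mult[OF g x(1) g]
      word_dist_left_mult[OF g one_closed g] g x(1)
    by (simp_all add: word_dist_def[of G S x g])
  have half: "real (len x) \<le> real (len (inv x \<otimes> g))" "real (len (inv x \<otimes> g)) \<le> real (len x) + 1"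
    "real (len x) + real (len (inv x \<otimes> g)) = real (len g)"
    using x by linarith+
  \<comment> \<open>The first inequality bounds the distance from \<open>\<one>\<close> to the
    translated midpoint, and the second uses this to bound how far \<open>g\<close> moves
    \<open>x\<close>. The error consists of \<open>4 * \<delta>\<close> from \<open>short\<close>
    and twice \<open>2 * \<delta>\<close>; the summand 1 accounts for odd
    \<open>len g\<close>.\<close>
  have 1: "word_distance \<one> (g \<otimes> x) + word_distance g (g \<otimes> g) \<le>
    max (word_distance \<one> g + word_distance (g \<otimes> x) (g \<otimes> g)) (word_distance \<one> (g \<otimes> g) + word_distance g (g \<otimes> x)) + 2 * \<delta>"
    using four_point_sums[of "g \<otimes> g" \<one> g "g \<otimes> x"] g x(1) by simp
  have 2: "word_distance x (g \<otimes> x) + word_distance \<one> g \<le>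
    max (word_distance x \<one> + word_distance (g \<otimes> x) g) (word_distance x g + word_distance \<one> (g \<otimes> x)) + 2 * \<delta>"
    using four_point_sums[of g x \<one> "g \<otimes> x"] g x(1) by simp
  have "word_distance x (g \<otimes> x) \<le> 1 + 8 * \<delta>"
    using 1 2 half d short delta_nonneg g x(1) word_dist_commute[of "g \<otimes> x" g]
    by (simp add: max_def split: if_splits)
  then show ?thesis using x(1) by (auto simp: word_dist_def)
qed

text \<open>Translate \<open>x\<close> to \<open>y\<close> so that \<open>\<one>\<close> is the power of \<open>h\<close> nearest to \<open>y\<close>. If \<open>y\<close> is far from \<open>\<one>\<close>, then, since
  \<open>h\<^sup>2 y\<close> is close to \<open>y\<close>, the four-point condition makes \<open>h\<close> nearer to \<open>y\<close> than \<open>\<one>\<close>.\<close>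

lemma bounded_distance_from_powers:
  assumes h: "h \<in> carrier G" and long: "real (len h) + 4 * \<delta> < real (len (h \<otimes> h))"
    and C: "\<And>x. x \<in> carrier G \<Longrightarrow> len (inv x \<otimes> (h \<otimes> h \<otimes> x)) \<le> C"
    and x: "x \<in> carrier G"
  shows "\<exists>k::int. \<exists>y\<in>carrier G. len y \<le> C + len (h \<otimes> h) \<and> x = h [^] k \<otimes> y"
proof -
  \<comment> \<open>A nearest power exists because word distances are natural numbers.\<close>
  obtain k :: int where k: "\<And>j::int. word_dist G S x (h [^] k) \<le> word_dist G S x (h [^] j)"
    using ex_has_least_nat[of "\<lambda>_. True" "0::int" "\<lambda>j. word_dist G S x (h [^] j)"] by auto
  define y where "y = inv (h [^] k) \<otimes> x"
  have y: "y \<in> carrier G" and xy: "x = h [^] k \<otimes> y" using h x by (auto simp: y_def m_assoc[symmetric])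
  have dist: "word_dist G S x (h [^] (k + j)) = word_dist G S y (h [^] j)" for j
    unfolding xy using h y word_dist_left_mult[of "h [^] k" y "h [^] j"] by (simp add: int_pow_mult)
  have min: "len y \<le> word_dist G S y (h [^] j)" for j :: int
    using k[of "k + j"] dist[of 0] dist[of j] y by simp
  let ?h2 = "h \<otimes> h"
  have h2: "?h2 \<in> carrier G" "h [^] (1::int) = h" "h [^] (2::int) = ?h2" "h [^] (-2::int) = inv ?h2"
    using h int_pow_mult[OF h, of 1 1] int_pow_neg[OF h, of 2] by auto
  have d: "word_dist G S (?h2 \<otimes> y) \<one> = word_dist G S y (inv ?h2)"
    "word_dist G S (?h2 \<otimes> y) ?h2 = len y" "word_dist G S h ?h2 = len h"
    using word_dist_left_mult[OF h2(1) y, of "inv ?h2"] word_dist_left_mult[OF h2(1) y one_closed]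
      word_dist_left_mult[OF h one_closed h] h y h2(1)
    by simp_all
  have near: "word_distance y (?h2 \<otimes> y) \<le> C" using C[OF y] by (simp add: word_dist_def)
  \<comment> \<open>When \<open>y\<close> is far away, the first inequality puts \<open>?h2\<close>
    within \<open>len y + 2 * \<delta>\<close> of \<open>y\<close>, because \<open>inv ?h2\<close>
    is not nearer to \<open>y\<close> than \<open>\<one>\<close>. The second concerns
    \<open>h\<close>, which is equidistant from \<open>\<one>\<close> and \<open>?h2\<close>; there
    \<open>long\<close> outweighs the total error \<open>4 * \<delta>\<close>.\<close>
  have 1: "word_distance y ?h2 + word_distance (?h2 \<otimes> y) \<one> \<le>
    max (word_distance y (?h2 \<otimes> y) + word_distance ?h2 \<one>) (word_distance y \<one> + word_distance (?h2 \<otimes> y) ?h2) + 2 * \<delta>"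
    using four_point_sums[of \<one> y "?h2 \<otimes> y" ?h2] h2(1) y by simp
  have 2: "word_distance y h + word_distance \<one> ?h2 \<le>
    max (word_distance y \<one> + word_distance h ?h2) (word_distance y ?h2 + word_distance \<one> h) + 2 * \<delta>"
    using four_point_sums[of ?h2 y \<one> h] h h2(1) y by simp
  have "len y \<le> C + len ?h2"
  proof (rule ccontr)
    assume "\<not> ?thesis"
    then have far: "real C + real (len ?h2) < real (len y)" by linarith
    have m: "real (len y) \<le> word_distance y (inv ?h2)" "real (len y) \<le> word_distance y h"
      using min[of "-2"] min[of 1] h2 by simp_all
    have "word_distance y ?h2 \<le> real (len y) + 2 * \<delta>"
      using 1 d near far m(1) y h2(1) by (simp add: max_def split: if_splits)
    then have "word_distance y h < real (len y)"
      using 2 d long y h h2(1) delta_nonneg by (simp add: max_def split: if_splits)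
    then show False using m(2) by simp
  qed
  then show ?thesis using xy y by blast
qed

end

section \<open>Torsion-free groups with a cyclic subgroup of finite index\<close>

lemma (in group) inv_commutes:
  assumes "x \<otimes> y = y \<otimes> x" "x \<in> carrier G" "y \<in> carrier G"
  shows "inv x \<otimes> y = y \<otimes> inv x"
proof -
  have "inv x \<otimes> (x \<otimes> y) \<otimes> inv x = inv x \<otimes> (y \<otimes> x) \<otimes> inv x" using assms(1) by simp
  moreover have "inv x \<otimes> (x \<otimes> y) = y" using assms(2,3) by (simp add: m_assoc[symmetric])
  moreover have "inv x \<otimes> (y \<otimes> x) \<otimes> inv x = inv x \<otimes> y" using assms(2,3) by (simp add: m_assoc)
  ultimately show ?thesis by simp
qed

lemma (in group) int_pow_commutes:
  assumes "x \<otimes> y = y \<otimes> x" "x \<in> carrier G" "y \<in> carrier G"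
  shows "x [^] (k::int) \<otimes> y = y \<otimes> x [^] k"
proof (cases k rule: int_cases2)
  case (nonneg n)
  then show ?thesis using group_commutes_pow[OF assms] by (simp only: int_pow_int)
next
  case (nonpos n)
  then show ?thesis
    using inv_commutes[OF group_commutes_pow[OF assms]] assms by (simp only: int_pow_neg_int nat_pow_closed)
qed

text \<open>The powers of \<open>x\<close> meet only finitely many cosets, so two of them lie in the
  same one, and their quotient is a power of \<open>a\<close>.\<close>

lemma (in group) power_in_cyclic_subgroup:
  assumes a: "a \<in> carrier G" and F: "finite F" "F \<subseteq> carrier G"
    and cover: "\<And>x. x \<in> carrier G \<Longrightarrow> \<exists>k::int. \<exists>f\<in>F. x = a [^] k \<otimes> f"
    and x: "x \<in> carrier G"
  shows "\<exists>n>0. \<exists>k::int. x [^] (n::nat) = a [^] k"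
proof -
  have "\<forall>i::nat. \<exists>k::int. \<exists>f\<in>F. x [^] i = a [^] k \<otimes> f"
    using cover x by simp
  then obtain k :: "nat \<Rightarrow> int" and f where kf: "\<And>i. f i \<in> F" "\<And>i::nat. x [^] i = a [^] k i \<otimes> f i"
    by metis
  have "range f \<subseteq> F" using kf(1) by auto
  then have "\<not> inj f" using F(1) infinite_UNIV_nat by (metis finite_imageD finite_subset)
  then obtain p q where "f p = f q" "p \<noteq> q" by (auto simp: inj_on_def)
  then obtain i j where ij: "i < j" "f i = f j" by (metis linorder_neqE_nat)
  have fc: "f i \<in> carrier G" using kf(1) F(2) by auto
  have "x [^] (j - i) \<otimes> x [^] i = x [^] j" using ij(1) x by (simp add: nat_pow_mult)
  also have "\<dots> = (a [^] (k j - k i) \<otimes> a [^] k i) \<otimes> f i"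
    using kf(2)[of j] ij(2) a int_pow_mult[OF a, of "k j - k i" "k i"] by simp
  also have "\<dots> = a [^] (k j - k i) \<otimes> x [^] i" using kf(2)[of i] a fc by (simp add: m_assoc)
  finally have "x [^] (j - i) = a [^] (k j - k i)" using x a by simp
  then show ?thesis using ij(1) by (intro exI[of _ "j - i"]) auto
qed

lemma torsion_freeD:
  "torsion_free G \<Longrightarrow> g \<in> carrier G \<Longrightarrow> 0 < n \<Longrightarrow> g [^]\<^bsub>G\<^esub> (n::nat) = \<one>\<^bsub>G\<^esub> \<Longrightarrow> g = \<one>\<^bsub>G\<^esub>"
  unfolding torsion_free_def by blast

lemma (in group) torsion_free_int_pow:
  assumes "torsion_free G" "g \<in> carrier G" "g \<noteq> \<one>" "g [^] (k::int) = \<one>"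
  shows "k = 0"
proof (rule ccontr)
  assume "k \<noteq> 0"
  obtain n :: nat where n: "k = int n \<or> k = - int n" by (metis int_cases2)
  then have "g [^] n = \<one>"
  proof
    assume "k = int n"
    then show ?thesis using assms(4) by (simp only: int_pow_int)
  next
    assume "k = - int n"
    then have "inv (g [^] n) = \<one>" using assms(2,4) int_pow_neg_int by metis
    then show ?thesis using assms(2) by (simp add: inv_eq_1_iff)
  qed
  moreover have "0 < n" using n \<open>k \<noteq> 0\<close> by auto
  ultimately show False using torsion_freeD[OF assms(1,2)] assms(3) by blast
qed

lemma (in group) torsion_free_int_pow_inject:
  assumes "torsion_free G" "g \<in> carrier G" "g \<noteq> \<one>" "g [^] (k::int) = g [^] l"
  shows "k = l"
proof -
  have "g [^] (k - l) = \<one>" using assms(2,4) by (simp add: int_pow_diff)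
  then show ?thesis using torsion_free_int_pow[OF assms(1-3)] by force
qed

text \<open>The map \<open>V\<close> is the transfer homomorphism into the central subgroup generated by \<open>a\<close>, written
  additively.\<close>

lemma (in group) commutative_if_central_cyclic_finite_index:
  assumes tf: "torsion_free G" and a: "a \<in> carrier G" "a \<noteq> \<one>"
    and central: "\<And>x. x \<in> carrier G \<Longrightarrow> a \<otimes> x = x \<otimes> a"
    and F: "finite F" "F \<subseteq> carrier G"
    and cover: "\<And>x. x \<in> carrier G \<Longrightarrow> \<exists>k::int. \<exists>f\<in>F. x = a [^] k \<otimes> f"
    and xy: "x \<in> carrier G" "y \<in> carrier G"
  shows "x \<otimes> y = y \<otimes> x"
proof -
  \<comment> \<open>The choice depends only on the set of admissible \<open>y\<close>, which is the
    coset of \<open>x\<close>. So \<open>rep\<close> picks one representative for each coset of the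
    subgroup generated by \<open>a\<close>.\<close>
  define rep where "rep x = (SOME y. y \<in> carrier G \<and> (\<exists>k::int. x = a [^] k \<otimes> y))" for x
  have rep: "rep x \<in> carrier G \<and> (\<exists>k::int. x = a [^] k \<otimes> rep x)" if "x \<in> carrier G" for x
    unfolding rep_def by (rule someI[of _ x]) (use that in \<open>auto intro: exI[of _ "0::int"]\<close>)
  have ap: "a [^] k \<in> carrier G" for k :: int using a by simp
  have rep_shift: "rep (a [^] k \<otimes> x) = rep x" if x: "x \<in> carrier G" for k :: int and x
  proof -
    have "(\<exists>l::int. a [^] k \<otimes> x = a [^] l \<otimes> y) \<longleftrightarrow> (\<exists>l::int. x = a [^] l \<otimes> y)" if y: "y \<in> carrier G" for y
    proof
      assume "\<exists>l::int. a [^] k \<otimes> x = a [^] l \<otimes> y"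
      then obtain l :: int where "a [^] k \<otimes> x = a [^] l \<otimes> y" ..
      then have "a [^] (-k) \<otimes> (a [^] k \<otimes> x) = a [^] (-k) \<otimes> (a [^] l \<otimes> y)" by simp
      then have "x = a [^] (l - k) \<otimes> y"
        using a(1) x y by (simp add: m_assoc[symmetric] int_pow_mult[symmetric])
      then show "\<exists>l::int. x = a [^] l \<otimes> y" ..
    next
      assume "\<exists>l::int. x = a [^] l \<otimes> y"
      then obtain l :: int where "x = a [^] l \<otimes> y" ..
      then have "a [^] k \<otimes> x = a [^] (k + l) \<otimes> y"
        using a(1) y by (simp add: m_assoc int_pow_mult)
      then show "\<exists>l::int. a [^] k \<otimes> x = a [^] l \<otimes> y" ..
    qed
    then have "(\<lambda>y. y \<in> carrier G \<and> (\<exists>l::int. a [^] k \<otimes> x = a [^] l \<otimes> y)) =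
        (\<lambda>y. y \<in> carrier G \<and> (\<exists>l::int. x = a [^] l \<otimes> y))" by (intro ext conj_cong refl)
    then show ?thesis unfolding rep_def by simp
  qed
  define \<kappa> where "\<kappa> x = (SOME k::int. x = a [^] k \<otimes> rep x)" for x
  have \<kappa>: "x = a [^] \<kappa> x \<otimes> rep x" if "x \<in> carrier G" for x
    unfolding \<kappa>_def using rep[OF that] by (metis (mono_tags, lifting) someI_ex)
  have \<kappa>_unique: "\<kappa> x = k" if "x \<in> carrier G" "x = a [^] k \<otimes> rep x" for x and k :: int
  proof -
    have "a [^] \<kappa> x = a [^] k"
      using \<kappa>[OF that(1)] that(2) rep[OF that(1)] ap by (metis right_cancel)
    then show ?thesis by (rule torsion_free_int_pow_inject[OF tf a])
  qed
  have rep_rep: "rep (rep x) = rep x" if "x \<in> carrier G" for x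
    using rep_shift[of "rep x" "\<kappa> x"] \<kappa>[OF that] rep[OF that] by simp
  define B where "B = rep ` carrier G"
  have B: "b \<in> carrier G" "rep b = b" if "b \<in> B" for b
    using that rep rep_rep by (auto simp: B_def)
  have "B \<subseteq> rep ` F"
  proof
    fix b assume "b \<in> B"
    then obtain x where x: "x \<in> carrier G" "b = rep x" by (auto simp: B_def)
    obtain k :: int and f where kf: "f \<in> F" "x = a [^] k \<otimes> f" using cover[OF x(1)] by blast
    then have "rep x = rep f" using rep_shift[of f k] F(2) by auto
    then show "b \<in> rep ` F" using x kf by blast
  qed
  then have finB: "finite B" using F(1) finite_surj by blast
  \<comment> \<open>This makes \<open>card B\<close> nonzero, so that the transfer is injective on
    the powers of \<open>a\<close>.\<close>
  have "rep \<one> \<in> B" by (simp add: B_def)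
  define V where "V x = (\<Sum>b\<in>B. \<kappa> (b \<otimes> x))" for x
  \<comment> \<open>Right multiplication by \<open>x\<close> permutes the cosets.\<close>
  have bij: "bij_betw (\<lambda>b. rep (b \<otimes> x)) B B" if x: "x \<in> carrier G" for x
  proof -
    have inj: "inj_on (\<lambda>b. rep (b \<otimes> x)) B"
    proof (rule inj_onI)
      fix b b' assume b: "b \<in> B" "b' \<in> B" and eq: "rep (b \<otimes> x) = rep (b' \<otimes> x)"
      have bx: "b \<otimes> x \<in> carrier G" "b' \<otimes> x \<in> carrier G" using B b x by auto
      let ?k = "\<kappa> (b \<otimes> x)" and ?l = "\<kappa> (b' \<otimes> x)" and ?r = "rep (b' \<otimes> x)"
      have r: "?r \<in> carrier G" using rep[OF bx(2)] by simp
      have "b \<otimes> x = a [^] ?k \<otimes> ?r" using \<kappa>[OF bx(1)] eq by simp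
      also have "a [^] ?k = a [^] (?k - ?l) \<otimes> a [^] ?l"
        using a(1) int_pow_mult[OF a(1), of "?k - ?l" ?l] by simp
      also have "a [^] (?k - ?l) \<otimes> a [^] ?l \<otimes> ?r = a [^] (?k - ?l) \<otimes> (b' \<otimes> x)"
        using \<kappa>[OF bx(2)] ap r by (simp add: m_assoc)
      also have "\<dots> = a [^] (?k - ?l) \<otimes> b' \<otimes> x" using ap B(1)[OF b(2)] x by (simp add: m_assoc)
      finally have "b = a [^] (?k - ?l) \<otimes> b'" using ap B b x by simp
      then have "rep b = rep b'" using rep_shift[OF B(1)[OF b(2)], of "?k - ?l"] by simp
      then show "b = b'" using B(2)[OF b(1)] B(2)[OF b(2)] by simp
    qed
    moreover have "(\<lambda>b. rep (b \<otimes> x)) ` B \<subseteq> B"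
    proof (rule image_subsetI)
      fix b assume "b \<in> B"
      then show "rep (b \<otimes> x) \<in> B" unfolding B_def[symmetric] using B(1) x by (simp add: B_def)
    qed
    ultimately show ?thesis using endo_inj_surj[OF finB] by (simp add: bij_betw_def)
  qed
  have V_mult: "V (x \<otimes> y) = V x + V y" if x: "x \<in> carrier G" and y: "y \<in> carrier G" for x y
  proof -
    \<comment> \<open>This is the cocycle identity. Summed over \<open>B\<close>, its last term
      becomes \<open>V y\<close> after reindexing by the permutation \<open>bij\<close>.\<close>
    have "\<kappa> (b \<otimes> (x \<otimes> y)) = \<kappa> (b \<otimes> x) + \<kappa> (rep (b \<otimes> x) \<otimes> y)" if b: "b \<in> B" for b
    proof (rule \<kappa>_unique)
      have bx: "b \<otimes> x \<in> carrier G" using B b x by simp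
      let ?r = "rep (b \<otimes> x)"
      have r: "?r \<in> carrier G" using rep[OF bx] by simp
      then have ry: "?r \<otimes> y \<in> carrier G" using y by simp
      show "b \<otimes> (x \<otimes> y) \<in> carrier G" using B b x y by simp
      have "b \<otimes> (x \<otimes> y) = (b \<otimes> x) \<otimes> y" using B b x y by (simp add: m_assoc)
      also have "\<dots> = a [^] \<kappa> (b \<otimes> x) \<otimes> ?r \<otimes> y" using \<kappa>[OF bx] by simp
      also have "\<dots> = a [^] \<kappa> (b \<otimes> x) \<otimes> (?r \<otimes> y)" using ap r y by (simp add: m_assoc)
      finally have 1: "b \<otimes> (x \<otimes> y) = a [^] \<kappa> (b \<otimes> x) \<otimes> (?r \<otimes> y)" .
      then have "rep (b \<otimes> (x \<otimes> y)) = rep (?r \<otimes> y)" using rep_shift[OF ry] by simp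
      moreover have "a [^] \<kappa> (b \<otimes> x) \<otimes> (?r \<otimes> y) = a [^] (\<kappa> (b \<otimes> x) + \<kappa> (?r \<otimes> y)) \<otimes> rep (?r \<otimes> y)"
      proof -
        have "a [^] (\<kappa> (b \<otimes> x) + \<kappa> (?r \<otimes> y)) \<otimes> rep (?r \<otimes> y) = a [^] \<kappa> (b \<otimes> x) \<otimes> (a [^] \<kappa> (?r \<otimes> y) \<otimes> rep (?r \<otimes> y))"
          using a(1) rep[OF ry] by (simp add: int_pow_mult m_assoc)
        then show ?thesis using \<kappa>[OF ry] by simp
      qed
      ultimately show "b \<otimes> (x \<otimes> y) = a [^] (\<kappa> (b \<otimes> x) + \<kappa> (?r \<otimes> y)) \<otimes> rep (b \<otimes> (x \<otimes> y))"
        using 1 by simp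
    qed
    then have "V (x \<otimes> y) = V x + (\<Sum>b\<in>B. \<kappa> (rep (b \<otimes> x) \<otimes> y))"
      unfolding V_def by (simp add: sum.distrib)
    also have "(\<Sum>b\<in>B. \<kappa> (rep (b \<otimes> x) \<otimes> y)) = V y"
      unfolding V_def by (rule sum.reindex_bij_betw[OF bij[OF x]])
    finally show ?thesis .
  qed
  have a_pow_commute: "b \<otimes> a [^] k = a [^] k \<otimes> b" if b: "b \<in> carrier G" for b and k :: int
    using int_pow_commutes[OF central[OF b] a(1) b] by simp
  have V_power: "V (a [^] k) = k * int (card B)" for k :: int
  proof -
    have "\<kappa> (b \<otimes> a [^] k) = k" if b: "b \<in> B" for b
      using B[OF b] ap rep_shift[of b k] by (intro \<kappa>_unique) (simp_all add: a_pow_commute)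
    then show ?thesis by (simp add: V_def mult.commute)
  qed
  have V_one: "V \<one> = 0" using V_mult[OF one_closed one_closed] by simp
  have V_inv: "V (inv x) = - V x" if "x \<in> carrier G" for x
    using V_mult[of x "inv x"] V_one that by simp
  \<comment> \<open>The homomorphism \<open>V\<close> kills this commutator. Some power of
    \<open>c\<close> is a power of \<open>a\<close>, where \<open>V\<close> is multiplication by the
    index, so that power is trivial and \<open>c\<close> has finite order.\<close>
  define c where "c = x \<otimes> y \<otimes> (inv x \<otimes> inv y)"
  have c: "c \<in> carrier G" using xy by (simp add: c_def)
  have "V c = 0" using xy by (simp add: c_def V_mult V_inv)
  then have Vc: "V (c [^] n) = 0" for n :: nat
    using c by (induction n) (simp_all add: V_one V_mult)
  obtain n :: nat and k :: int where n: "n > 0" "c [^] n = a [^] k"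
    using power_in_cyclic_subgroup[OF a(1) F cover c] by blast
  then have "k * int (card B) = 0" using Vc[of n] V_power[of k] by simp
  then have "k = 0" using \<open>rep \<one> \<in> B\<close> finB by auto
  then have "c = \<one>" using n torsion_freeD[OF tf c] by simp
  then have "c \<otimes> (y \<otimes> x) = y \<otimes> x" using xy by simp
  moreover have "c \<otimes> (y \<otimes> x) = x \<otimes> y"
  proof -
    have "c \<otimes> (y \<otimes> x) = x \<otimes> y \<otimes> (inv x \<otimes> (inv y \<otimes> (y \<otimes> x)))"
      using xy by (simp add: c_def m_assoc)
    also have "inv y \<otimes> (y \<otimes> x) = x" using xy by (simp add: m_assoc[symmetric])
    finally show ?thesis using xy by simp
  qed
  ultimately show ?thesis by simp
qed

text \<open>This reduces to the central case. Each \<open>f\<close> has a nontrivial power among the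
  powers of \<open>h\<close> unless \<open>f = \<one>\<close>, so some positive power of
  \<open>h\<close> commutes with \<open>f\<close>. The product of these exponents over the finite
  set \<open>F\<close> gives a power of \<open>h\<close> that commutes with \<open>F\<close> and
  with \<open>h\<close>, hence with everything.\<close>

lemma (in group) commutative_if_cyclic_finite_index:
  assumes tf: "torsion_free G" and h: "h \<in> carrier G" "h \<noteq> \<one>"
    and F: "finite F" "F \<subseteq> carrier G"
    and cover: "\<And>x. x \<in> carrier G \<Longrightarrow> \<exists>k::int. \<exists>f\<in>F. x = h [^] k \<otimes> f"
    and xy: "x \<in> carrier G" "y \<in> carrier G"
  shows "x \<otimes> y = y \<otimes> x"
proof -
  have "\<exists>j>0. h [^] (j::nat) \<otimes> f = f \<otimes> h [^] j" if f: "f \<in> carrier G" for f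
  proof (cases "f = \<one>")
    case True
    then show ?thesis using h by (intro exI[of _ 1]) simp
  next
    case False
    obtain n :: nat and k :: int where nk: "n > 0" "f [^] n = h [^] k"
      using power_in_cyclic_subgroup[OF h(1) F cover f] by blast
    have "k \<noteq> 0" using torsion_freeD[OF tf f nk(1)] nk(2) False by auto
    have comm: "h [^] k \<otimes> f = f \<otimes> h [^] k" using group_commutes_pow[OF refl f f, of n] nk(2) by simp
    show ?thesis
    proof (cases k rule: int_cases2)
      case (nonneg m)
      then show ?thesis using comm \<open>k \<noteq> 0\<close> by (intro exI[of _ m]) (simp add: int_pow_int)
    next
      case (nonpos m)
      then have "inv (h [^] m) \<otimes> f = f \<otimes> inv (h [^] m)" using comm int_pow_neg_int[OF h(1), of m] by simp
      from inv_commutes[OF this] have "h [^] m \<otimes> f = f \<otimes> h [^] m" using h(1) f by simp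
      then show ?thesis using nonpos \<open>k \<noteq> 0\<close> by (intro exI[of _ m]) simp
    qed
  qed
  then obtain j :: "'a \<Rightarrow> nat" where j: "\<And>f. f \<in> carrier G \<Longrightarrow> j f > 0 \<and> h [^] j f \<otimes> f = f \<otimes> h [^] j f"
    by metis
  define N where "N = (\<Prod>f\<in>F. j f)"
  have "N > 0" unfolding N_def using j F by (intro prod_pos) auto
  define a where "a = h [^] N"
  have a: "a \<in> carrier G" "a \<noteq> \<one>" using h torsion_freeD[OF tf h(1) \<open>N > 0\<close>] by (auto simp: a_def)
  have a_int: "a [^] (k::int) = h [^] (int N * k)" for k
    using h by (simp add: a_def int_pow_pow flip: int_pow_int)
  have aF: "a \<otimes> f = f \<otimes> a" if f: "f \<in> F" for f
  proof -
    have fc: "f \<in> carrier G" using f F by auto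
    obtain q where q: "N = j f * q" using dvd_prodI[OF F(1) f, of j] by (auto simp: N_def)
    have "a = (h [^] j f) [^] q" using h by (simp add: a_def q nat_pow_pow)
    moreover have "(h [^] j f) [^] q \<otimes> f = f \<otimes> (h [^] j f) [^] q"
      using group_commutes_pow[of "h [^] j f" f q] j[OF fc] h(1) fc by simp
    ultimately show ?thesis by simp
  qed
  have central: "a \<otimes> x = x \<otimes> a" if x: "x \<in> carrier G" for x
  proof -
    obtain k :: int and f where kf: "f \<in> F" "x = h [^] k \<otimes> f" using cover[OF x] by blast
    have fc: "f \<in> carrier G" using kf F by auto
    have hk: "a \<otimes> h [^] k = h [^] k \<otimes> a"
      using h by (simp add: a_def flip: int_pow_int int_pow_mult) (simp add: add.commute)
    have "a \<otimes> x = a \<otimes> h [^] k \<otimes> f" using a h fc kf by (simp add: m_assoc)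
    also have "\<dots> = h [^] k \<otimes> (a \<otimes> f)" using a h fc hk by (simp add: m_assoc)
    also have "\<dots> = x \<otimes> a" using a h fc kf aF[OF kf(1)] by (simp add: m_assoc)
    finally show ?thesis .
  qed
  \<comment> \<open>Passing from \<open>h\<close> to its power \<open>a\<close> multiplies the
    number of representatives by at most \<open>N\<close>: the remainder of the exponent modulo
    \<open>N\<close> is absorbed into them.\<close>
  define F' where "F' = (\<lambda>(r, f). h [^] r \<otimes> f) ` ({0..<int N} \<times> F)"
  have "finite F'" "F' \<subseteq> carrier G" using F h by (auto simp: F'_def)
  moreover have "\<exists>k::int. \<exists>f\<in>F'. x = a [^] k \<otimes> f" if x: "x \<in> carrier G" for x
  proof -
    obtain k :: int and f where kf: "f \<in> F" "x = h [^] k \<otimes> f" using cover[OF x] by blast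
    have fc: "f \<in> carrier G" using kf F by auto
    have "h [^] k = h [^] (int N * (k div int N)) \<otimes> h [^] (k mod int N)"
      using int_pow_mult[OF h(1), of "int N * (k div int N)" "k mod int N"] by simp
    then have "x = a [^] (k div int N) \<otimes> (h [^] (k mod int N) \<otimes> f)"
      using kf h fc by (simp add: a_int m_assoc)
    moreover have "h [^] (k mod int N) \<otimes> f \<in> F'"
      unfolding F'_def using kf(1) \<open>N > 0\<close> by force
    ultimately show ?thesis by blast
  qed
  ultimately show ?thesis
    using commutative_if_central_cyclic_finite_index[OF tf a central _ _ _ xy, of F'] by blast
qed

lemma (in group) conjugate_pow:
  assumes "g \<in> carrier G" "x \<in> carrier G"
  shows "inv x \<otimes> (g [^] (n::nat) \<otimes> x) = (inv x \<otimes> (g \<otimes> x)) [^] n"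
proof (induction n)
  case (Suc n)
  have "(inv x \<otimes> (g \<otimes> x)) [^] Suc n = inv x \<otimes> (g [^] n \<otimes> x) \<otimes> (inv x \<otimes> (g \<otimes> x))"
    using Suc by simp
  also have "\<dots> = inv x \<otimes> (g [^] n \<otimes> (x \<otimes> (inv x \<otimes> (g \<otimes> x))))" using assms by (simp add: m_assoc)
  also have "x \<otimes> (inv x \<otimes> (g \<otimes> x)) = g \<otimes> x" using assms by (simp add: m_assoc[symmetric])
  finally show ?case using assms by (simp add: m_assoc)
qed (use assms in simp)

text \<open>If the lengths of the powers of \<open>g\<close> hardly grow under squaring, every power has a short conjugate; as
  \<open>g\<close> has finitely many conjugates, two different powers of one of them coincide. Otherwise some power
  of \<open>g\<close> generates a subgroup of finite index.\<close>

lemma (in hyperbolic_word_metric) commutative_if_finite_conjugacy_class: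
  assumes tf: "torsion_free G" and g: "g \<in> carrier G" "g \<noteq> \<one>"
    and fin: "finite ((\<lambda>x. inv x \<otimes> (g \<otimes> x)) ` carrier G)" (is "finite ?C")
    and xy: "x \<in> carrier G" "y \<in> carrier G"
  shows "x \<otimes> y = y \<otimes> x"
proof (cases "\<forall>n::nat. 0 < n \<longrightarrow> real (len (g [^] n \<otimes> g [^] n)) \<le> real (len (g [^] n)) + 4 * \<delta>")
  case True
  define B where "B = {b \<in> carrier G. len b \<le> nat \<lfloor>1 + 8 * \<delta>\<rfloor>}"
  define C where "C = ?C"
  have finC: "finite C" and finB: "finite B" using fin finite_word_ball by (simp_all add: C_def B_def)
  have ex: "\<exists>c\<in>C. c [^] n \<in> B" if "0 < n" for n :: nat
  proof -
    obtain x where x: "x \<in> carrier G" "real (len (inv x \<otimes> (g [^] n \<otimes> x))) \<le> 1 + 8 * \<delta>"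
      using short_conjugate[OF nat_pow_closed[OF g(1), of n]] True \<open>0 < n\<close> by blast
    have "len (inv x \<otimes> (g [^] n \<otimes> x)) \<le> nat \<lfloor>1 + 8 * \<delta>\<rfloor>"
      using x(2) by (rule le_nat_floor)
    then have "(inv x \<otimes> (g \<otimes> x)) [^] n \<in> B"
      using x(1) g(1) conjugate_pow[OF g(1) x(1), of n, symmetric] by (simp add: B_def)
    moreover have "inv x \<otimes> (g \<otimes> x) \<in> C" unfolding C_def using x(1) by (rule imageI)
    ultimately show ?thesis ..
  qed
  \<comment> \<open>The shift to \<open>Suc n\<close> lets \<open>n\<close> range over all natural
    numbers, while only positive powers are considered.\<close>
  have "\<forall>n. \<exists>c. c \<in> C \<and> c [^] Suc n \<in> B" using ex[OF zero_less_Suc] by blast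
  from choice[OF this] obtain c where c: "\<forall>n. c n \<in> C \<and> c n [^] Suc n \<in> B" ..
  \<comment> \<open>Pigeonhole on the conjugate together with the value of its power: a repetition
    yields two equal powers of one and the same element.\<close>
  have "range (\<lambda>n. (c n, c n [^] Suc n)) \<subseteq> C \<times> B" using c by (intro image_subsetI SigmaI) simp_all
  then have "finite (range (\<lambda>n. (c n, c n [^] Suc n)))"
    by (rule finite_subset) (intro finite_cartesian_product finB finC)
  then have "\<not> inj (\<lambda>n. (c n, c n [^] Suc n))" using infinite_UNIV_nat finite_imageD by blast
  then obtain p q where "p \<noteq> q" "c p = c q" "c p [^] Suc p = c q [^] Suc q" by (auto simp: inj_on_def)
  then obtain i j where ij: "i < j" "c i = c j" "c j [^] Suc i = c j [^] Suc j"
    by (metis linorder_neqE_nat)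
  obtain x where x: "x \<in> carrier G" "c j = inv x \<otimes> (g \<otimes> x)" using spec[OF c, of j] unfolding C_def by blast
  have cj: "c j \<in> carrier G" using x g(1) by simp
  have "c j [^] (j - i) \<otimes> c j [^] Suc i = c j [^] Suc j"
    using ij(1) cj nat_pow_mult[of "c j" "j - i" "Suc i"] by simp
  then have "c j [^] (j - i) = \<one>" using ij(3) cj by (metis l_cancel_one nat_pow_closed r_cancel_one')
  then have "c j = \<one>" using torsion_freeD[OF tf cj, of "j - i"] ij(1) by simp
  then have "x \<otimes> (inv x \<otimes> (g \<otimes> x)) = x" using x by simp
  then have "g = \<one>" using x(1) g(1) by (simp add: m_assoc[symmetric])
  then show ?thesis using g(2) by simp
next
  case False
  then obtain n :: nat where n: "0 < n"
    and long: "real (len (g [^] n)) + 4 * \<delta> < real (len (g [^] n \<otimes> g [^] n))" by (auto simp: not_le)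
  define h where "h = g [^] n"
  have h: "h \<in> carrier G" "h \<noteq> \<one>" using g torsion_freeD[OF tf g(1) n] by (auto simp: h_def)
  \<comment> \<open>A conjugate of \<open>h \<otimes> h\<close> is a power of a conjugate of
    \<open>g\<close>, so there are finitely many of them and their lengths are bounded.\<close>
  have "finite (len ` (\<lambda>c. c [^] (n + n)) ` ?C)" by (rule finite_imageI, rule finite_imageI, rule fin)
  then obtain C where C: "\<forall>m\<in>len ` (\<lambda>c. c [^] (n + n)) ` ?C. m \<le> C"
    unfolding finite_nat_set_iff_bounded_le ..
  have "len (inv x \<otimes> (h \<otimes> h \<otimes> x)) \<le> C" if x: "x \<in> carrier G" for x
  proof -
    have "inv x \<otimes> (h \<otimes> h \<otimes> x) = (inv x \<otimes> (g \<otimes> x)) [^] (n + n)"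
      using conjugate_pow[OF g(1) x, of "n + n"] g(1) by (simp add: h_def nat_pow_mult)
    then show ?thesis using C x by simp
  qed
  from bounded_distance_from_powers[OF h(1) _ this] long
  have "\<exists>k::int. \<exists>f\<in>{y \<in> carrier G. len y \<le> C + len (h \<otimes> h)}. x = h [^] k \<otimes> f" if "x \<in> carrier G" for x
    using that unfolding h_def by blast
  from commutative_if_cyclic_finite_index[OF tf h finite_word_ball _ this xy] show ?thesis by blast
qed

section \<open>The center of the group algebra\<close>

lemma group_algebra_defines_scalars:
  fixes G :: "('g, 'z) monoid_scheme"
  assumes hyp: "hyperbolic_group G" and tf: "torsion_free G"
    and nc: "noncommutative (group_algebra G :: ('k::field, 'g \<Rightarrow>\<^sub>0 'k) kalg)"
  shows "\<exists>X. defines_scalars (group_algebra G :: ('k, 'g \<Rightarrow>\<^sub>0 'k) kalg) X"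
proof -
  obtain S \<delta> where S: "group G" "finite S" "S \<subseteq> carrier G" "generate G S = carrier G"
    "\<forall>w\<in>carrier G. \<forall>x\<in>carrier G. \<forall>y\<in>carrier G. \<forall>z\<in>carrier G.
      min (gromov_product G S w x y) (gromov_product G S w y z) - \<delta> \<le> gromov_product G S w x z"
    using hyp unfolding hyperbolic_group_def by blast
  interpret group G by (rule S(1))
  interpret hyperbolic_word_metric G S \<delta>
    using S(2-4) S(5)[rule_format] by unfold_locales
  have not_commutative: "\<exists>x\<in>carrier G. \<exists>y\<in>carrier G. x \<otimes>\<^bsub>G\<^esub> y \<noteq> y \<otimes>\<^bsub>G\<^esub> x"
  proof (rule ccontr)
    assume "\<not> ?thesis"
    then have comm: "x \<otimes>\<^bsub>G\<^esub> y = y \<otimes>\<^bsub>G\<^esub> x" if "x \<in> carrier G" "y \<in> carrier G" for x y using that by blast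
    have "convolve (mult G) p q = convolve (mult G) q p"
      if "Poly_Mapping.keys p \<subseteq> carrier G" "Poly_Mapping.keys q \<subseteq> carrier G" for p q :: "'g \<Rightarrow>\<^sub>0 'k"
      using that by (intro convolve_commute comm) auto
    then show False using nc by (auto simp: noncommutative_def group_algebra_def magma_algebra_def)
  qed
  have center: "Poly_Mapping.keys p \<subseteq> {\<one>\<^bsub>G\<^esub>}"
    if p: "Poly_Mapping.keys p \<subseteq> carrier G"
      and central: "\<And>u. u \<in> carrier G \<Longrightarrow>
        convolve (mult G) p (Poly_Mapping.single u 1) = convolve (mult G) (Poly_Mapping.single u 1) p"
    for p :: "'g \<Rightarrow>\<^sub>0 'k"
  proof
    fix u assume u: "u \<in> Poly_Mapping.keys p"
    then have uc: "u \<in> carrier G" using p by auto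
    have "inv\<^bsub>G\<^esub> x \<otimes>\<^bsub>G\<^esub> (u \<otimes>\<^bsub>G\<^esub> x) \<in> Poly_Mapping.keys p" if x: "x \<in> carrier G" for x
    proof -
      let ?x = "Poly_Mapping.single x 1 :: 'g \<Rightarrow>\<^sub>0 'k"
      let ?v = "inv\<^bsub>G\<^esub> x \<otimes>\<^bsub>G\<^esub> (u \<otimes>\<^bsub>G\<^esub> x)"
      have v: "?v \<in> carrier G" "x \<otimes>\<^bsub>G\<^esub> ?v = u \<otimes>\<^bsub>G\<^esub> x" using x uc by (auto simp: m_assoc[symmetric])
      \<comment> \<open>The product of \<open>u\<close> and \<open>x\<close> is also that of
        \<open>x\<close> and \<open>?v\<close>. Comparing coefficients there on both sides shows
        that a central element is constant on conjugacy classes, so its finite support contains all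
        conjugates of \<open>u\<close>.\<close>
      have "Poly_Mapping.lookup (convolve (mult G) p ?x) (u \<otimes>\<^bsub>G\<^esub> x) =
          Poly_Mapping.lookup p u * Poly_Mapping.lookup ?x x"
        by (rule lookup_convolve_unique) (use p uc x in auto)
      moreover have "Poly_Mapping.lookup (convolve (mult G) ?x p) (x \<otimes>\<^bsub>G\<^esub> ?v) =
          Poly_Mapping.lookup ?x x * Poly_Mapping.lookup p ?v"
        by (rule lookup_convolve_unique) (use p uc x v(1) in \<open>auto split: if_splits\<close>)
      ultimately have "Poly_Mapping.lookup p ?v = Poly_Mapping.lookup p u"
        using central[OF x] v(2) by simp
      then show ?thesis using u by (simp add: in_keys_iff)
    qed
    then have "finite ((\<lambda>x. inv\<^bsub>G\<^esub> x \<otimes>\<^bsub>G\<^esub> (u \<otimes>\<^bsub>G\<^esub> x)) ` carrier G)"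
      by (intro finite_subset[OF _ finite_keys[of p]]) auto
    then show "u \<in> {\<one>\<^bsub>G\<^esub>}"
      using commutative_if_finite_conjugacy_class[OF tf uc] not_commutative by blast
  qed
  show ?thesis
    unfolding group_algebra_def
    by (rule exI, rule defines_scalars_magma_algebra_with_unit[where e = "\<one>\<^bsub>G\<^esub>"]) (use center in auto)
qed

section \<open>Transport along isomorphisms of algebras\<close>

lemma zero_interpretable_if_alg_iso:
  assumes "alg_iso A L" "vector_space_like A" "defines_scalars A X"
  shows "zero_interpretable (field_with_action L) L"
proof -
  obtain h where h: "bij_betw h (dom A) (dom L)" "h (rzero A) = rzero L"
    "\<And>x y. x \<in> dom A \<Longrightarrow> y \<in> dom A \<Longrightarrow> h (radd A x y) = radd L (h x) (h y)"
    "\<And>x y. x \<in> dom A \<Longrightarrow> y \<in> dom A \<Longrightarrow> h (rmul A x y) = rmul L (h x) (h y)"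
    "\<And>c x. x \<in> dom A \<Longrightarrow> h (scale A c x) = scale L c (h x)"
    using assms(1) unfolding alg_iso_def by auto
  show ?thesis
    by (rule interpretable_if_defines_scalars[OF vector_space_like_iso[OF h assms(2)]
          defines_scalars_iso[OF h assms(2,3)]])
qed

lemma noncommutative_alg_iso:
  assumes "alg_iso A L" "noncommutative L" shows "noncommutative A"
proof -
  obtain h where h: "bij_betw h (dom A) (dom L)"
    "\<forall>x\<in>dom A. \<forall>y\<in>dom A. h (rmul A x y) = rmul L (h x) (h y)"
    using assms(1) unfolding alg_iso_def by auto
  obtain x y where xy: "x \<in> dom L" "y \<in> dom L" "rmul L x y \<noteq> rmul L y x"
    using assms(2) unfolding noncommutative_def by auto
  obtain x' y' where "x' \<in> dom A" "y' \<in> dom A" "x = h x'" "y = h y'"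
    using bij_betw_imp_surj_on[OF h(1)] xy(1,2) by (metis imageE)
  then show ?thesis using h(2) xy(3) unfolding noncommutative_def by metis
qed

lemma nonabelian_alg_iso:
  assumes "alg_iso A L" "nonabelian L" shows "nonabelian A"
proof -
  obtain h where h: "bij_betw h (dom A) (dom L)" "h (rzero A) = rzero L"
    "\<forall>x\<in>dom A. \<forall>y\<in>dom A. h (rmul A x y) = rmul L (h x) (h y)"
    using assms(1) unfolding alg_iso_def by auto
  obtain x y where xy: "x \<in> dom L" "y \<in> dom L" "rmul L x y \<noteq> rzero L"
    using assms(2) unfolding nonabelian_def by auto
  obtain x' y' where "x' \<in> dom A" "y' \<in> dom A" "x = h x'" "y = h y'"
    using bij_betw_imp_surj_on[OF h(1)] xy(1,2) by (metis imageE)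
  then show ?thesis using h(2,3) xy(3) unfolding nonabelian_def by metis
qed

lemma alg_iso_trans:
  assumes "alg_iso A B" "alg_iso B C" shows "alg_iso A C"
proof -
  obtain g where g: "bij_betw g (dom A) (dom B)" "g (rzero A) = rzero B"
    "\<forall>x\<in>dom A. \<forall>y\<in>dom A. g (radd A x y) = radd B (g x) (g y)"
    "\<forall>x\<in>dom A. \<forall>y\<in>dom A. g (rmul A x y) = rmul B (g x) (g y)"
    "\<forall>c. \<forall>x\<in>dom A. g (scale A c x) = scale B c (g x)"
    using assms(1) unfolding alg_iso_def by auto
  obtain h where h: "bij_betw h (dom B) (dom C)" "h (rzero B) = rzero C"
    "\<forall>x\<in>dom B. \<forall>y\<in>dom B. h (radd B x y) = radd C (h x) (h y)"
    "\<forall>x\<in>dom B. \<forall>y\<in>dom B. h (rmul B x y) = rmul C (h x) (h y)"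
    "\<forall>c. \<forall>x\<in>dom B. h (scale B c x) = scale C c (h x)"
    using assms(2) unfolding alg_iso_def by auto
  have gB: "g x \<in> dom B" if "x \<in> dom A" for x using g(1) that by (auto simp: bij_betw_def)
  show ?thesis
    unfolding alg_iso_def
    by (intro exI[of _ "h \<circ> g"] conjI bij_betw_trans[OF g(1) h(1)])
      (use g(2-5) h(2-5) gB in \<open>simp_all\<close>)
qed

theorem theorem3p5:
  fixes L :: "('k::field, 'a) kalg"
  assumes
    "noncommutative L \<and>
       ((\<exists>n. alg_iso (free_assoc_unital n) L) \<or>
        (\<exists>n. alg_iso (free_assoc_nonunital n) L) \<or>
        (\<exists>G :: 'g monoid. hyperbolic_group G \<and> torsion_free G \<and> alg_iso (group_algebra G) L)) \<or>
     nonabelian L \<and> (\<exists>n. alg_iso (free_lie n) L)"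
  shows "zero_interpretable (field_with_action L) L"
  using assms
proof (elim disjE conjE exE)
  fix n assume "noncommutative L" and iso: "alg_iso (free_assoc_unital n) L"
  then obtain X where X: "defines_scalars (free_assoc_unital n :: ('k, _) kalg) X"
    using free_assoc_unital_defines_scalars noncommutative_alg_iso by blast
  have "vector_space_like (free_assoc_unital n :: ('k, _) kalg)"
    unfolding free_assoc_unital_def by (rule vector_space_like_magma_algebra) auto
  with iso show ?thesis using X by (rule zero_interpretable_if_alg_iso)
next
  fix n assume "noncommutative L" and iso: "alg_iso (free_assoc_nonunital n) L"
  then obtain X where X: "defines_scalars (free_assoc_nonunital n :: ('k, _) kalg) X"
    using free_assoc_nonunital_defines_scalars noncommutative_alg_iso by blast
  have "vector_space_like (free_assoc_nonunital n :: ('k, _) kalg)"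
    unfolding free_assoc_nonunital_def by (rule vector_space_like_magma_algebra) auto
  with iso show ?thesis using X by (rule zero_interpretable_if_alg_iso)
next
  fix G :: "'g monoid"
  assume "noncommutative L" "hyperbolic_group G" "torsion_free G" and iso: "alg_iso (group_algebra G) L"
  then obtain X where X: "defines_scalars (group_algebra G :: ('k, _) kalg) X"
    using group_algebra_defines_scalars noncommutative_alg_iso by blast
  have "group G" using \<open>hyperbolic_group G\<close> by (simp add: hyperbolic_group_def)
  then interpret group G .
  have "vector_space_like (group_algebra G :: ('k, _) kalg)"
    unfolding group_algebra_def by (rule vector_space_like_magma_algebra) auto
  with iso show ?thesis using X by (rule zero_interpretable_if_alg_iso)
next
  fix n assume "nonabelian L" "alg_iso (free_lie n) L"
  \<comment> \<open>The quotient is exchanged for its model inside the free associative algebra,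
    where leading words are available.\<close>
  then have iso: "alg_iso (lie_polynomials n) L" and "nonabelian L"
    using alg_iso_trans alg_iso_free_lie by blast+
  then obtain X where X: "defines_scalars (lie_polynomials n :: ('k, _) kalg) X"
    using lie_polynomials_defines_scalars nonabelian_alg_iso by blast
  show ?thesis
    using iso lie_polynomials_vector_space_like X by (rule zero_interpretable_if_alg_iso)
qed

end
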